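(* (1) Let $H$ be a braided coalgebra and $V$ a braided right $H$-comodule with coaction $\rho_R:V\to V\otimes H$ (and braiding $\Psi_{HV}$). Let $U\subset H'$ and $W\subset V'$ be non-degenerate subspaces such that $\Psi_{UU}$, $\Psi_{HW}^\circ$, $\Psi_{UV}^\circ$ and $\Psi_{WU}^\bullet$ are bijective. Assume that $U$ is a (unital) subalgebra of $H'$ with respect to the product $\underline m$. Consider $\nu_R:W\otimes U\to V'$, $\nu_R(e\otimes f)(v):=(f\otimes e)\big(\Psi_{HV}^{-1}(\rho_R(v))\big)$. If $\nu_R(W\otimes U)\subset W$, then $\nu_R$ is a right $U$-action on $W$ making $W$ a braided right $U$-module with respect to the braidings $\Psi_{UU}^{-1}$ on $U$ and $\Psi_{WU}^\bullet$. (2) Let $H$ be a braided coalgebra and $V$ a braided left $H$-comodule with coaction $\rho_L:V\to H\otimes V$ (and braiding $\Psi_{VH}$). Let $U\subset H'$ and $W\subset V'$ be non-degenerate subspaces such that $\Psi_{UU}$, $\Psi_{WH}^\circ$, $\Psi_{VU}^\circ$ and $\Psi_{UW}^\bullet$ are bijective, with $U$ a (unital) subalgebra of $H'$ with respect to $\underline m$. Consider $\nu_L:U\otimes W\to V'$, $\nu_L(f\otimes e)(v):=(e\otimes f)\big(\Psi_{VH}^{-1}(\rho_L(v))\big)$. If $\nu_L(U\otimes W)\subset W$, then $\nu_L$ is a left $U$-action on $W$ making $W$ a braided left $U$-module with respect to the braidings $\Psi_{UU}^{-1}$ on $U$ and $\Psi_{UW}^\bullet$.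
   Context: All vector spaces are over a fixed field $\mathbb K$, $\otimes$ is the algebraic tensor product, $X'$ is the full linear dual of $X$, and composition of maps is written by juxtaposition. A braiding on $V$ is a bijective linear map $\Psi_{VV}:V\otimes V\to V\otimes V$ with $(\Psi_{VV}\otimes\mathrm{id})(\mathrm{id}\otimes\Psi_{VV})(\Psi_{VV}\otimes\mathrm{id})=(\mathrm{id}\otimes\Psi_{VV})(\Psi_{VV}\otimes\mathrm{id})(\mathrm{id}\otimes\Psi_{VV})$; $V$ is then a braided vector space. Let $\Psi_{VW}:V\otimes W\to W\otimes V$ be bijective and linear. If $V$ is braided, $W$ is a left $V$-braided vector space if $(\Psi_{VW}\otimes\mathrm{id})(\mathrm{id}\otimes\Psi_{VW})(\Psi_{VV}\otimes\mathrm{id})=(\mathrm{id}\otimes\Psi_{VV})(\Psi_{VW}\otimes\mathrm{id})(\mathrm{id}\otimes\Psi_{VW})$. If $W$ is braided, $V$ is a right $W$-braided vector space if $(\mathrm{id}\otimes\Psi_{VW})(\Psi_{VW}\otimes\mathrm{id})(\mathrm{id}\otimes\Psi_{WW})=(\Psi_{WW}\otimes\mathrm{id})(\mathrm{id}\otimes\Psi_{VW})(\Psi_{VW}\otimes\mathrm{id})$. Compatibility of $\Psi=\Psi_{VW}$: with the multiplication of an algebra $V$: $\Psi(m_V\otimes\mathrm{id})=(\mathrm{id}\otimes m_V)(\Psi\otimes\mathrm{id})(\mathrm{id}\otimes\Psi)$ and $\Psi(1\otimes w)=w\otimes1$ if $1\in V$; with the multiplication of an algebra $W$: $\Psi(\mathrm{id}\otimes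 m_W)=(m_W\otimes\mathrm{id})(\mathrm{id}\otimes\Psi)(\Psi\otimes\mathrm{id})$ and $\Psi(v\otimes1)=1\otimes v$ if $1\in W$; with the comultiplication of a coalgebra $V$: $(\mathrm{id}\otimes\Delta)\Psi=(\Psi\otimes\mathrm{id})(\mathrm{id}\otimes\Psi)(\Delta\otimes\mathrm{id})$ and $(\mathrm{id}\otimes\varepsilon)\Psi=\varepsilon\otimes\mathrm{id}$; with the comultiplication of a coalgebra $W$: $(\Delta\otimes\mathrm{id})\Psi=(\mathrm{id}\otimes\Psi)(\Psi\otimes\mathrm{id})(\mathrm{id}\otimes\Delta)$ and $(\varepsilon\otimes\mathrm{id})\Psi=\mathrm{id}\otimes\varepsilon$. A braided (co)algebra is a (co)algebra with a braiding satisfying both compatibility conditions with its (co)multiplication. Braided modules over a braided (unital) algebra $(A,m)$: a braided left $A$-module is a left $A$-braided vector space $W$ with $\Psi_{AW}$ compatible with $m$ and a map $\nu_L:A\otimes W\to W$ with $\nu_L(\mathrm{id}\otimes\nu_L)=\nu_L(m\otimes\mathrm{id})$, $\nu_L(1\otimes w)=w$ (if $1\in A$), $\Psi_{AW}(\mathrm{id}\otimes\nu_L)=(\nu_L\otimes\mathrm{id})(\mathrm{id}\otimes\Psi_{AW})(\Psi_{AA}\otimes\mathrm{id})$. A braided right $A$-module is a right $A$-braided vector space $V$ with $\Psi_{VA}$ compatible with $m$ and $\nu_R:V\otimes A\to V$ with $\nu_R(\nu_R\otimes\mathrm{id})=\nu_R(\mathrm{id}\otimes m)$, $\nu_R(v\otimes1)=v$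 (if $1\in A$), $\Psi_{VA}(\nu_R\otimes\mathrm{id})=(\mathrm{id}\otimes\nu_R)(\Psi_{VA}\otimes\mathrm{id})(\mathrm{id}\otimes\Psi_{AA})$. Braided comodules over a braided coalgebra $H$: a braided right $H$-comodule is a left $H$-braided vector space $V$ with $\Psi_{HV}:H\otimes V\to V\otimes H$ compatible with the comultiplication of $H$ and $\rho_R:V\to V\otimes H$ with $(\rho_R\otimes\mathrm{id})\rho_R=(\mathrm{id}\otimes\Delta)\rho_R$, $(\mathrm{id}\otimes\varepsilon)\rho_R=\mathrm{id}$, $(\rho_R\otimes\mathrm{id})\Psi_{HV}=(\mathrm{id}\otimes\Psi_{HH})(\Psi_{HV}\otimes\mathrm{id})(\mathrm{id}\otimes\rho_R)$. A braided left $H$-comodule is a right $H$-braided vector space $V$ with $\Psi_{VH}:V\otimes H\to H\otimes V$ compatible with the comultiplication of $H$ and $\rho_L:V\to H\otimes V$ with $(\mathrm{id}\otimes\rho_L)\rho_L=(\Delta\otimes\mathrm{id})\rho_L$, $(\varepsilon\otimes\mathrm{id})\rho_L=\mathrm{id}$, $(\mathrm{id}\otimes\rho_L)\Psi_{VH}=(\Psi_{HH}\otimes\mathrm{id})(\mathrm{id}\otimes\Psi_{VH})(\rho_L\otimes\mathrm{id})$. Duality notation: $\langle f,a\rangle=\langle a,f\rangle=f(a)$. A subspace of $X'$ is non-degenerate if it separates the points of $X$. $\langle\langle\xi\otimes\eta,x\otimes y\rangle\rangle:=\langle\xi,y\rangle\langle\eta,x\rangle$. Tensor products are embedded into duals by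 $(\xi\otimes\eta)(x\otimes y)=\langle\xi,x\rangle\langle\eta,y\rangle$. Product on $H'$: $\underline m(f\otimes g)(a):=\langle\langle f\otimes g,\Psi_{HH}^{-1}(\Delta(a))\rangle\rangle$, with unit $\varepsilon$. Define, for $a,b\in H$, $v\in V$ and functionals $f,g$ on $H$, $e$ on $V$: $\Psi_{UU}(f\otimes g)(b\otimes a):=\langle\langle f\otimes g,\Psi_{HH}(a\otimes b)\rangle\rangle$ (values in $(H\otimes H)'\supset U\otimes U$); for $V$ left $H$-braided: $\Psi_{HW}^\circ(a\otimes e)(v\otimes f):=\langle\langle e\otimes f,\Psi_{HV}^{-1}(v\otimes a)\rangle\rangle$, $e\in W$, $f\in H'$ (values in $(V\otimes H')'\supset W\otimes H$); $\Psi_{UV}^\circ(f\otimes v)(e\otimes a):=\langle\langle e\otimes f,\Psi_{HV}^{-1}(v\otimes a)\rangle\rangle$, $f\in U$, $e\in V'$ (values in $(V'\otimes H)'\supset V\otimes U$); $\Psi_{WU}^\bullet(e\otimes f)(a\otimes v):=\langle\langle a\otimes e,\Psi_{UV}^\circ(f\otimes v)\rangle\rangle$, $e\in W$, $f\in U$ (values in $(H\otimes V)'\supset U\otimes W$); for $V$ right $H$-braided: $\Psi_{WH}^\circ(e\otimes a)(f\otimes v):=\langle\langle f\otimes e,\Psi_{VH}^{-1}(a\otimes v)\rangle\rangle$, $e\in W$, $f\in H'$ (values in $(H'\otimes V)'\supset H\otimes W$); $\Psi_{VU}^\circ(v\otimes f)(a\otimes e):=\langle\langle f\otimes e,\Psi_{VH}^{-1}(a\otimes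 v)\rangle\rangle$, $f\in U$, $e\in V'$ (values in $(H\otimes V')'\supset U\otimes V$); $\Psi_{UW}^\bullet(f\otimes e)(v\otimes a):=\langle\langle e\otimes a,\Psi_{VU}^\circ(v\otimes f)\rangle\rangle$, $e\in W$, $f\in U$ (values in $(V\otimes H)'\supset W\otimes U$). Such a map $\Psi_{XY}$ is called bijective if it is a bijection $X\otimes Y\to Y\otimes X$. *)

theory Defs
  imports Complex_Main "HOL-Library.Function_Algebras"
begin

section \<open>Vector spaces, linear maps, duals\<close>

text \<open>A vector space over the field \<open>'k\<close> is a linear subspace \<open>carr A\<close> of an ambient
  \<^locale>\<open>vector_space\<close>. Carriers are needed because subspaces of duals (with their own tensor
  products) are objects of the theory; a full type is the case \<open>carr A = UNIV\<close>.
  Maps matter only on carriers.\<close>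

record ('k, 'a) vspace =
  carr :: "'a set"
  smul :: "'k \<Rightarrow> 'a \<Rightarrow> 'a"

definition is_vspace :: "('k::field, 'a::ab_group_add) vspace \<Rightarrow> bool" where
  "is_vspace A \<longleftrightarrow> vector_space (smul A) \<and> module.subspace (smul A) (carr A)"

definition linear_map ::
  "('k::field, 'a::ab_group_add) vspace \<Rightarrow> ('k, 'b::ab_group_add) vspace \<Rightarrow> ('a \<Rightarrow> 'b) \<Rightarrow> bool" where
  "linear_map A B f \<longleftrightarrow>
     (\<forall>x\<in>carr A. f x \<in> carr B) \<and>
     (\<forall>x\<in>carr A. \<forall>y\<in>carr A. f (x + y) = f x + f y) \<and>
     (\<forall>c. \<forall>x\<in>carr A. f (smul A c x) = smul B c (f x))"

definition linear_bij ::
  "('k::field, 'a::ab_group_add) vspace \<Rightarrow> ('k, 'b::ab_group_add) vspace \<Rightarrow> ('a \<Rightarrow> 'b) \<Rightarrow> bool" where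
  "linear_bij A B f \<longleftrightarrow> linear_map A B f \<and> bij_betw f (carr A) (carr B)"

definition bilinear_map ::
  "('k::field, 'a::ab_group_add) vspace \<Rightarrow> ('k, 'b::ab_group_add) vspace \<Rightarrow>
   ('k, 'c::ab_group_add) vspace \<Rightarrow> ('a \<Rightarrow> 'b \<Rightarrow> 'c) \<Rightarrow> bool" where
  "bilinear_map A B C \<beta> \<longleftrightarrow>
     (\<forall>x\<in>carr A. linear_map B C (\<beta> x)) \<and> (\<forall>y\<in>carr B. linear_map A C (\<lambda>x. \<beta> x y))"

definition ground :: "('k::field, 'k) vspace" where
  "ground = \<lparr>carr = UNIV, smul = (*)\<rparr>"

definition fscale :: "'k::field \<Rightarrow> ('x \<Rightarrow> 'k) \<Rightarrow> ('x \<Rightarrow> 'k)" where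
  "fscale c f = (\<lambda>x. c * f x)"

text \<open>Functionals on \<open>A\<close> are normalised to be \<open>0\<close> off the carrier, so that equality of functionals
  is equality of HOL functions.\<close>

definition dual :: "('k::field, 'a::ab_group_add) vspace \<Rightarrow> ('k, 'a \<Rightarrow> 'k) vspace" where
  "dual A = \<lparr>carr = {f. linear_map A ground f \<and> (\<forall>x. x \<notin> carr A \<longrightarrow> f x = 0)}, smul = fscale\<rparr>"

definition subspace_of ::
  "('k::field, 'a::ab_group_add) vspace \<Rightarrow> ('k, 'a) vspace \<Rightarrow> bool" where
  "subspace_of U X \<longleftrightarrow> is_vspace U \<and> smul U = smul X \<and> carr U \<subseteq> carr X"

definition nondegenerate_subspace ::
  "('k::field, 'a \<Rightarrow> 'k) vspace \<Rightarrow> ('k, 'a::ab_group_add) vspace \<Rightarrow> bool" where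
  "nondegenerate_subspace U X \<longleftrightarrow> subspace_of U (dual X) \<and>
     (\<forall>x\<in>carr X. \<forall>y\<in>carr X. (\<forall>f\<in>carr U. f x = f y) \<longrightarrow> x = y)"


section \<open>The algebraic tensor product\<close>

text \<open>\<open>A \<otimes> B\<close> is realised as the span of the evaluations \<open>\<beta> \<mapsto> \<beta> a b\<close> in the space of
  scalar functions of bilinear forms \<open>\<beta>\<close> on \<open>A \<times> B\<close>. Over a field this has the universal property of
  the tensor product (lemma \<open>tensor_universal\<close> below), and everything further is defined through
  that property only.\<close>

type_synonym ('k, 'a, 'b) tensor = "('a \<Rightarrow> 'b \<Rightarrow> 'k) \<Rightarrow> 'k"

definition tens ::
  "('k::field, 'a::ab_group_add) vspace \<Rightarrow> ('k, 'b::ab_group_add) vspace \<Rightarrow>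
   'a \<Rightarrow> 'b \<Rightarrow> ('k, 'a, 'b) tensor" where
  "tens A B a b = (\<lambda>\<beta>. if bilinear_map A B ground \<beta> then \<beta> a b else 0)"

definition tensor ::
  "('k::field, 'a::ab_group_add) vspace \<Rightarrow> ('k, 'b::ab_group_add) vspace \<Rightarrow>
   ('k, ('k, 'a, 'b) tensor) vspace"  (infixl \<open>\<otimes>\<close> 70) where
  "A \<otimes> B = \<lparr>carr = module.span fscale {tens A B a b | a b. a \<in> carr A \<and> b \<in> carr B},
             smul = fscale\<rparr>"

text \<open>The linear map \<open>A \<otimes> B \<rightarrow> C\<close> with \<open>a \<otimes> b \<mapsto> \<beta> a b\<close>, extended by \<open>0\<close> off the carrier.\<close>

definition lift ::
  "('k::field, 'a::ab_group_add) vspace \<Rightarrow> ('k, 'b::ab_group_add) vspace \<Rightarrow>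
   ('k, 'c::ab_group_add) vspace \<Rightarrow> ('a \<Rightarrow> 'b \<Rightarrow> 'c) \<Rightarrow> ('k, 'a, 'b) tensor \<Rightarrow> 'c" where
  "lift A B C \<beta> = (THE h. linear_map (A \<otimes> B) C h \<and>
      (\<forall>a\<in>carr A. \<forall>b\<in>carr B. h (tens A B a b) = \<beta> a b) \<and>
      (\<forall>t. t \<notin> carr (A \<otimes> B) \<longrightarrow> h t = 0))"

lemma vector_space_fscale: "vector_space fscale"
  by unfold_locales (auto simp: fscale_def fun_eq_iff algebra_simps)

lemma smul_tensor [simp]: "smul (A \<otimes> B) = fscale"
  by (simp add: tensor_def)

lemma is_vspace_tensor:
  fixes A :: "('k::field, 'a::ab_group_add) vspace" and B :: "('k, 'b::ab_group_add) vspace"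
  shows "is_vspace (A \<otimes> B)"
proof -
  interpret vector_space "fscale :: 'k \<Rightarrow> (('a \<Rightarrow> 'b \<Rightarrow> 'k) \<Rightarrow> 'k) \<Rightarrow> _"
    by (rule vector_space_fscale)
  show ?thesis
    by (simp add: is_vspace_def tensor_def vector_space_fscale subspace_span)
qed

lemma tens_in:
  fixes A :: "('k::field, 'a::ab_group_add) vspace" and B :: "('k, 'b::ab_group_add) vspace"
  shows "a \<in> carr A \<Longrightarrow> b \<in> carr B \<Longrightarrow> tens A B a b \<in> carr (A \<otimes> B)"
proof -
  interpret vector_space "fscale :: 'k \<Rightarrow> (('a \<Rightarrow> 'b \<Rightarrow> 'k) \<Rightarrow> 'k) \<Rightarrow> _"
    by (rule vector_space_fscale)
  show "a \<in> carr A \<Longrightarrow> b \<in> carr B \<Longrightarrow> tens A B a b \<in> carr (A \<otimes> B)"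
    by (auto simp: tensor_def intro!: span_base)
qed

lemma tensor_induct [consumes 1, case_names zero step]:
  fixes A :: "('k::field, 'a::ab_group_add) vspace" and B :: "('k, 'b::ab_group_add) vspace"
  assumes "t \<in> carr (A \<otimes> B)" and "P 0"
    and step: "\<And>c a b s. a \<in> carr A \<Longrightarrow> b \<in> carr B \<Longrightarrow> s \<in> carr (A \<otimes> B) \<Longrightarrow> P s \<Longrightarrow>
                 P (fscale c (tens A B a b) + s)"
  shows "P t"
proof -
  interpret vector_space "fscale :: 'k \<Rightarrow> (('a \<Rightarrow> 'b \<Rightarrow> 'k) \<Rightarrow> 'k) \<Rightarrow> _"
    by (rule vector_space_fscale)
  let ?S = "{tens A B a b | a b. a \<in> carr A \<and> b \<in> carr B}"
  have "t \<in> span ?S" using assms(1) by (simp add: tensor_def)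
  then have "t \<in> span ?S \<and> P t"
  proof (induction rule: span_induct_alt)
    case base
    show ?case by (intro conjI span_zero assms(2))
  next
    case (step c x y)
    then obtain a b where ab: "x = tens A B a b" "a \<in> carr A" "b \<in> carr B" by auto
    have "P (fscale c x + y)"
      using assms(3)[OF ab(2,3)] step ab(1) by (simp add: tensor_def)
    then show ?case
      using step(1,2) \<open>P (fscale c x + y)\<close> span_add[OF span_scale[OF span_base[OF step(1)]]] by blast
  qed
  then show ?thesis ..
qed

lemma functional_separation:
  assumes "vector_space s" and "y \<noteq> 0"
  shows "\<exists>\<phi>. Vector_Spaces.linear s (*) \<phi> \<and> \<phi> y \<noteq> 0"
proof -
  interpret vector_space s by fact
  let ?B = "extend_basis {y}"
  have ind: "independent {y}" using assms(2) by (simp add: dependent_single)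
  have B: "independent ?B" "span ?B = UNIV" "y \<in> ?B"
    using independent_extend_basis[OF ind] span_extend_basis[OF ind] extend_basis_superset[OF ind]
    by auto
  have "representation ?B y y = 1" using representation_basis[OF B(1,3)] by simp
  then show ?thesis using linear_representation[OF B(1,2), of y]
    by (intro exI[of _ "\<lambda>v. representation ?B v y"]) simp
qed

theorem tensor_universal:
  fixes A :: "('k::field, 'a::ab_group_add) vspace" and B :: "('k, 'b::ab_group_add) vspace"
    and C :: "('k, 'c::ab_group_add) vspace"
  assumes C: "is_vspace C" and \<beta>: "bilinear_map A B C \<beta>"
  shows "\<exists>!h. linear_map (A \<otimes> B) C h \<and>
      (\<forall>a\<in>carr A. \<forall>b\<in>carr B. h (tens A B a b) = \<beta> a b) \<and>
      (\<forall>t. t \<notin> carr (A \<otimes> B) \<longrightarrow> h t = 0)" (is "\<exists>!h. ?Q h")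
proof -
  interpret T: vector_space "fscale :: 'k \<Rightarrow> (('a \<Rightarrow> 'b \<Rightarrow> 'k) \<Rightarrow> 'k) \<Rightarrow> _"
    by (rule vector_space_fscale)
  interpret C: vector_space "smul C" using C by (simp add: is_vspace_def)
  have Csub: "C.subspace (carr C)" using C by (simp add: is_vspace_def)
  have Tsub: "T.subspace (carr (A \<otimes> B))" using is_vspace_tensor[of A B] by (simp add: is_vspace_def)
  define L where "L = {\<phi>. Vector_Spaces.linear (smul C) ((*) :: 'k \<Rightarrow> 'k \<Rightarrow> 'k) \<phi>}"
  have add: "\<phi> (x + y) = \<phi> x + \<phi> y" and scl: "\<phi> (smul C c x) = c * \<phi> x"
    and phi0: "\<phi> 0 = 0" and diff: "\<phi> (x - y) = \<phi> x - \<phi> y" if "\<phi> \<in> L" for \<phi> x y c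
  proof -
    interpret Vector_Spaces.linear "smul C" "(*)" \<phi> using that by (simp add: L_def)
    show "\<phi> (x + y) = \<phi> x + \<phi> y" "\<phi> (smul C c x) = c * \<phi> x" "\<phi> 0 = 0" "\<phi> (x - y) = \<phi> x - \<phi> y"
      by (rule add scale zero diff)+
  qed
  have sep: "x = y" if "\<And>\<phi>. \<phi> \<in> L \<Longrightarrow> \<phi> x = \<phi> y" for x y
    using functional_separation[OF C.vector_space_axioms, of "x - y"] that diff
    by (force simp: L_def)
  have bil: "bilinear_map A B ground (\<lambda>a b. \<phi> (\<beta> a b))" if "\<phi> \<in> L" for \<phi>
    using \<beta> add[OF that] scl[OF that] by (auto simp: bilinear_map_def linear_map_def ground_def)
  have "\<exists>y\<in>carr C. \<forall>\<phi>\<in>L. \<phi> y = t (\<lambda>a b. \<phi> (\<beta> a b))" if "t \<in> carr (A \<otimes> B)" for t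
    using that
  proof (induction rule: tensor_induct)
    case zero
    show ?case using Csub phi0 by (intro bexI[of _ 0]) (auto simp: C.subspace_0)
  next
    case (step c a b s)
    then obtain y where y: "y \<in> carr C" "\<forall>\<phi>\<in>L. \<phi> y = s (\<lambda>a b. \<phi> (\<beta> a b))" by blast
    have "\<beta> a b \<in> carr C" using \<beta> step by (auto simp: bilinear_map_def linear_map_def)
    then show ?case using y Csub
      by (intro bexI[of _ "smul C c (\<beta> a b) + y"])
        (auto simp: add scl fscale_def tens_def bil C.subspace_add C.subspace_scale)
  qed
  then obtain g where g: "\<And>t. t \<in> carr (A \<otimes> B) \<Longrightarrow> g t \<in> carr C"
      "\<And>t \<phi>. t \<in> carr (A \<otimes> B) \<Longrightarrow> \<phi> \<in> L \<Longrightarrow> \<phi> (g t) = t (\<lambda>a b. \<phi> (\<beta> a b))"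
    by metis
  define h where "h t = (if t \<in> carr (A \<otimes> B) then g t else 0)" for t
  have "?Q h"
  proof (intro conjI ballI allI impI)
    show "linear_map (A \<otimes> B) C h"
      unfolding linear_map_def
    proof (intro conjI ballI allI)
      fix x y assume xy: "x \<in> carr (A \<otimes> B)" "y \<in> carr (A \<otimes> B)"
      then have "x + y \<in> carr (A \<otimes> B)" using Tsub by (simp add: T.subspace_add)
      then show "h (x + y) = h x + h y"
        using xy by (intro sep) (simp add: h_def g add)
    next
      fix c x assume x: "x \<in> carr (A \<otimes> B)"
      then have "fscale c x \<in> carr (A \<otimes> B)" using Tsub by (simp add: T.subspace_scale)
      then show "h (smul (A \<otimes> B) c x) = smul C c (h x)"
        using x by (intro sep) (simp add: h_def g scl, simp add: fscale_def)
    qed (simp add: h_def g)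
  next
    fix a b assume "a \<in> carr A" "b \<in> carr B"
    then show "h (tens A B a b) = \<beta> a b"
      by (intro sep) (simp add: h_def g tens_in, simp add: tens_def bil)
  qed (simp add: h_def)
  moreover have "h1 = h2" if 1: "?Q h1" and 2: "?Q h2" for h1 h2
  proof
    fix t
    show "h1 t = h2 t"
    proof (cases "t \<in> carr (A \<otimes> B)")
      case True
      then show ?thesis
      proof (induction rule: tensor_induct)
        case zero
        have z: "fscale 0 0 = (0 :: ('a \<Rightarrow> 'b \<Rightarrow> 'k) \<Rightarrow> 'k)" by simp
        have "(0 :: ('a \<Rightarrow> 'b \<Rightarrow> 'k) \<Rightarrow> 'k) \<in> carr (A \<otimes> B)" using Tsub by (simp add: T.subspace_0)
        then have "h1 (fscale 0 0) = smul C 0 (h1 0)" "h2 (fscale 0 0) = smul C 0 (h2 0)"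
          using 1 2 unfolding linear_map_def smul_tensor by blast+
        then show ?case using z by (metis C.scale_zero_left)
      next
        case (step c a b s)
        have t: "tens A B a b \<in> carr (A \<otimes> B)" using step by (simp add: tens_in)
        then have fs: "fscale c (tens A B a b) \<in> carr (A \<otimes> B)"
          using Tsub by (simp add: T.subspace_scale)
        have "h (fscale c (tens A B a b) + s) = smul C c (\<beta> a b) + h s" if "?Q h" for h
          using that fs t step(1-3) unfolding linear_map_def smul_tensor by metis
        then show ?case using 1 2 step(4) by metis
      qed
    qed (use 1 2 in simp)
  qed
  ultimately show ?thesis by blast
qed

lemma lift:
  assumes "is_vspace C" and "bilinear_map A B C \<beta>"
  shows linear_map_lift: "linear_map (A \<otimes> B) C (lift A B C \<beta>)"
    and lift_tens: "\<And>a b. a \<in> carr A \<Longrightarrow> b \<in> carr B \<Longrightarrow> lift A B C \<beta> (tens A B a b) = \<beta> a b"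
    and lift_off: "\<And>t. t \<notin> carr (A \<otimes> B) \<Longrightarrow> lift A B C \<beta> t = 0"
  using theI'[OF tensor_universal[OF assms]] unfolding lift_def[symmetric] by blast+


section \<open>Maps between tensor products\<close>

definition tensor_map ::
  "('k::field, 'a::ab_group_add) vspace \<Rightarrow> ('k, 'b::ab_group_add) vspace \<Rightarrow>
   ('k, 'c::ab_group_add) vspace \<Rightarrow> ('k, 'd::ab_group_add) vspace \<Rightarrow>
   ('a \<Rightarrow> 'c) \<Rightarrow> ('b \<Rightarrow> 'd) \<Rightarrow> ('k, 'a, 'b) tensor \<Rightarrow> ('k, 'c, 'd) tensor" where
  "tensor_map A B C D f g = lift A B (C \<otimes> D) (\<lambda>a b. tens C D (f a) (g b))"

text \<open>\<open>f \<otimes> id : X \<otimes> C \<rightarrow> Y \<otimes> C\<close> and \<open>id \<otimes> f : C \<otimes> X \<rightarrow> C \<otimes> Y\<close> for \<open>f : X \<rightarrow> Y\<close>.\<close>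

definition map_id where
  "map_id X Y C f = tensor_map X C Y C f (\<lambda>c. c)"

definition id_map where
  "id_map C X Y f = tensor_map C X C Y (\<lambda>c. c) f"

definition assoc ::
  "('k::field, 'a::ab_group_add) vspace \<Rightarrow> ('k, 'b::ab_group_add) vspace \<Rightarrow>
   ('k, 'c::ab_group_add) vspace \<Rightarrow>
   ('k, ('k, 'a, 'b) tensor, 'c) tensor \<Rightarrow> ('k, 'a, ('k, 'b, 'c) tensor) tensor" where
  "assoc A B C = lift (A \<otimes> B) C (A \<otimes> (B \<otimes> C))
     (\<lambda>t c. lift A B (A \<otimes> (B \<otimes> C)) (\<lambda>a b. tens A (B \<otimes> C) a (tens B C b c)) t)"

definition unassoc ::
  "('k::field, 'a::ab_group_add) vspace \<Rightarrow> ('k, 'b::ab_group_add) vspace \<Rightarrow>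
   ('k, 'c::ab_group_add) vspace \<Rightarrow>
   ('k, 'a, ('k, 'b, 'c) tensor) tensor \<Rightarrow> ('k, ('k, 'a, 'b) tensor, 'c) tensor" where
  "unassoc A B C = lift A (B \<otimes> C) (A \<otimes> B \<otimes> C)
     (\<lambda>a t. lift B C (A \<otimes> B \<otimes> C) (\<lambda>b c. tens (A \<otimes> B) C (tens A B a b) c) t)"

text \<open>Triple tensor products are always bracketed to the left. \<open>on12\<close> and \<open>on23\<close> are \<open>\<Psi> \<otimes> id\<close> and
  \<open>id \<otimes> \<Psi>\<close> there, for a map that exchanges the two factors \<open>X\<close> and \<open>Y\<close>.\<close>

definition on12 ::
  "('k::field, 'a::ab_group_add) vspace \<Rightarrow> ('k, 'b::ab_group_add) vspace \<Rightarrow>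
   ('k, 'c::ab_group_add) vspace \<Rightarrow> (('k, 'a, 'b) tensor \<Rightarrow> ('k, 'b, 'a) tensor) \<Rightarrow>
   ('k, ('k, 'a, 'b) tensor, 'c) tensor \<Rightarrow> ('k, ('k, 'b, 'a) tensor, 'c) tensor" where
  "on12 X Y C \<Psi> = map_id (X \<otimes> Y) (Y \<otimes> X) C \<Psi>"

definition on23 ::
  "('k::field, 'c::ab_group_add) vspace \<Rightarrow> ('k, 'a::ab_group_add) vspace \<Rightarrow>
   ('k, 'b::ab_group_add) vspace \<Rightarrow> (('k, 'a, 'b) tensor \<Rightarrow> ('k, 'b, 'a) tensor) \<Rightarrow>
   ('k, ('k, 'c, 'a) tensor, 'b) tensor \<Rightarrow> ('k, ('k, 'c, 'b) tensor, 'a) tensor" where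
  "on23 C X Y \<Psi> t = unassoc C Y X (id_map C (X \<otimes> Y) (Y \<otimes> X) \<Psi> (assoc C X Y t))"

text \<open>\<open>id \<otimes> \<epsilon> : A \<otimes> B \<rightarrow> A\<close> and \<open>\<epsilon> \<otimes> id : A \<otimes> B \<rightarrow> B\<close> for a functional \<open>\<epsilon>\<close>, using
  \<open>A \<otimes> \<K> = A\<close> and \<open>\<K> \<otimes> B = B\<close>.\<close>

definition id_fun where
  "id_fun A B \<epsilon> = lift A B A (\<lambda>a b. smul A (\<epsilon> b) a)"

definition fun_id where
  "fun_id A B \<epsilon> = lift A B B (\<lambda>a b. smul B (\<epsilon> a) b)"


section \<open>Braided vector spaces\<close>

definition braiding where
  "braiding V \<Psi> \<longleftrightarrow> is_vspace V \<and> linear_bij (V \<otimes> V) (V \<otimes> V) \<Psi> \<and>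
     (\<forall>t\<in>carr (V \<otimes> V \<otimes> V).
        on12 V V V \<Psi> (on23 V V V \<Psi> (on12 V V V \<Psi> t)) =
        on23 V V V \<Psi> (on12 V V V \<Psi> (on23 V V V \<Psi> t)))"

definition left_braided where
  "left_braided V \<Psi>VV W \<Psi>VW \<longleftrightarrow>
     braiding V \<Psi>VV \<and> is_vspace W \<and> linear_bij (V \<otimes> W) (W \<otimes> V) \<Psi>VW \<and>
     (\<forall>t\<in>carr (V \<otimes> V \<otimes> W).
        on12 V W V \<Psi>VW (on23 V V W \<Psi>VW (on12 V V W \<Psi>VV t)) =
        on23 W V V \<Psi>VV (on12 V W V \<Psi>VW (on23 V V W \<Psi>VW t)))"

definition right_braided where
  "right_braided W \<Psi>WW V \<Psi>VW \<longleftrightarrow>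
     braiding W \<Psi>WW \<and> is_vspace V \<and> linear_bij (V \<otimes> W) (W \<otimes> V) \<Psi>VW \<and>
     (\<forall>t\<in>carr (V \<otimes> W \<otimes> W).
        on23 W V W \<Psi>VW (on12 V W W \<Psi>VW (on23 V W W \<Psi>WW t)) =
        on12 W W V \<Psi>WW (on23 W V W \<Psi>VW (on12 V W W \<Psi>VW t)))"


section \<open>Braided algebras and coalgebras\<close>

text \<open>Algebras need not be unital: the unit is an option, \<open>None\<close> meaning that there is none.\<close>

definition algebra ::
  "('k::field, 'a::ab_group_add) vspace \<Rightarrow> (('k, 'a, 'a) tensor \<Rightarrow> 'a) \<Rightarrow> 'a option \<Rightarrow> bool" where
  "algebra A m u \<longleftrightarrow> is_vspace A \<and> linear_map (A \<otimes> A) A m \<and>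
     (\<forall>t\<in>carr (A \<otimes> A \<otimes> A).
        m (map_id (A \<otimes> A) A A m t) = m (id_map A (A \<otimes> A) A m (assoc A A A t))) \<and>
     (\<forall>e. u = Some e \<longrightarrow> e \<in> carr A \<and>
        (\<forall>a\<in>carr A. m (tens A A e a) = a \<and> m (tens A A a e) = a))"

definition coalgebra where
  "coalgebra H \<Delta> \<epsilon> \<longleftrightarrow> is_vspace H \<and> linear_map H (H \<otimes> H) \<Delta> \<and> \<epsilon> \<in> carr (dual H) \<and>
     (\<forall>a\<in>carr H.
        map_id H (H \<otimes> H) H \<Delta> (\<Delta> a) = unassoc H H H (id_map H H (H \<otimes> H) \<Delta> (\<Delta> a)) \<and>
        id_fun H H \<epsilon> (\<Delta> a) = a \<and> fun_id H H \<epsilon> (\<Delta> a) = a)"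

text \<open>Compatibility of \<open>\<Psi> : V \<otimes> W \<rightarrow> W \<otimes> V\<close> with a structure on the left factor \<open>V\<close>
  (\<open>_left\<close>) or on the right factor \<open>W\<close> (\<open>_right\<close>).\<close>

definition compat_mult_left where
  "compat_mult_left V m u W \<Psi> \<longleftrightarrow>
     (\<forall>t\<in>carr (V \<otimes> V \<otimes> W).
        \<Psi> (map_id (V \<otimes> V) V W m t) =
        id_map W (V \<otimes> V) V m (assoc W V V (on12 V W V \<Psi> (on23 V V W \<Psi> t)))) \<and>
     (\<forall>e. u = Some e \<longrightarrow> (\<forall>w\<in>carr W. \<Psi> (tens V W e w) = tens W V w e))"

definition compat_mult_right where
  "compat_mult_right V W m u \<Psi> \<longleftrightarrow>
     (\<forall>t\<in>carr (V \<otimes> W \<otimes> W).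
        \<Psi> (id_map V (W \<otimes> W) W m (assoc V W W t)) =
        map_id (W \<otimes> W) W V m (on23 W V W \<Psi> (on12 V W W \<Psi> t))) \<and>
     (\<forall>e. u = Some e \<longrightarrow> (\<forall>v\<in>carr V. \<Psi> (tens V W v e) = tens W V e v))"

definition compat_comult_left where
  "compat_comult_left V \<Delta> \<epsilon> W \<Psi> \<longleftrightarrow>
     (\<forall>t\<in>carr (V \<otimes> W).
        unassoc W V V (id_map W V (V \<otimes> V) \<Delta> (\<Psi> t)) =
          on12 V W V \<Psi> (on23 V V W \<Psi> (map_id V (V \<otimes> V) W \<Delta> t)) \<and>
        id_fun W V \<epsilon> (\<Psi> t) = fun_id V W \<epsilon> t)"

definition compat_comult_right where
  "compat_comult_right V W \<Delta> \<epsilon> \<Psi> \<longleftrightarrow>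
     (\<forall>t\<in>carr (V \<otimes> W).
        map_id W (W \<otimes> W) V \<Delta> (\<Psi> t) =
          on23 W V W \<Psi> (on12 V W W \<Psi> (unassoc V W W (id_map V W (W \<otimes> W) \<Delta> t))) \<and>
        fun_id W V \<epsilon> (\<Psi> t) = id_fun V W \<epsilon> t)"

definition braided_algebra where
  "braided_algebra A m u \<Psi> \<longleftrightarrow> algebra A m u \<and> braiding A \<Psi> \<and>
     compat_mult_left A m u A \<Psi> \<and> compat_mult_right A A m u \<Psi>"

definition braided_coalgebra where
  "braided_coalgebra H \<Delta> \<epsilon> \<Psi> \<longleftrightarrow> coalgebra H \<Delta> \<epsilon> \<and> braiding H \<Psi> \<and>
     compat_comult_left H \<Delta> \<epsilon> H \<Psi> \<and> compat_comult_right H H \<Delta> \<epsilon> \<Psi>"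


section \<open>Braided modules and comodules\<close>

definition braided_left_module where
  "braided_left_module A m u \<Psi>AA W \<Psi>AW \<nu> \<longleftrightarrow>
     braided_algebra A m u \<Psi>AA \<and> left_braided A \<Psi>AA W \<Psi>AW \<and> compat_mult_left A m u W \<Psi>AW \<and>
     linear_map (A \<otimes> W) W \<nu> \<and>
     (\<forall>t\<in>carr (A \<otimes> A \<otimes> W).
        \<nu> (id_map A (A \<otimes> W) W \<nu> (assoc A A W t)) = \<nu> (map_id (A \<otimes> A) A W m t)) \<and>
     (\<forall>e. u = Some e \<longrightarrow> (\<forall>w\<in>carr W. \<nu> (tens A W e w) = w)) \<and>
     (\<forall>t\<in>carr (A \<otimes> A \<otimes> W).
        \<Psi>AW (id_map A (A \<otimes> W) W \<nu> (assoc A A W t)) =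
        map_id (A \<otimes> W) W A \<nu> (on23 A A W \<Psi>AW (on12 A A W \<Psi>AA t)))"

definition braided_right_module where
  "braided_right_module A m u \<Psi>AA V \<Psi>VA \<nu> \<longleftrightarrow>
     braided_algebra A m u \<Psi>AA \<and> right_braided A \<Psi>AA V \<Psi>VA \<and> compat_mult_right V A m u \<Psi>VA \<and>
     linear_map (V \<otimes> A) V \<nu> \<and>
     (\<forall>t\<in>carr (V \<otimes> A \<otimes> A).
        \<nu> (map_id (V \<otimes> A) V A \<nu> t) = \<nu> (id_map V (A \<otimes> A) A m (assoc V A A t))) \<and>
     (\<forall>e. u = Some e \<longrightarrow> (\<forall>v\<in>carr V. \<nu> (tens V A v e) = v)) \<and>
     (\<forall>t\<in>carr (V \<otimes> A \<otimes> A).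
        \<Psi>VA (map_id (V \<otimes> A) V A \<nu> t) =
        id_map A (V \<otimes> A) V \<nu> (assoc A V A (on12 V A A \<Psi>VA (on23 V A A \<Psi>AA t))))"

definition braided_right_comodule where
  "braided_right_comodule H \<Delta> \<epsilon> \<Psi>HH V \<Psi>HV \<rho> \<longleftrightarrow>
     braided_coalgebra H \<Delta> \<epsilon> \<Psi>HH \<and> left_braided H \<Psi>HH V \<Psi>HV \<and> compat_comult_left H \<Delta> \<epsilon> V \<Psi>HV \<and>
     linear_map V (V \<otimes> H) \<rho> \<and>
     (\<forall>v\<in>carr V.
        map_id V (V \<otimes> H) H \<rho> (\<rho> v) = unassoc V H H (id_map V H (H \<otimes> H) \<Delta> (\<rho> v)) \<and>
        id_fun V H \<epsilon> (\<rho> v) = v) \<and>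
     (\<forall>t\<in>carr (H \<otimes> V).
        map_id V (V \<otimes> H) H \<rho> (\<Psi>HV t) =
        on23 V H H \<Psi>HH (on12 H V H \<Psi>HV (unassoc H V H (id_map H V (V \<otimes> H) \<rho> t))))"

definition braided_left_comodule where
  "braided_left_comodule H \<Delta> \<epsilon> \<Psi>HH V \<Psi>VH \<rho> \<longleftrightarrow>
     braided_coalgebra H \<Delta> \<epsilon> \<Psi>HH \<and> right_braided H \<Psi>HH V \<Psi>VH \<and> compat_comult_right V H \<Delta> \<epsilon> \<Psi>VH \<and>
     linear_map V (H \<otimes> V) \<rho> \<and>
     (\<forall>v\<in>carr V.
        unassoc H H V (id_map H V (H \<otimes> V) \<rho> (\<rho> v)) = map_id H (H \<otimes> H) V \<Delta> (\<rho> v) \<and>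
        fun_id H V \<epsilon> (\<rho> v) = v) \<and>
     (\<forall>t\<in>carr (V \<otimes> H).
        unassoc H H V (id_map H V (H \<otimes> V) \<rho> (\<Psi>VH t)) =
        on12 H H V \<Psi>HH (on23 H V H \<Psi>VH (map_id V (H \<otimes> V) H \<rho> t)))"


section \<open>Pairings\<close>

text \<open>\<open>tfun\<close>: the functional \<open>a \<otimes> b \<mapsto> \<langle>\<xi>, a\<rangle> \<langle>\<eta>, b\<rangle>\<close> on \<open>A \<otimes> B\<close>.
  \<open>rfun\<close>: the functional \<open>a \<otimes> b \<mapsto> \<langle>\<xi>, b\<rangle> \<langle>\<eta>, a\<rangle>\<close> on \<open>A \<otimes> B\<close>, i.e. the reversed
  pairing \<open>\<langle>\<langle>\<xi> \<otimes> \<eta>, _\<rangle>\<rangle>\<close>. Here \<open>\<xi>\<close>, \<open>\<eta>\<close> may also be vectors acting on spaces of functionals,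
  through \<open>ev\<close>.\<close>

definition tfun where
  "tfun A B \<xi> \<eta> = lift A B ground (\<lambda>a b. \<xi> a * \<eta> b)"

definition rfun where
  "rfun A B \<xi> \<eta> = lift A B ground (\<lambda>a b. \<xi> b * \<eta> a)"

definition ev :: "'a \<Rightarrow> ('a \<Rightarrow> 'k) \<Rightarrow> 'k" where
  "ev x f = f x"

text \<open>The embedding \<open>X \<otimes> Y \<rightarrow> (A \<otimes> B)'\<close>, \<open>(\<xi> \<otimes> \<eta>)(a \<otimes> b) = \<langle>\<xi>, a\<rangle> \<langle>\<eta>, b\<rangle>\<close>, where
  \<open>p\<close> and \<open>q\<close> turn elements of \<open>X\<close> and \<open>Y\<close> into functionals on \<open>A\<close> and \<open>B\<close>
  (\<open>\<lambda>f. f\<close> or \<^const>\<open>ev\<close>).\<close>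

definition emb ::
  "('k::field, 'x::ab_group_add) vspace \<Rightarrow> ('k, 'y::ab_group_add) vspace \<Rightarrow>
   ('k, 'a::ab_group_add) vspace \<Rightarrow> ('k, 'b::ab_group_add) vspace \<Rightarrow>
   ('x \<Rightarrow> 'a \<Rightarrow> 'k) \<Rightarrow> ('y \<Rightarrow> 'b \<Rightarrow> 'k) \<Rightarrow> ('k, 'x, 'y) tensor \<Rightarrow> ('k, 'a, 'b) tensor \<Rightarrow> 'k" where
  "emb X Y A B p q = lift X Y (dual (A \<otimes> B)) (\<lambda>\<xi> \<eta>. tfun A B (p \<xi>) (q \<eta>))"

text \<open>A map \<open>\<Psi>\<close> on \<open>X \<otimes> Y\<close> with values in a dual space, into which \<open>Y \<otimes> X\<close> is
  embedded by \<open>E\<close>, is bijective if it is a bijection onto the image of \<open>E\<close>; \<open>pull\<close> is then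
  \<open>\<Psi>\<close> viewed as a map \<open>X \<otimes> Y \<rightarrow> Y \<otimes> X\<close>.\<close>

definition bij_onto where
  "bij_onto X Y E \<Psi> \<longleftrightarrow> bij_betw \<Psi> (carr (X \<otimes> Y)) (E ` carr (Y \<otimes> X))"

definition pull where
  "pull X Y E \<Psi> t = inv_into (carr (Y \<otimes> X)) E (\<Psi> t)"

definition inv_on where
  "inv_on X Y \<Psi> = inv_into (carr (X \<otimes> Y)) \<Psi>"


section \<open>Dual braidings\<close>

text \<open>Each \<open>Psi_XY\<close> is the map on \<open>X \<otimes> Y\<close> with values in a dual space, and \<open>emb_YX\<close> the
  embedding of \<open>Y \<otimes> X\<close> into that dual space. \<open>Psi_HW\<close>, \<open>Psi_UV\<close>, \<open>Psi_WH\<close>, \<open>Psi_VU\<close> are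
  the maps usually decorated with a circle, \<open>Psi_WU\<close> and \<open>Psi_UW\<close> those decorated with a bullet.
  The latter evaluate the former as elements of \<open>V \<otimes> U\<close> resp. \<open>U \<otimes> V\<close>, hence \<open>pull\<close>.
  \<open>dual_mult\<close>, \<open>nu_R\<close>, \<open>nu_L\<close> take values in the full dual; that these lie in \<open>U\<close>
  resp. \<open>W\<close> is a separate hypothesis.\<close>

definition dual_mult where
  "dual_mult H \<Delta> \<Psi>HH U = lift U U (dual H) (\<lambda>f g.
     (\<lambda>a. if a \<in> carr H then rfun H H f g (inv_on H H \<Psi>HH (\<Delta> a)) else 0))"

definition emb_UU where
  "emb_UU H U = emb U U H H (\<lambda>f. f) (\<lambda>f. f)"

definition Psi_UU where
  "Psi_UU H \<Psi>HH U = lift U U (dual (H \<otimes> H)) (\<lambda>f g.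
     lift H H ground (\<lambda>b a. rfun H H f g (\<Psi>HH (tens H H a b))))"

subsection \<open>For a left \<open>H\<close>-braided space \<open>V\<close>\<close>

definition emb_WH_L where
  "emb_WH_L H V W = emb W H V (dual H) (\<lambda>e. e) ev"

definition Psi_HW where
  "Psi_HW H V \<Psi>HV W = lift H W (dual (V \<otimes> dual H)) (\<lambda>a e.
     lift V (dual H) ground (\<lambda>v f. rfun H V e f (inv_on H V \<Psi>HV (tens V H v a))))"

definition emb_VU_L where
  "emb_VU_L H V U = emb V U (dual V) H ev (\<lambda>f. f)"

definition Psi_UV where
  "Psi_UV H V \<Psi>HV U = lift U V (dual (dual V \<otimes> H)) (\<lambda>f v.
     lift (dual V) H ground (\<lambda>e a. rfun H V e f (inv_on H V \<Psi>HV (tens V H v a))))"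

definition emb_UW_L where
  "emb_UW_L H V U W = emb U W H V (\<lambda>f. f) (\<lambda>e. e)"

definition Psi_WU where
  "Psi_WU H V \<Psi>HV U W = lift W U (dual (H \<otimes> V)) (\<lambda>e f.
     lift H V ground (\<lambda>a v.
       rfun V U (ev a) e (pull U V (emb_VU_L H V U) (Psi_UV H V \<Psi>HV U) (tens U V f v))))"

definition nu_R where
  "nu_R H V \<Psi>HV \<rho> U W = lift W U (dual V) (\<lambda>e f.
     (\<lambda>v. if v \<in> carr V then tfun H V f e (inv_on H V \<Psi>HV (\<rho> v)) else 0))"

subsection \<open>For a right \<open>H\<close>-braided space \<open>V\<close>\<close>

definition emb_HW_R where
  "emb_HW_R H V W = emb H W (dual H) V ev (\<lambda>e. e)"

definition Psi_WH where
  "Psi_WH H V \<Psi>VH W = lift W H (dual (dual H \<otimes> V)) (\<lambda>e a.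
     lift (dual H) V ground (\<lambda>f v. rfun V H f e (inv_on V H \<Psi>VH (tens H V a v))))"

definition emb_UV_R where
  "emb_UV_R H V U = emb U V H (dual V) (\<lambda>f. f) ev"

definition Psi_VU where
  "Psi_VU H V \<Psi>VH U = lift V U (dual (H \<otimes> dual V)) (\<lambda>v f.
     lift H (dual V) ground (\<lambda>a e. rfun V H f e (inv_on V H \<Psi>VH (tens H V a v))))"

definition emb_WU_R where
  "emb_WU_R H V U W = emb W U V H (\<lambda>e. e) (\<lambda>f. f)"

definition Psi_UW where
  "Psi_UW H V \<Psi>VH U W = lift U W (dual (V \<otimes> H)) (\<lambda>f e.
     lift V H ground (\<lambda>v a.
       rfun U V e (ev a) (pull V U (emb_UV_R H V U) (Psi_VU H V \<Psi>VH U) (tens V U v f))))"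

definition nu_L where
  "nu_L H V \<Psi>VH \<rho> U W = lift U W (dual V) (\<lambda>f e.
     (\<lambda>v. if v \<in> carr V then tfun V H e f (inv_on V H \<Psi>VH (\<rho> v)) else 0))"

end

theory Submission
  imports Defs
begin

text \<open>
  The statement becomes transparent once every map on the side of the functionals is recognised as a
  transpose with respect to the reversed pairing
  \<open>\<langle>\<langle>\<xi> \<otimes> \<eta>, b \<otimes> a\<rangle>\<rangle> = \<langle>\<xi>, a\<rangle> \<langle>\<eta>, b\<rangle>\<close>.
  Put \<open>R = \<Psi>HH\<^sup>-\<^sup>1\<close> and, for a right comodule, \<open>S = \<Psi>HV\<^sup>-\<^sup>1\<close>, \<open>D = R \<Delta>\<close>, \<open>N = S \<rho>\<close>. Unfolding the
  definitions, the braiding of \<open>U\<close> is the transpose of \<open>R\<close>, the braiding between \<open>W\<close> and \<open>U\<close> is the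
  transpose of \<open>S\<close>, the product of \<open>U\<close> is the transpose of \<open>D\<close>, and the action is the transpose of \<open>N\<close>
  (\<open>adj_dual_braiding\<close>, \<open>Psi_WU\<close> with \<open>adj_pull\<close>, \<open>adj_dual_mult\<close>, \<open>adj_lift_dual\<close>).

  Transposition reverses the order of composition and, because the pairing reverses the tensor factors,
  exchanges the positions 12 and 23 in a triple tensor product (\<open>adj_on12\<close>, \<open>adj_on23\<close>,
  \<open>adj_mult12\<close>, \<open>adj_mult23\<close>). The axioms of a braided right \<open>U\<close>-module therefore are the transposes of
    \<^item> \<open>R\<^sub>1\<^sub>2 S\<^sub>2\<^sub>3 S\<^sub>1\<^sub>2 = S\<^sub>2\<^sub>3 S\<^sub>1\<^sub>2 R\<^sub>2\<^sub>3\<close>,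
    \<^item> \<open>D\<^sub>1\<^sub>2 S = S\<^sub>2\<^sub>3 S\<^sub>1\<^sub>2 D\<^sub>2\<^sub>3\<close>,
    \<^item> \<open>N\<^sub>2\<^sub>3 N = D\<^sub>1\<^sub>2 N\<close>,
    \<^item> \<open>N\<^sub>2\<^sub>3 S = R\<^sub>1\<^sub>2 S\<^sub>2\<^sub>3 N\<^sub>1\<^sub>2\<close>,

  and these follow from the comodule axioms by inverting the braidings
  (\<open>braided_right_comodule_inverse\<close>). An identity between operators on \<open>H\<close> and \<open>V\<close> passes to their
  transposes because tensor products of functionals still separate: an element of \<open>U \<otimes> W\<close>, say, that
  vanishes on all of \<open>V \<otimes> H\<close> is zero (\<open>is_pairing_ptensor\<close>, \<open>adj_unique\<close>).

  That \<open>U\<close> itself is a braided algebra is the same statement for \<open>V = H\<close> and \<open>\<rho> = \<Delta>\<close>, since a braided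
  coalgebra is a comodule over itself on both sides (\<open>dual_braided_algebra\<close>). The left-handed case is
  the mirror image of the right-handed one.
\<close>

section \<open>Linear maps on carriers\<close>

lemma linear_map_in: "linear_map A B f \<Longrightarrow> x \<in> carr A \<Longrightarrow> f x \<in> carr B"
  by (simp add: linear_map_def)

lemma linear_map_add:
  "linear_map A B f \<Longrightarrow> x \<in> carr A \<Longrightarrow> y \<in> carr A \<Longrightarrow> f (x + y) = f x + f y"
  by (simp add: linear_map_def)

lemma linear_map_scale:
  "linear_map A B f \<Longrightarrow> x \<in> carr A \<Longrightarrow> f (smul A c x) = smul B c (f x)"
  by (simp add: linear_map_def)

lemma linear_mapI:
  assumes "\<And>x. x \<in> carr A \<Longrightarrow> f x \<in> carr B"
    and "\<And>x y. x \<in> carr A \<Longrightarrow> y \<in> carr A \<Longrightarrow> f (x + y) = f x + f y"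
    and "\<And>c x. x \<in> carr A \<Longrightarrow> f (smul A c x) = smul B c (f x)"
  shows "linear_map A B f"
  using assms by (simp add: linear_map_def)

lemma linear_map_comp:
  assumes "linear_map A B f" and "linear_map B C g"
  shows "linear_map A C (\<lambda>x. g (f x))"
  using assms by (simp add: linear_map_def)

lemma linear_map_id: "linear_map A A (\<lambda>x. x)"
  by (simp add: linear_map_def)

lemma linear_map_cong:
  assumes "is_vspace A" and "linear_map A B f" and "\<And>x. x \<in> carr A \<Longrightarrow> g x = f x"
  shows "linear_map A B g"
proof -
  interpret vector_space "smul A" using assms(1) by (simp add: is_vspace_def)
  have "subspace (carr A)" using assms(1) by (simp add: is_vspace_def)
  then show ?thesis using assms(2,3)
    by (simp add: linear_map_def subspace_add subspace_scale)
qed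

lemma is_vspaceD:
  assumes "is_vspace A"
  shows is_vspace_zero: "0 \<in> carr A"
    and is_vspace_add: "\<And>x y. x \<in> carr A \<Longrightarrow> y \<in> carr A \<Longrightarrow> x + y \<in> carr A"
    and is_vspace_scale: "\<And>c x. x \<in> carr A \<Longrightarrow> smul A c x \<in> carr A"
    and is_vspace_diff: "\<And>x y. x \<in> carr A \<Longrightarrow> y \<in> carr A \<Longrightarrow> x - y \<in> carr A"
    and is_vspace_sum: "\<And>f S. (\<And>i. i \<in> S \<Longrightarrow> f i \<in> carr A) \<Longrightarrow> sum f S \<in> carr A"
proof -
  interpret vector_space "smul A" using assms by (simp add: is_vspace_def)
  have "subspace (carr A)" using assms by (simp add: is_vspace_def)
  then show "0 \<in> carr A" "\<And>x y. x \<in> carr A \<Longrightarrow> y \<in> carr A \<Longrightarrow> x + y \<in> carr A"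
    "\<And>c x. x \<in> carr A \<Longrightarrow> smul A c x \<in> carr A"
    "\<And>x y. x \<in> carr A \<Longrightarrow> y \<in> carr A \<Longrightarrow> x - y \<in> carr A"
    "\<And>f S. (\<And>i. i \<in> S \<Longrightarrow> f i \<in> carr A) \<Longrightarrow> sum f S \<in> carr A"
    by (auto simp: subspace_0 subspace_add subspace_scale subspace_diff intro: subspace_sum)
qed

lemma linear_map_zero:
  assumes "is_vspace A" and "linear_map A B f"
  shows "f 0 = 0"
proof -
  have "f (0 + 0) = f 0 + f 0"
    using assms is_vspace_zero linear_map_add by blast
  then show ?thesis by simp
qed

lemma linear_map_diff:
  assumes "is_vspace A" and "linear_map A B f" and "x \<in> carr A" and "y \<in> carr A"
  shows "f (x - y) = f x - f y"
proof -
  have "f ((x - y) + y) = f (x - y) + f y"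
    using assms by (intro linear_map_add[OF assms(2)]) (auto intro: is_vspace_diff)
  then show ?thesis by (simp add: algebra_simps)
qed

lemma linear_map_sum:
  assumes "is_vspace A" and "linear_map A B f" and "\<And>i. i \<in> S \<Longrightarrow> x i \<in> carr A"
  shows "f (sum x S) = (\<Sum>i\<in>S. f (x i))"
  using assms(3)
proof (induction S rule: infinite_finite_induct)
  case (insert i S)
  then have "f (x i + sum x S) = f (x i) + f (sum x S)"
    by (intro linear_map_add[OF assms(2)] is_vspace_sum[OF assms(1)]) auto
  then show ?case using insert by simp
qed (simp_all add: linear_map_zero[OF assms(1,2)])

lemma linear_map_plus:
  assumes "is_vspace B" and "linear_map A B f" and "linear_map A B g"
  shows "linear_map A B (\<lambda>x. f x + g x)"
proof -
  interpret vector_space "smul B" using assms(1) by (simp add: is_vspace_def)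
  show ?thesis using assms is_vspace_add[OF assms(1)]
    by (simp add: linear_map_def scale_right_distrib algebra_simps)
qed

lemma linear_map_smul:
  assumes "is_vspace B" and "linear_map A B f"
  shows "linear_map A B (\<lambda>x. smul B c (f x))"
proof -
  interpret vector_space "smul B" using assms(1) by (simp add: is_vspace_def)
  show ?thesis using assms is_vspace_scale[OF assms(1)]
    by (simp add: linear_map_def scale_right_distrib mult.commute)
qed

lemma is_vspace_ground: "is_vspace (ground :: ('k::field, 'k) vspace)"
proof -
  interpret vector_space "(*) :: 'k \<Rightarrow> 'k \<Rightarrow> 'k"
    by unfold_locales (auto simp: algebra_simps)
  show ?thesis
    unfolding is_vspace_def ground_def
    by (simp add: vector_space_axioms subspace_UNIV)
qed

lemma carr_ground [simp]: "carr ground = UNIV" and smul_ground [simp]: "smul ground = (*)"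
  by (simp_all add: ground_def)

lemma smul_dual [simp]: "smul (dual A) = fscale"
  by (simp add: dual_def)

lemma in_dual_iff:
  "f \<in> carr (dual A) \<longleftrightarrow> linear_map A ground f \<and> (\<forall>x. x \<notin> carr A \<longrightarrow> f x = 0)"
  by (simp add: dual_def)

lemma is_vspace_dual:
  fixes A :: "('k::field, 'a::ab_group_add) vspace"
  shows "is_vspace (dual A)"
proof -
  interpret vector_space "fscale :: 'k \<Rightarrow> ('a \<Rightarrow> 'k) \<Rightarrow> _"
    by (rule vector_space_fscale)
  have "subspace (carr (dual A))"
    by (auto simp: subspace_def dual_def linear_map_def fscale_def algebra_simps)
  then show ?thesis by (simp add: is_vspace_def vector_space_fscale)
qed


section \<open>Multilinear maps and tensor products\<close>

lemma bilinear_mapI: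
  assumes "\<And>x. x \<in> carr A \<Longrightarrow> linear_map B C (\<beta> x)"
    and "\<And>y. y \<in> carr B \<Longrightarrow> linear_map A C (\<lambda>x. \<beta> x y)"
  shows "bilinear_map A B C \<beta>"
  using assms by (simp add: bilinear_map_def)

lemma bilinear_map_right: "bilinear_map A B C \<beta> \<Longrightarrow> x \<in> carr A \<Longrightarrow> linear_map B C (\<beta> x)"
  and bilinear_map_left: "bilinear_map A B C \<beta> \<Longrightarrow> y \<in> carr B \<Longrightarrow> linear_map A C (\<lambda>x. \<beta> x y)"
  by (simp_all add: bilinear_map_def)

lemma bilinear_map_comp2:
  assumes "bilinear_map A B C \<beta>" and "linear_map A' A f" and "linear_map B' B g"
  shows "bilinear_map A' B' C (\<lambda>a b. \<beta> (f a) (g b))"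
  using assms by (simp add: bilinear_map_def linear_map_def)

lemma bilinear_map_flip: "bilinear_map A B C \<beta> \<Longrightarrow> bilinear_map B A C (\<lambda>b a. \<beta> a b)"
  by (simp add: bilinear_map_def)

lemma bilinear_map_cong:
  assumes "is_vspace A" and "is_vspace B" and "bilinear_map A B C \<beta>"
    and "\<And>a b. a \<in> carr A \<Longrightarrow> b \<in> carr B \<Longrightarrow> \<gamma> a b = \<beta> a b"
  shows "bilinear_map A B C \<gamma>"
proof (rule bilinear_mapI)
  show "linear_map B C (\<gamma> x)" if "x \<in> carr A" for x
    using that assms(4) by (intro linear_map_cong[OF assms(2) bilinear_map_right[OF assms(3) that]])
  show "linear_map A C (\<lambda>x. \<gamma> x y)" if "y \<in> carr B" for y
    using that assms(4) by (intro linear_map_cong[OF assms(1) bilinear_map_left[OF assms(3) that]])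
qed

lemma bilinear_map_mult:
  fixes \<xi> :: "'a::ab_group_add \<Rightarrow> 'k::field" and \<eta> :: "'b::ab_group_add \<Rightarrow> 'k"
  assumes "linear_map A ground \<xi>" and "linear_map B ground \<eta>"
  shows "bilinear_map A B ground (\<lambda>a b. \<xi> a * \<eta> b)"
  using assms by (simp add: bilinear_map_def linear_map_def algebra_simps)

lemma bilinear_map_tens:
  fixes A :: "('k::field, 'a::ab_group_add) vspace" and B :: "('k, 'b::ab_group_add) vspace"
  shows "bilinear_map A B (A \<otimes> B) (tens A B)"
  by (intro bilinear_mapI linear_mapI tens_in)
    (auto simp: tens_def fscale_def fun_eq_iff bilinear_map_def linear_map_def)

lemmas linear_map_tens_right = bilinear_map_right[OF bilinear_map_tens]
lemmas linear_map_tens_left = bilinear_map_left[OF bilinear_map_tens]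

lemma tensor_ext:
  fixes A :: "('k::field, 'a::ab_group_add) vspace" and B :: "('k, 'b::ab_group_add) vspace"
  assumes f: "linear_map (A \<otimes> B) C f" and g: "linear_map (A \<otimes> B) C g"
    and eq: "\<And>a b. a \<in> carr A \<Longrightarrow> b \<in> carr B \<Longrightarrow> f (tens A B a b) = g (tens A B a b)"
    and t: "t \<in> carr (A \<otimes> B)"
  shows "f t = g t"
  using t
proof (induction rule: tensor_induct)
  case zero
  show ?case using f g is_vspace_tensor linear_map_zero by metis
next
  case (step c a b s)
  have "tens A B a b \<in> carr (A \<otimes> B)" using step tens_in by blast
  moreover from this have "fscale c (tens A B a b) \<in> carr (A \<otimes> B)"
    using is_vspace_scale[OF is_vspace_tensor, of _ A B c] by simp
  ultimately have "h (fscale c (tens A B a b) + s) = smul C c (h (tens A B a b)) + h s"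
    if "linear_map (A \<otimes> B) C h" for h
    using linear_map_add[OF that _ step(3)] linear_map_scale[OF that] unfolding smul_tensor by metis
  then show ?case using f g step(4) eq[OF step(1,2)] by metis
qed

lemma tensor_ext3:
  assumes f: "linear_map (A \<otimes> B \<otimes> C) D f" and g: "linear_map (A \<otimes> B \<otimes> C) D g"
    and eq: "\<And>a b c. a \<in> carr A \<Longrightarrow> b \<in> carr B \<Longrightarrow> c \<in> carr C \<Longrightarrow>
      f (tens (A \<otimes> B) C (tens A B a b) c) = g (tens (A \<otimes> B) C (tens A B a b) c)"
    and t: "t \<in> carr (A \<otimes> B \<otimes> C)"
  shows "f t = g t"
proof (rule tensor_ext[OF f g _ t])
  fix s c assume s: "s \<in> carr (A \<otimes> B)" and c: "c \<in> carr C"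
  show "f (tens (A \<otimes> B) C s c) = g (tens (A \<otimes> B) C s c)"
    using eq c by (intro tensor_ext[OF linear_map_comp[OF linear_map_tens_left f]
          linear_map_comp[OF linear_map_tens_left g] _ s]) auto
qed

lemma tensor_ext3':
  assumes f: "linear_map (A \<otimes> (B \<otimes> C)) D f" and g: "linear_map (A \<otimes> (B \<otimes> C)) D g"
    and eq: "\<And>a b c. a \<in> carr A \<Longrightarrow> b \<in> carr B \<Longrightarrow> c \<in> carr C \<Longrightarrow>
      f (tens A (B \<otimes> C) a (tens B C b c)) = g (tens A (B \<otimes> C) a (tens B C b c))"
    and t: "t \<in> carr (A \<otimes> (B \<otimes> C))"
  shows "f t = g t"
proof (rule tensor_ext[OF f g _ t])
  fix a s assume a: "a \<in> carr A" and s: "s \<in> carr (B \<otimes> C)"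
  show "f (tens A (B \<otimes> C) a s) = g (tens A (B \<otimes> C) a s)"
    using eq a by (intro tensor_ext[OF linear_map_comp[OF linear_map_tens_right f]
          linear_map_comp[OF linear_map_tens_right g] _ s]) auto
qed

text \<open>Iterated lifts, such as those in \<^const>\<open>assoc\<close> and in the dual braidings, are multilinear because a
  lift depends linearly on a parameter as soon as it does so on pure tensors.\<close>

lemma linear_map_lift_param:
  assumes C: "is_vspace C" and D: "is_vspace D"
    and bil: "\<And>d. d \<in> carr D \<Longrightarrow> bilinear_map A B C (\<beta> d)"
    and lin: "\<And>a b. a \<in> carr A \<Longrightarrow> b \<in> carr B \<Longrightarrow> linear_map D C (\<lambda>d. \<beta> d a b)"
    and t: "t \<in> carr (A \<otimes> B)"
  shows "linear_map D C (\<lambda>d. lift A B C (\<beta> d) t)"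
proof (rule linear_mapI)
  note L = linear_map_lift[OF C bil] and T = lift_tens[OF C bil]
  fix d assume d: "d \<in> carr D"
  show "lift A B C (\<beta> d) t \<in> carr C" using linear_map_in[OF L[OF d] t] .
  fix e assume e: "e \<in> carr D"
  have de: "d + e \<in> carr D" using is_vspace_add[OF D d e] .
  show "lift A B C (\<beta> (d + e)) t = lift A B C (\<beta> d) t + lift A B C (\<beta> e) t"
    by (rule tensor_ext[OF L[OF de] linear_map_plus[OF C L[OF d] L[OF e]] _ t])
      (simp add: T d e de linear_map_add[OF lin])
next
  note L = linear_map_lift[OF C bil] and T = lift_tens[OF C bil]
  fix c d assume d: "d \<in> carr D"
  have cd: "smul D c d \<in> carr D" using is_vspace_scale[OF D d] .
  show "lift A B C (\<beta> (smul D c d)) t = smul C c (lift A B C (\<beta> d) t)"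
    by (rule tensor_ext[OF L[OF cd] linear_map_smul[OF C L[OF d]] _ t])
      (simp add: T d cd linear_map_scale[OF lin])
qed

lemma bilinear_map_tens_map:
  assumes "linear_map A C f" and "linear_map B D g"
  shows "bilinear_map A B (C \<otimes> D) (\<lambda>a b. tens C D (f a) (g b))"
  using bilinear_map_comp2[OF bilinear_map_tens assms] .

lemma linear_map_map_id:
  assumes "linear_map X Y f"
  shows "linear_map (X \<otimes> C) (Y \<otimes> C) (map_id X Y C f)"
  unfolding map_id_def tensor_map_def
  by (rule linear_map_lift[OF is_vspace_tensor bilinear_map_tens_map[OF assms linear_map_id]])

lemma linear_map_id_map:
  assumes "linear_map X Y f"
  shows "linear_map (C \<otimes> X) (C \<otimes> Y) (id_map C X Y f)"
  unfolding id_map_def tensor_map_def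
  by (rule linear_map_lift[OF is_vspace_tensor bilinear_map_tens_map[OF linear_map_id assms]])

lemma map_id_tens:
  assumes "linear_map X Y f" and "x \<in> carr X" and "c \<in> carr C"
  shows "map_id X Y C f (tens X C x c) = tens Y C (f x) c"
  unfolding map_id_def tensor_map_def
  by (rule lift_tens[OF is_vspace_tensor bilinear_map_tens_map[OF assms(1) linear_map_id] assms(2,3)])

lemma id_map_tens:
  assumes "linear_map X Y f" and "c \<in> carr C" and "x \<in> carr X"
  shows "id_map C X Y f (tens C X c x) = tens C Y c (f x)"
  unfolding id_map_def tensor_map_def
  by (rule lift_tens[OF is_vspace_tensor bilinear_map_tens_map[OF linear_map_id assms(1)] assms(2,3)])

lemma map_id_comp:
  assumes f: "linear_map X Y f" and g: "linear_map Y Z g" and t: "t \<in> carr (X \<otimes> C)"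
  shows "map_id Y Z C g (map_id X Y C f t) = map_id X Z C (\<lambda>x. g (f x)) t"
proof -
  note h = linear_map_comp[OF f g]
  show ?thesis
    by (rule tensor_ext[OF linear_map_comp[OF linear_map_map_id[OF f] linear_map_map_id[OF g]]
          linear_map_map_id[OF h] _ t])
      (simp add: map_id_tens[OF f] map_id_tens[OF g] map_id_tens[OF h] linear_map_in[OF f])
qed

lemma id_map_comp:
  assumes f: "linear_map X Y f" and g: "linear_map Y Z g" and t: "t \<in> carr (C \<otimes> X)"
  shows "id_map C Y Z g (id_map C X Y f t) = id_map C X Z (\<lambda>x. g (f x)) t"
proof -
  note h = linear_map_comp[OF f g]
  show ?thesis
    by (rule tensor_ext[OF linear_map_comp[OF linear_map_id_map[OF f] linear_map_id_map[OF g]]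
          linear_map_id_map[OF h] _ t])
      (simp add: id_map_tens[OF f] id_map_tens[OF g] id_map_tens[OF h] linear_map_in[OF f])
qed

lemma map_id_ident:
  assumes f: "linear_map X X f" and id: "\<And>x. x \<in> carr X \<Longrightarrow> f x = x" and t: "t \<in> carr (X \<otimes> C)"
  shows "map_id X X C f t = t"
  by (rule tensor_ext[OF linear_map_map_id[OF f] linear_map_id _ t]) (simp add: map_id_tens[OF f] id)

lemma id_map_ident:
  assumes f: "linear_map X X f" and id: "\<And>x. x \<in> carr X \<Longrightarrow> f x = x" and t: "t \<in> carr (C \<otimes> X)"
  shows "id_map C X X f t = t"
  by (rule tensor_ext[OF linear_map_id_map[OF f] linear_map_id _ t]) (simp add: id_map_tens[OF f] id)

lemma bilinear_map_assoc_inner: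
  assumes "c \<in> carr C"
  shows "bilinear_map A B (A \<otimes> (B \<otimes> C)) (\<lambda>a b. tens A (B \<otimes> C) a (tens B C b c))"
  using bilinear_map_comp2[OF bilinear_map_tens linear_map_id linear_map_tens_left[OF assms]] .

lemma bilinear_map_unassoc_inner:
  assumes "a \<in> carr A"
  shows "bilinear_map B C (A \<otimes> B \<otimes> C) (\<lambda>b c. tens (A \<otimes> B) C (tens A B a b) c)"
  using bilinear_map_comp2[OF bilinear_map_tens linear_map_tens_right[OF assms] linear_map_id] .

lemma assoc:
  assumes "is_vspace C"
  shows linear_map_assoc: "linear_map (A \<otimes> B \<otimes> C) (A \<otimes> (B \<otimes> C)) (assoc A B C)"
    and assoc_tens: "\<And>a b c. a \<in> carr A \<Longrightarrow> b \<in> carr B \<Longrightarrow> c \<in> carr C \<Longrightarrow>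
      assoc A B C (tens (A \<otimes> B) C (tens A B a b) c) = tens A (B \<otimes> C) a (tens B C b c)"
proof -
  note in' = bilinear_map_assoc_inner
  have lin: "linear_map C (A \<otimes> (B \<otimes> C)) (\<lambda>c. tens A (B \<otimes> C) a (tens B C b c))"
    if "a \<in> carr A" "b \<in> carr B" for a b
    using linear_map_comp[OF linear_map_tens_right[OF that(2)] linear_map_tens_right[OF that(1)]] .
  have bil: "bilinear_map (A \<otimes> B) C (A \<otimes> (B \<otimes> C))
     (\<lambda>t c. lift A B (A \<otimes> (B \<otimes> C)) (\<lambda>a b. tens A (B \<otimes> C) a (tens B C b c)) t)"
    by (intro bilinear_mapI linear_map_lift[OF is_vspace_tensor in'] is_vspace_tensor
        linear_map_lift_param[OF is_vspace_tensor assms in'] lin)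
  show "linear_map (A \<otimes> B \<otimes> C) (A \<otimes> (B \<otimes> C)) (assoc A B C)"
    unfolding assoc_def by (rule linear_map_lift[OF is_vspace_tensor bil])
  show "assoc A B C (tens (A \<otimes> B) C (tens A B a b) c) = tens A (B \<otimes> C) a (tens B C b c)"
    if "a \<in> carr A" "b \<in> carr B" "c \<in> carr C" for a b c
    unfolding assoc_def
    using that by (simp add: lift_tens[OF is_vspace_tensor bil] tens_in
        lift_tens[OF is_vspace_tensor in'])
qed

lemma unassoc:
  assumes "is_vspace A"
  shows linear_map_unassoc: "linear_map (A \<otimes> (B \<otimes> C)) (A \<otimes> B \<otimes> C) (unassoc A B C)"
    and unassoc_tens: "\<And>a b c. a \<in> carr A \<Longrightarrow> b \<in> carr B \<Longrightarrow> c \<in> carr C \<Longrightarrow>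
      unassoc A B C (tens A (B \<otimes> C) a (tens B C b c)) = tens (A \<otimes> B) C (tens A B a b) c"
proof -
  note in' = bilinear_map_unassoc_inner
  have lin: "linear_map A (A \<otimes> B \<otimes> C) (\<lambda>a. tens (A \<otimes> B) C (tens A B a b) c)"
    if "b \<in> carr B" "c \<in> carr C" for b c
    using linear_map_comp[OF linear_map_tens_left[OF that(1)] linear_map_tens_left[OF that(2)]] .
  have bil: "bilinear_map A (B \<otimes> C) (A \<otimes> B \<otimes> C)
     (\<lambda>a t. lift B C (A \<otimes> B \<otimes> C) (\<lambda>b c. tens (A \<otimes> B) C (tens A B a b) c) t)"
    by (intro bilinear_mapI linear_map_lift[OF is_vspace_tensor in'] is_vspace_tensor
        linear_map_lift_param[OF is_vspace_tensor assms in'] lin)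
  show "linear_map (A \<otimes> (B \<otimes> C)) (A \<otimes> B \<otimes> C) (unassoc A B C)"
    unfolding unassoc_def by (rule linear_map_lift[OF is_vspace_tensor bil])
  show "unassoc A B C (tens A (B \<otimes> C) a (tens B C b c)) = tens (A \<otimes> B) C (tens A B a b) c"
    if "a \<in> carr A" "b \<in> carr B" "c \<in> carr C" for a b c
    unfolding unassoc_def
    using that by (simp add: lift_tens[OF is_vspace_tensor bil] tens_in
        lift_tens[OF is_vspace_tensor in'])
qed

lemma unassoc_assoc:
  assumes A: "is_vspace A" and C: "is_vspace C" and t: "t \<in> carr (A \<otimes> B \<otimes> C)"
  shows "unassoc A B C (assoc A B C t) = t"
  by (rule tensor_ext3[OF linear_map_comp[OF linear_map_assoc[OF C] linear_map_unassoc[OF A]]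
        linear_map_id _ t])
    (simp add: assoc_tens[OF C] unassoc_tens[OF A])

lemma assoc_unassoc:
  assumes A: "is_vspace A" and C: "is_vspace C" and t: "t \<in> carr (A \<otimes> (B \<otimes> C))"
  shows "assoc A B C (unassoc A B C t) = t"
  by (rule tensor_ext3'[OF linear_map_comp[OF linear_map_unassoc[OF A] linear_map_assoc[OF C]]
        linear_map_id _ t])
    (simp add: assoc_tens[OF C] unassoc_tens[OF A])

section \<open>Dual pairings and their tensor products\<close>

record ('k, 'x, 'a) pairing =
  lft :: "('k, 'x) vspace"
  rgt :: "('k, 'a) vspace"
  pr :: "'x \<Rightarrow> 'a \<Rightarrow> 'k"

text \<open>A bilinear form whose left radical is zero. Separation is asked on the left side only, since
  identities are going to be carried from operators on the right space to operators on the left one.\<close>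

definition is_pairing :: "('k::field, 'x::ab_group_add, 'a::ab_group_add) pairing \<Rightarrow> bool" where
  "is_pairing P \<longleftrightarrow> is_vspace (lft P) \<and> is_vspace (rgt P) \<and>
     bilinear_map (lft P) (rgt P) ground (pr P) \<and>
     (\<forall>x\<in>carr (lft P). (\<forall>a\<in>carr (rgt P). pr P x a = 0) \<longrightarrow> x = 0)"

lemma is_pairingD:
  assumes "is_pairing P"
  shows is_vspace_lft: "is_vspace (lft P)" and is_vspace_rgt: "is_vspace (rgt P)"
    and bilinear_map_pr: "bilinear_map (lft P) (rgt P) ground (pr P)"
  using assms by (simp_all add: is_pairing_def)

lemma linear_map_pr:
  "is_pairing P \<Longrightarrow> x \<in> carr (lft P) \<Longrightarrow> linear_map (rgt P) ground (pr P x)"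
  using bilinear_map_right[OF bilinear_map_pr] .

lemma linear_map_pr_left:
  "is_pairing P \<Longrightarrow> a \<in> carr (rgt P) \<Longrightarrow> linear_map (lft P) ground (\<lambda>x. pr P x a)"
  using bilinear_map_left[OF bilinear_map_pr] .

lemma pairing_eqI:
  assumes P: "is_pairing P" and x: "x \<in> carr (lft P)" and y: "y \<in> carr (lft P)"
    and eq: "\<And>a. a \<in> carr (rgt P) \<Longrightarrow> pr P x a = pr P y a"
  shows "x = y"
proof -
  note vs = is_vspace_lft[OF P]
  have "pr P (x - y) a = 0" if "a \<in> carr (rgt P)" for a
    using linear_map_diff[OF vs linear_map_pr_left[OF P that] x y] eq[OF that] by simp
  then have "x - y = 0"
    using P is_vspace_diff[OF vs x y] unfolding is_pairing_def by blast
  then show ?thesis by simp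
qed

lemma bilinear_map_mult_flip:
  fixes \<xi> :: "'b::ab_group_add \<Rightarrow> 'k::field" and \<eta> :: "'a::ab_group_add \<Rightarrow> 'k"
  assumes "linear_map B ground \<xi>" and "linear_map A ground \<eta>"
  shows "bilinear_map A B ground (\<lambda>a b. \<xi> b * \<eta> a)"
  using bilinear_map_flip[OF bilinear_map_mult[OF assms]] .

lemma rfun:
  fixes A :: "('k::field, 'a::ab_group_add) vspace" and B :: "('k, 'b::ab_group_add) vspace"
  assumes "linear_map B ground \<xi>" and "linear_map A ground \<eta>"
  shows linear_map_rfun: "linear_map (A \<otimes> B) ground (rfun A B \<xi> \<eta>)"
    and rfun_tens: "\<And>a b. a \<in> carr A \<Longrightarrow> b \<in> carr B \<Longrightarrow> rfun A B \<xi> \<eta> (tens A B a b) = \<xi> b * \<eta> a"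
  unfolding rfun_def
  using lift[OF is_vspace_ground bilinear_map_mult_flip[OF assms]] by blast+

lemma tfun:
  fixes A :: "('k::field, 'a::ab_group_add) vspace" and B :: "('k, 'b::ab_group_add) vspace"
  assumes "linear_map A ground \<xi>" and "linear_map B ground \<eta>"
  shows linear_map_tfun: "linear_map (A \<otimes> B) ground (tfun A B \<xi> \<eta>)"
    and tfun_tens: "\<And>a b. a \<in> carr A \<Longrightarrow> b \<in> carr B \<Longrightarrow> tfun A B \<xi> \<eta> (tens A B a b) = \<xi> a * \<eta> b"
  unfolding tfun_def
  using lift[OF is_vspace_ground bilinear_map_mult[OF assms]] by blast+

lemma tfun_eq_rfun: "tfun A B \<xi> \<eta> = rfun A B \<eta> \<xi>"
  by (simp add: tfun_def rfun_def mult.commute)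

lemma bilinear_map_rfun:
  fixes A :: "('k::field, 'a::ab_group_add) vspace" and B :: "('k, 'b::ab_group_add) vspace"
  assumes X: "is_vspace X" and Y: "is_vspace Y"
    and p: "bilinear_map X B ground p" and q: "bilinear_map Y A ground q"
    and T: "T \<in> carr (A \<otimes> B)"
  shows "bilinear_map X Y ground (\<lambda>x y. rfun A B (p x) (q y) T)"
proof (rule bilinear_mapI)
  fix x assume x: "x \<in> carr X"
  show "linear_map Y ground (\<lambda>y. rfun A B (p x) (q y) T)"
    unfolding rfun_def
  proof (rule linear_map_lift_param[OF is_vspace_ground Y _ _ T])
    show "bilinear_map A B ground (\<lambda>a b. p x b * q y a)" if "y \<in> carr Y" for y
      using bilinear_map_mult_flip[OF bilinear_map_right[OF p x] bilinear_map_right[OF q that]] .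
    show "linear_map Y ground (\<lambda>y. p x b * q y a)" if "a \<in> carr A" "b \<in> carr B" for a b
      using linear_map_smul[OF is_vspace_ground bilinear_map_left[OF q that(1)], of "p x b"] by simp
  qed
next
  fix y assume y: "y \<in> carr Y"
  show "linear_map X ground (\<lambda>x. rfun A B (p x) (q y) T)"
    unfolding rfun_def
  proof (rule linear_map_lift_param[OF is_vspace_ground X _ _ T])
    show "bilinear_map A B ground (\<lambda>a b. p x b * q y a)" if "x \<in> carr X" for x
      using bilinear_map_mult_flip[OF bilinear_map_right[OF p that] bilinear_map_right[OF q y]] .
    show "linear_map X ground (\<lambda>x. p x b * q y a)" if "a \<in> carr A" "b \<in> carr B" for a b
      using linear_map_smul[OF is_vspace_ground bilinear_map_left[OF p that(2)], of "q y a"]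
      by (simp add: mult.commute)
  qed
qed

text \<open>The reversed pairing: the factors of the right space appear in the opposite order. It extends
  \<open>\<langle>\<langle>_, _\<rangle>\<rangle>\<close>, that is \<^const>\<open>rfun\<close>, to tensors in both arguments.\<close>

definition ptensor ::
  "('k::field, 'x::ab_group_add, 'a::ab_group_add) pairing \<Rightarrow>
   ('k, 'y::ab_group_add, 'b::ab_group_add) pairing \<Rightarrow>
   ('k, ('k, 'x, 'y) tensor, ('k, 'b, 'a) tensor) pairing"  (infixl \<open>\<odot>\<close> 70) where
  "P \<odot> Q = \<lparr>lft = lft P \<otimes> lft Q, rgt = rgt Q \<otimes> rgt P,
     pr = (\<lambda>F T. lift (lft P) (lft Q) ground
       (\<lambda>x y. rfun (rgt Q) (rgt P) (pr P x) (pr Q y) T) F)\<rparr>"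

lemma lft_ptensor [simp]: "lft (P \<odot> Q) = lft P \<otimes> lft Q"
  and rgt_ptensor [simp]: "rgt (P \<odot> Q) = rgt Q \<otimes> rgt P"
  by (simp_all add: ptensor_def)

lemma ptensor:
  assumes P: "is_pairing P" and Q: "is_pairing Q"
  shows bilinear_map_ptensor:
      "bilinear_map (lft P \<otimes> lft Q) (rgt Q \<otimes> rgt P) ground (pr (P \<odot> Q))"
    and pr_tens_left: "\<And>x y T. x \<in> carr (lft P) \<Longrightarrow> y \<in> carr (lft Q) \<Longrightarrow>
      T \<in> carr (rgt Q \<otimes> rgt P) \<Longrightarrow>
      pr (P \<odot> Q) (tens (lft P) (lft Q) x y) T = rfun (rgt Q) (rgt P) (pr P x) (pr Q y) T"
    and pr_tens: "\<And>x y a b. x \<in> carr (lft P) \<Longrightarrow> y \<in> carr (lft Q) \<Longrightarrow>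
      b \<in> carr (rgt Q) \<Longrightarrow> a \<in> carr (rgt P) \<Longrightarrow>
      pr (P \<odot> Q) (tens (lft P) (lft Q) x y) (tens (rgt Q) (rgt P) b a) = pr P x a * pr Q y b"
proof -
  note bil = bilinear_map_rfun[OF is_vspace_lft[OF P] is_vspace_lft[OF Q]
      bilinear_map_pr[OF P] bilinear_map_pr[OF Q]]
  note lin = linear_map_rfun[OF linear_map_pr[OF P] linear_map_pr[OF Q]]
  show "bilinear_map (lft P \<otimes> lft Q) (rgt Q \<otimes> rgt P) ground (pr (P \<odot> Q))"
    unfolding ptensor_def pairing.simps
    by (rule bilinear_mapI)
      (rule linear_map_lift_param[OF is_vspace_ground is_vspace_tensor bil lin],
        assumption+, rule linear_map_lift[OF is_vspace_ground bil])
  show left: "pr (P \<odot> Q) (tens (lft P) (lft Q) x y) T = rfun (rgt Q) (rgt P) (pr P x) (pr Q y) T"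
    if "x \<in> carr (lft P)" "y \<in> carr (lft Q)" "T \<in> carr (rgt Q \<otimes> rgt P)" for x y T
    using lift_tens[OF is_vspace_ground bil[OF that(3)] that(1,2)] by (simp add: ptensor_def)
  show "pr (P \<odot> Q) (tens (lft P) (lft Q) x y) (tens (rgt Q) (rgt P) b a) = pr P x a * pr Q y b"
    if "x \<in> carr (lft P)" "y \<in> carr (lft Q)" "b \<in> carr (rgt Q)" "a \<in> carr (rgt P)" for x y a b
    using that left rfun_tens[OF linear_map_pr[OF P] linear_map_pr[OF Q]] by (simp add: tens_in)
qed

text \<open>Independence of the left factors is what allows the right factors of a vanishing tensor to be
  compared with zero one by one.\<close>

lemma tensor_basis_expansion:
  fixes X :: "('k::field, 'x::ab_group_add) vspace" and Y :: "('k, 'y::ab_group_add) vspace"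
  assumes X: "is_vspace X" and Y: "is_vspace Y" and F: "F \<in> carr (X \<otimes> Y)"
  obtains S y where "finite S" and "S \<subseteq> carr X" and "\<not> module.dependent (smul X) S"
    and "\<And>s. y s \<in> carr Y" and "F = (\<Sum>s\<in>S. tens X Y s (y s))"
proof -
  interpret X: vector_space "smul X" using X by (simp add: is_vspace_def)
  interpret Y: vector_space "smul Y" using Y by (simp add: is_vspace_def)
  obtain B where B: "B \<subseteq> carr X" "X.independent B" "carr X \<subseteq> X.span B"
    using X.maximal_independent_subset by metis
  have tens0: "tens X Y x 0 = 0" if "x \<in> carr X" for x
    using linear_map_zero[OF Y linear_map_tens_right[OF that]] .
  have "\<exists>S y. finite S \<and> S \<subseteq> B \<and> (\<forall>s. y s \<in> carr Y) \<and> (\<forall>s. s \<notin> S \<longrightarrow> y s = 0) \<and>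
      F = (\<Sum>s\<in>S. tens X Y s (y s))"
    using F
  proof (induction rule: tensor_induct)
    case zero
    show ?case by (rule exI[of _ "{}"], rule exI[of _ "\<lambda>_. 0"]) (simp add: is_vspace_zero[OF Y])
  next
    case (step c a b F)
    then obtain S y where S: "finite S" "S \<subseteq> B" "\<And>s. y s \<in> carr Y" "\<And>s. s \<notin> S \<Longrightarrow> y s = 0"
      "F = (\<Sum>s\<in>S. tens X Y s (y s))" by blast
    have "a \<in> X.span B" using B(3) step(1) by blast
    then obtain T r where T: "finite T" "T \<subseteq> B" "a = (\<Sum>t\<in>T. smul X (r t) t)"
      unfolding X.span_explicit by blast
    define z where "z s = (if s \<in> T then smul Y (c * r s) b else 0)" for s
    have z: "z s \<in> carr Y" for s
      unfolding z_def using is_vspace_zero[OF Y] is_vspace_scale[OF Y step(2)] by simp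
    have TX: "t \<in> carr X" if "t \<in> T" for t using that T(2) B(1) by blast
    have lin: "linear_map X (X \<otimes> Y) (\<lambda>a. tens X Y a (smul Y c b))"
      by (rule linear_map_tens_left) (rule is_vspace_scale[OF Y step(2)])
    have "fscale c (tens X Y a b) = tens X Y a (smul Y c b)"
      using linear_map_scale[OF linear_map_tens_right[OF step(1)] step(2)] by simp
    also have "\<dots> = (\<Sum>t\<in>T. tens X Y (smul X (r t) t) (smul Y c b))"
      unfolding T(3) by (rule linear_map_sum[OF X lin]) (rule is_vspace_scale[OF X TX])
    also have "\<dots> = (\<Sum>t\<in>T. tens X Y t (z t))"
    proof (rule sum.cong[OF refl])
      fix t assume t: "t \<in> T"
      have "tens X Y (smul X (r t) t) (smul Y c b) = fscale (r t) (tens X Y t (smul Y c b))"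
        using linear_map_scale[OF lin TX[OF t]] by simp
      also have "\<dots> = tens X Y t (smul Y (r t) (smul Y c b))"
        using linear_map_scale[OF linear_map_tens_right[OF TX[OF t]] is_vspace_scale[OF Y step(2)]]
        by simp
      finally show "tens X Y (smul X (r t) t) (smul Y c b) = tens X Y t (z t)"
        using t by (simp add: z_def mult.commute)
    qed
    also have "\<dots> = (\<Sum>t\<in>S \<union> T. tens X Y t (z t))"
      by (rule sum.mono_neutral_left) (use S T B(1) tens0 in \<open>auto simp: z_def\<close>)
    finally have 1: "fscale c (tens X Y a b) = (\<Sum>t\<in>S \<union> T. tens X Y t (z t))" .
    have 2: "F = (\<Sum>t\<in>S \<union> T. tens X Y t (y t))"
      unfolding S(5) by (rule sum.mono_neutral_left) (use S T B(1) tens0 in auto)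
    have "fscale c (tens X Y a b) + F = (\<Sum>t\<in>S \<union> T. tens X Y t (z t + y t))"
      unfolding 1 2 sum.distrib[symmetric]
    proof (rule sum.cong[OF refl])
      fix t assume "t \<in> S \<union> T"
      then have "t \<in> carr X" using S(2) T(2) B(1) by blast
      then show "tens X Y t (z t) + tens X Y t (y t) = tens X Y t (z t + y t)"
        using linear_map_add[OF linear_map_tens_right[of t X Y] z S(3), of t] by metis
    qed
    then show ?case
      using S T z is_vspace_add[OF Y]
      by (intro exI[of _ "S \<union> T"] exI[of _ "\<lambda>t. z t + y t"]) (simp add: z_def)
  qed
  then obtain S y where S: "finite S" "S \<subseteq> B" "\<And>s. y s \<in> carr Y" 
      "F = (\<Sum>s\<in>S. tens X Y s (y s))" by blast
  show thesis
    by (rule that[OF S(1) _ _ S(3,4)]) (use S(2) B X.dependent_mono in blast)+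
qed

text \<open>Separation survives tensor products. Write \<open>F = \<Sum>s. s \<otimes> y s\<close> with independent \<open>s\<close>. If \<open>F\<close> pairs to
  zero with everything, then for each \<open>b\<close> the vector \<open>\<Sum>s. \<langle>y s, b\<rangle> s\<close> is killed by the right space of
  \<open>P\<close>, hence is zero. By independence all \<open>\<langle>y s, b\<rangle>\<close> vanish, and separation for \<open>Q\<close> gives \<open>y s = 0\<close>.\<close>

lemma is_pairing_ptensor:
  fixes P :: "('k::field, 'x::ab_group_add, 'a::ab_group_add) pairing"
    and Q :: "('k, 'y::ab_group_add, 'b::ab_group_add) pairing"
  assumes P: "is_pairing P" and Q: "is_pairing Q"
  shows "is_pairing (P \<odot> Q)"
  unfolding is_pairing_def lft_ptensor rgt_ptensor
proof (intro conjI ballI impI is_vspace_tensor bilinear_map_ptensor[OF P Q])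
  fix F assume F: "F \<in> carr (lft P \<otimes> lft Q)"
    and 0: "\<forall>T\<in>carr (rgt Q \<otimes> rgt P). pr (P \<odot> Q) F T = 0"
  interpret X: vector_space "smul (lft P)" using P by (simp add: is_pairing_def is_vspace_def)
  obtain S y where S: "finite S" "S \<subseteq> carr (lft P)" "X.independent S"
    and y: "\<And>s. y s \<in> carr (lft Q)" and F_eq: "F = (\<Sum>s\<in>S. tens (lft P) (lft Q) s (y s))"
    using tensor_basis_expansion[OF is_vspace_lft[OF P] is_vspace_lft[OF Q] F] by metis
  have in': "smul (lft P) c s \<in> carr (lft P)" if "s \<in> S" for c s
    using that S(2) is_vspace_scale[OF is_vspace_lft[OF P]] by blast
  have "y s = 0" if s: "s \<in> S" for s
  proof -
    have "pr Q (y s) b = 0" if b: "b \<in> carr (rgt Q)" for b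
    proof -
      let ?x = "\<Sum>s\<in>S. smul (lft P) (pr Q (y s) b) s"
      have "pr P ?x a = 0" if a: "a \<in> carr (rgt P)" for a
      proof -
        have "0 = pr (P \<odot> Q) F (tens (rgt Q) (rgt P) b a)" using 0 a b by (simp add: tens_in)
        also have "\<dots> = (\<Sum>s\<in>S. pr (P \<odot> Q) (tens (lft P) (lft Q) s (y s))
            (tens (rgt Q) (rgt P) b a))"
          unfolding F_eq
          by (rule linear_map_sum[OF is_vspace_tensor
                bilinear_map_left[OF bilinear_map_ptensor[OF P Q]]])
            (use S(2) y a b in \<open>auto intro: tens_in\<close>)
        also have "\<dots> = (\<Sum>s\<in>S. pr P (smul (lft P) (pr Q (y s) b) s) a)"
          using S(2) y a b linear_map_scale[OF linear_map_pr_left[OF P a]]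
          by (intro sum.cong) (auto simp: pr_tens[OF P Q] mult.commute)
        also have "\<dots> = pr P ?x a"
          by (rule linear_map_sum[OF is_vspace_lft[OF P] linear_map_pr_left[OF P a] in', symmetric])
        finally show ?thesis by simp
      qed
      then have "?x = 0"
        using P is_vspace_sum[OF is_vspace_lft[OF P], of S "\<lambda>s. smul (lft P) (pr Q (y s) b) s"] in'
        unfolding is_pairing_def by blast
      then show ?thesis
        using X.independentD[OF S(3,1) order_refl, of "\<lambda>s. pr Q (y s) b"] s by blast
    qed
    then show ?thesis using Q y unfolding is_pairing_def by blast
  qed
  moreover have "tens (lft P) (lft Q) s 0 = 0" if "s \<in> S" for s
    using linear_map_zero[OF is_vspace_lft[OF Q] linear_map_tens_right] that S(2) by blast
  ultimately show "F = 0" unfolding F_eq by (simp add: sum.neutral)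
qed

text \<open>The pairing \<open>P \<odot> Q \<odot> R\<close> has a right space bracketed to the right. Rebracketing it to the
  left makes \<^const>\<open>on12\<close> and \<^const>\<open>on23\<close> available on both sides.\<close>

definition ptensor3 where
  "ptensor3 P Q R = \<lparr>lft = lft P \<otimes> lft Q \<otimes> lft R, rgt = rgt R \<otimes> rgt Q \<otimes> rgt P,
     pr = (\<lambda>F T. pr (P \<odot> Q \<odot> R) F (assoc (rgt R) (rgt Q) (rgt P) T))\<rparr>"

lemma lft_ptensor3 [simp]: "lft (ptensor3 P Q R) = lft P \<otimes> lft Q \<otimes> lft R"
  and rgt_ptensor3 [simp]: "rgt (ptensor3 P Q R) = rgt R \<otimes> rgt Q \<otimes> rgt P"
  and pr_ptensor3: "pr (ptensor3 P Q R) F T =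
    pr (P \<odot> Q \<odot> R) F (assoc (rgt R) (rgt Q) (rgt P) T)"
  by (simp_all add: ptensor3_def)

text \<open>The associator can be moved to the other argument. The definition of \<open>ptensor3\<close> suits operators
  that act on the first two left factors; this form suits those that act on the last two.\<close>

lemma pr_ptensor3_assoc:
  assumes P: "is_pairing P" and Q: "is_pairing Q" and R: "is_pairing R"
    and F: "F \<in> carr (lft P \<otimes> lft Q \<otimes> lft R)" and T: "T \<in> carr (rgt R \<otimes> rgt Q \<otimes> rgt P)"
  shows "pr (ptensor3 P Q R) F T = pr (P \<odot> (Q \<odot> R)) (assoc (lft P) (lft Q) (lft R) F) T"
proof -
  note PQ = is_pairing_ptensor[OF P Q] and QR = is_pairing_ptensor[OF Q R]
  note vP = is_vspace_rgt[OF P] and vR = is_vspace_lft[OF R]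
  note b1 = bilinear_map_ptensor[OF PQ R, simplified] and b2 = bilinear_map_ptensor[OF P QR, simplified]
  note lF = linear_map_assoc[OF vR, of "lft P" "lft Q"]
    and lT = linear_map_assoc[OF vP, of "rgt R" "rgt Q"]
  show ?thesis
    unfolding pr_ptensor3
  proof (rule tensor_ext3[OF bilinear_map_left[OF b1] linear_map_comp[OF lF bilinear_map_left[OF b2]] _ F])
    show "assoc (rgt R) (rgt Q) (rgt P) T \<in> carr (rgt R \<otimes> (rgt Q \<otimes> rgt P))"
      by (rule linear_map_in[OF lT T])
    show "T \<in> carr (rgt R \<otimes> rgt Q \<otimes> rgt P)" by (rule T)
    fix x y z assume x: "x \<in> carr (lft P)" and y: "y \<in> carr (lft Q)" and z: "z \<in> carr (lft R)"
    let ?F = "tens (lft P \<otimes> lft Q) (lft R) (tens (lft P) (lft Q) x y) z"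
    have F: "?F \<in> carr (lft P \<otimes> lft Q \<otimes> lft R)" using x y z by (simp add: tens_in)
    show "pr (P \<odot> Q \<odot> R) ?F (assoc (rgt R) (rgt Q) (rgt P) T) =
        pr (P \<odot> (Q \<odot> R)) (assoc (lft P) (lft Q) (lft R) ?F) T"
    proof (rule tensor_ext3[OF linear_map_comp[OF lT bilinear_map_right[OF b1 F]]
          bilinear_map_right[OF b2 linear_map_in[OF lF F]] _ T])
      fix c b a assume c: "c \<in> carr (rgt R)" and b: "b \<in> carr (rgt Q)" and a: "a \<in> carr (rgt P)"
      show "pr (P \<odot> Q \<odot> R) ?F (assoc (rgt R) (rgt Q) (rgt P)
              (tens (rgt R \<otimes> rgt Q) (rgt P) (tens (rgt R) (rgt Q) c b) a)) =
        pr (P \<odot> (Q \<odot> R)) (assoc (lft P) (lft Q) (lft R) ?F)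
              (tens (rgt R \<otimes> rgt Q) (rgt P) (tens (rgt R) (rgt Q) c b) a)"
        using x y z a b c pr_tens[OF PQ R, simplified] pr_tens[OF P QR, simplified]
        by (simp add: assoc_tens[OF vP] assoc_tens[OF vR] tens_in pr_tens[OF P Q] pr_tens[OF Q R])
    qed
  qed
qed

lemma is_pairing_ptensor3:
  assumes P: "is_pairing P" and Q: "is_pairing Q" and R: "is_pairing R"
  shows "is_pairing (ptensor3 P Q R)"
proof -
  note PQR = is_pairing_ptensor[OF is_pairing_ptensor[OF P Q] R]
  note vP = is_vspace_rgt[OF P] and vR = is_vspace_rgt[OF R]
  note lT = linear_map_assoc[OF vP, of "rgt R" "rgt Q"]
  note b = bilinear_map_pr[OF PQR, simplified]
  show ?thesis
    unfolding is_pairing_def lft_ptensor3 rgt_ptensor3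
  proof (intro conjI ballI impI is_vspace_tensor)
    show "bilinear_map (lft P \<otimes> lft Q \<otimes> lft R) (rgt R \<otimes> rgt Q \<otimes> rgt P) ground
       (pr (ptensor3 P Q R))"
      unfolding ptensor3_def pairing.simps
      by (rule bilinear_map_comp2[OF b linear_map_id lT])
    fix F assume F: "F \<in> carr (lft P \<otimes> lft Q \<otimes> lft R)"
      and 0: "\<forall>T\<in>carr (rgt R \<otimes> rgt Q \<otimes> rgt P).
        pr (ptensor3 P Q R) F T = 0"
    have "pr (P \<odot> Q \<odot> R) F T = 0" if T: "T \<in> carr (rgt R \<otimes> (rgt Q \<otimes> rgt P))" for T
      using 0 linear_map_in[OF linear_map_unassoc[OF vR] T] assoc_unassoc[OF vR vP T]
      unfolding pr_ptensor3 by metis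
    then show "F = 0" using PQR F by (simp add: is_pairing_def)
  qed
qed


section \<open>Transposes\<close>

definition adj where
  "adj P Q f g \<longleftrightarrow> linear_map (lft P) (lft Q) f \<and> linear_map (rgt Q) (rgt P) g \<and>
     (\<forall>x\<in>carr (lft P). \<forall>b\<in>carr (rgt Q). pr Q (f x) b = pr P x (g b))"

lemma adjD:
  assumes "adj P Q f g"
  shows adj_linear_left: "linear_map (lft P) (lft Q) f"
    and adj_linear_right: "linear_map (rgt Q) (rgt P) g"
    and adj_pr: "\<And>x b. x \<in> carr (lft P) \<Longrightarrow> b \<in> carr (rgt Q) \<Longrightarrow> pr Q (f x) b = pr P x (g b)"
  using assms by (simp_all add: adj_def)

text \<open>A map that has a transpose is linear, by separation. This is how \<^const>\<open>pull\<close> is seen to be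
  linear, although it is defined by choosing preimages.\<close>

lemma adjI:
  assumes P: "is_pairing P" and Q: "is_pairing Q"
    and f: "\<And>x. x \<in> carr (lft P) \<Longrightarrow> f x \<in> carr (lft Q)"
    and g: "linear_map (rgt Q) (rgt P) g"
    and pr: "\<And>x b. x \<in> carr (lft P) \<Longrightarrow> b \<in> carr (rgt Q) \<Longrightarrow> pr Q (f x) b = pr P x (g b)"
  shows "adj P Q f g"
  unfolding adj_def
proof (intro conjI ballI g pr linear_mapI f)
  note vP = is_vspace_lft[OF P] and vQ = is_vspace_lft[OF Q]
  fix x assume x: "x \<in> carr (lft P)"
  {
    fix y assume y: "y \<in> carr (lft P)"
    have xy: "x + y \<in> carr (lft P)" using is_vspace_add[OF vP x y] .
    show "f (x + y) = f x + f y"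
    proof (rule pairing_eqI[OF Q f[OF xy] is_vspace_add[OF vQ f[OF x] f[OF y]]])
      fix b assume b: "b \<in> carr (rgt Q)"
      show "pr Q (f (x + y)) b = pr Q (f x + f y) b"
        using linear_map_add[OF linear_map_pr_left[OF P linear_map_in[OF g b]] x y]
          linear_map_add[OF linear_map_pr_left[OF Q b] f[OF x] f[OF y]] pr b x y xy by simp
    qed
  next
    fix c
    have cx: "smul (lft P) c x \<in> carr (lft P)" using is_vspace_scale[OF vP x] .
    show "f (smul (lft P) c x) = smul (lft Q) c (f x)"
    proof (rule pairing_eqI[OF Q f[OF cx] is_vspace_scale[OF vQ f[OF x]]])
      fix b assume b: "b \<in> carr (rgt Q)"
      show "pr Q (f (smul (lft P) c x)) b = pr Q (smul (lft Q) c (f x)) b"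
        using linear_map_scale[OF linear_map_pr_left[OF P linear_map_in[OF g b]] x, of c]
          linear_map_scale[OF linear_map_pr_left[OF Q b] f[OF x], of c] pr b x cx by simp
    qed
  }
qed

lemma adj_tensI:
  assumes P: "is_pairing P" and Q: "is_pairing Q" and R: "is_pairing R"
    and f: "linear_map (lft (P \<odot> Q)) (lft R) f"
    and g: "linear_map (rgt R) (rgt (P \<odot> Q)) g"
    and pr: "\<And>x y b. x \<in> carr (lft P) \<Longrightarrow> y \<in> carr (lft Q) \<Longrightarrow> b \<in> carr (rgt R) \<Longrightarrow>
      pr R (f (tens (lft P) (lft Q) x y)) b = rfun (rgt Q) (rgt P) (pr P x) (pr Q y) (g b)"
  shows "adj (P \<odot> Q) R f g"
proof -
  note PQ = is_pairing_ptensor[OF P Q]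
  show ?thesis
    unfolding adj_def
  proof (intro conjI ballI f g)
    fix F b assume F: "F \<in> carr (lft (P \<odot> Q))" and b: "b \<in> carr (rgt R)"
    note gb = linear_map_in[OF g b]
    show "pr R (f F) b = pr (P \<odot> Q) F (g b)"
      by (rule tensor_ext[OF linear_map_comp[OF f[simplified] linear_map_pr_left[OF R b]]
            linear_map_pr_left[OF PQ gb, simplified] _ F[simplified]])
        (use pr b gb in \<open>simp add: pr_tens_left[OF P Q]\<close>)
  qed
qed

text \<open>The transfer principle by which every module law is obtained.\<close>

lemma adj_unique:
  assumes Q: "is_pairing Q" and f: "adj P Q f g" and f': "adj P Q f' g'"
    and eq: "\<And>b. b \<in> carr (rgt Q) \<Longrightarrow> g b = g' b" and x: "x \<in> carr (lft P)"
  shows "f x = f' x"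
  using eq adj_pr[OF f x] adj_pr[OF f' x]
    linear_map_in[OF adj_linear_left[OF f] x] linear_map_in[OF adj_linear_left[OF f'] x]
  by (intro pairing_eqI[OF Q]) simp_all

lemma adj_comp:
  assumes "adj P Q f g" and "adj Q R f' g'"
  shows "adj P R (\<lambda>x. f' (f x)) (\<lambda>c. g (g' c))"
  using assms by (simp add: adj_def linear_map_def)

lemma adj_map_id:
  assumes P: "is_pairing P" and Q: "is_pairing Q" and R: "is_pairing R" and fg: "adj P Q f g"
  shows "adj (P \<odot> R) (Q \<odot> R) (map_id (lft P) (lft Q) (lft R) f) (id_map (rgt R) (rgt Q) (rgt P) g)"
proof (rule adj_tensI[OF P R is_pairing_ptensor[OF Q R]], unfold lft_ptensor rgt_ptensor)
  note f = adj_linear_left[OF fg] and g = adj_linear_right[OF fg]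
  show "linear_map (lft P \<otimes> lft R) (lft Q \<otimes> lft R) (map_id (lft P) (lft Q) (lft R) f)"
    by (rule linear_map_map_id[OF f])
  show lg: "linear_map (rgt R \<otimes> rgt Q) (rgt R \<otimes> rgt P) (id_map (rgt R) (rgt Q) (rgt P) g)"
    by (rule linear_map_id_map[OF g])
  fix x z T assume x: "x \<in> carr (lft P)" and z: "z \<in> carr (lft R)"
    and T: "T \<in> carr (rgt R \<otimes> rgt Q)"
  note fx = linear_map_in[OF f x]
  show "pr (Q \<odot> R) (map_id (lft P) (lft Q) (lft R) f (tens (lft P) (lft R) x z)) T =
      rfun (rgt R) (rgt P) (pr P x) (pr R z) (id_map (rgt R) (rgt Q) (rgt P) g T)"
    unfolding map_id_tens[OF f x z] pr_tens_left[OF Q R fx z T]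
  proof (rule tensor_ext[OF linear_map_rfun[OF linear_map_pr[OF Q fx] linear_map_pr[OF R z]]
        linear_map_comp[OF lg linear_map_rfun[OF linear_map_pr[OF P x] linear_map_pr[OF R z]]] _ T])
    fix c b assume c: "c \<in> carr (rgt R)" and b: "b \<in> carr (rgt Q)"
    show "rfun (rgt R) (rgt Q) (pr Q (f x)) (pr R z) (tens (rgt R) (rgt Q) c b) =
        rfun (rgt R) (rgt P) (pr P x) (pr R z)
          (id_map (rgt R) (rgt Q) (rgt P) g (tens (rgt R) (rgt Q) c b))"
      using adj_pr[OF fg x b] linear_map_in[OF g b] c b
      by (simp add: id_map_tens[OF g] rfun_tens[OF linear_map_pr[OF Q fx] linear_map_pr[OF R z]]
          rfun_tens[OF linear_map_pr[OF P x] linear_map_pr[OF R z]])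
  qed
qed

lemma adj_id_map:
  assumes P: "is_pairing P" and Q: "is_pairing Q" and R: "is_pairing R" and fg: "adj P Q f g"
  shows "adj (R \<odot> P) (R \<odot> Q) (id_map (lft R) (lft P) (lft Q) f) (map_id (rgt Q) (rgt P) (rgt R) g)"
proof (rule adj_tensI[OF R P is_pairing_ptensor[OF R Q]], unfold lft_ptensor rgt_ptensor)
  note f = adj_linear_left[OF fg] and g = adj_linear_right[OF fg]
  show "linear_map (lft R \<otimes> lft P) (lft R \<otimes> lft Q) (id_map (lft R) (lft P) (lft Q) f)"
    by (rule linear_map_id_map[OF f])
  show lg: "linear_map (rgt Q \<otimes> rgt R) (rgt P \<otimes> rgt R) (map_id (rgt Q) (rgt P) (rgt R) g)"
    by (rule linear_map_map_id[OF g])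
  fix z x T assume x: "x \<in> carr (lft P)" and z: "z \<in> carr (lft R)"
    and T: "T \<in> carr (rgt Q \<otimes> rgt R)"
  note fx = linear_map_in[OF f x]
  show "pr (R \<odot> Q) (id_map (lft R) (lft P) (lft Q) f (tens (lft R) (lft P) z x)) T =
      rfun (rgt P) (rgt R) (pr R z) (pr P x) (map_id (rgt Q) (rgt P) (rgt R) g T)"
    unfolding id_map_tens[OF f z x] pr_tens_left[OF R Q z fx T]
  proof (rule tensor_ext[OF linear_map_rfun[OF linear_map_pr[OF R z] linear_map_pr[OF Q fx]]
        linear_map_comp[OF lg linear_map_rfun[OF linear_map_pr[OF R z] linear_map_pr[OF P x]]] _ T])
    fix b c assume c: "c \<in> carr (rgt R)" and b: "b \<in> carr (rgt Q)"
    show "rfun (rgt Q) (rgt R) (pr R z) (pr Q (f x)) (tens (rgt Q) (rgt R) b c) =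
        rfun (rgt P) (rgt R) (pr R z) (pr P x)
          (map_id (rgt Q) (rgt P) (rgt R) g (tens (rgt Q) (rgt R) b c))"
      using adj_pr[OF fg x b] linear_map_in[OF g b] c b
      by (simp add: map_id_tens[OF g] rfun_tens[OF linear_map_pr[OF R z] linear_map_pr[OF Q fx]]
          rfun_tens[OF linear_map_pr[OF R z] linear_map_pr[OF P x]])
  qed
qed

section \<open>Transposes of the operators on triple tensor products\<close>

lemma linear_map_on12:
  assumes "linear_map (X \<otimes> Y) (Y \<otimes> X) f"
  shows "linear_map (X \<otimes> Y \<otimes> C) (Y \<otimes> X \<otimes> C) (on12 X Y C f)"
  unfolding on12_def by (rule linear_map_map_id[OF assms])

lemma linear_map_on23:
  assumes C: "is_vspace C" and Y: "is_vspace Y" and f: "linear_map (X \<otimes> Y) (Y \<otimes> X) f"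
  shows "linear_map (C \<otimes> X \<otimes> Y) (C \<otimes> Y \<otimes> X) (on23 C X Y f)"
  unfolding on23_def
  by (rule linear_map_comp[OF linear_map_comp[OF linear_map_assoc[OF Y] linear_map_id_map[OF f]]
        linear_map_unassoc[OF C]])

lemma on12_map_id:
  assumes "linear_map X (Y \<otimes> Z) f" and "linear_map (Y \<otimes> Z) (Z \<otimes> Y) g" and "t \<in> carr (X \<otimes> C)"
  shows "on12 Y Z C g (map_id X (Y \<otimes> Z) C f t) = map_id X (Z \<otimes> Y) C (\<lambda>x. g (f x)) t"
  unfolding on12_def by (rule map_id_comp[OF assms])

lemma on23_id_map:
  assumes C: "is_vspace C" and Z: "is_vspace Z"
    and f: "linear_map X (Y \<otimes> Z) f" and g: "linear_map (Y \<otimes> Z) (Z \<otimes> Y) g" and t: "t \<in> carr (C \<otimes> X)"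
  shows "on23 C Y Z g (unassoc C Y Z (id_map C X (Y \<otimes> Z) f t)) =
    unassoc C Z Y (id_map C X (Z \<otimes> Y) (\<lambda>x. g (f x)) t)"
  unfolding on23_def assoc_unassoc[OF C Z linear_map_in[OF linear_map_id_map[OF f] t]]
  by (simp add: id_map_comp[OF f g t])

lemma on12_inverse:
  assumes f: "linear_map (X \<otimes> Y) (Y \<otimes> X) f" and g: "linear_map (Y \<otimes> X) (X \<otimes> Y) g"
    and gf: "\<And>s. s \<in> carr (X \<otimes> Y) \<Longrightarrow> g (f s) = s" and t: "t \<in> carr (X \<otimes> Y \<otimes> C)"
  shows "on12 Y X C g (on12 X Y C f t) = t"
  unfolding on12_def map_id_comp[OF f g t] by (rule map_id_ident[OF linear_map_comp[OF f g] gf t])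

lemma on23_inverse:
  assumes C: "is_vspace C" and X: "is_vspace X" and Y: "is_vspace Y"
    and f: "linear_map (X \<otimes> Y) (Y \<otimes> X) f" and g: "linear_map (Y \<otimes> X) (X \<otimes> Y) g"
    and gf: "\<And>s. s \<in> carr (X \<otimes> Y) \<Longrightarrow> g (f s) = s" and t: "t \<in> carr (C \<otimes> X \<otimes> Y)"
  shows "on23 C Y X g (on23 C X Y f t) = t"
proof -
  note at = linear_map_in[OF linear_map_assoc[OF Y] t]
  have "id_map C (X \<otimes> Y) (X \<otimes> Y) (\<lambda>x. g (f x)) (assoc C X Y t) = assoc C X Y t"
    by (rule id_map_ident[OF linear_map_comp[OF f g] gf at])
  then show ?thesis
    unfolding on23_def[of C X] on23_id_map[OF C X f g at] by (simp add: unassoc_assoc[OF C Y t])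
qed

text \<open>The reversed pairing matches the first two factors on the left with the last two on the right, so
  \<open>f \<otimes> id\<close> is transposed to \<open>id \<otimes> g\<close> and conversely.\<close>

lemma adj_on12:
  assumes P: "is_pairing P" and Q: "is_pairing Q" and R: "is_pairing R"
    and fg: "adj (P \<odot> Q) (Q \<odot> P) f g"
  shows "adj (ptensor3 P Q R) (ptensor3 Q P R) (on12 (lft P) (lft Q) (lft R) f)
    (on23 (rgt R) (rgt P) (rgt Q) g)"
proof -
  note f = adj_linear_left[OF fg, simplified] and g = adj_linear_right[OF fg, simplified]
  note vP = is_vspace_rgt[OF P] and vQ = is_vspace_rgt[OF Q] and vR = is_vspace_rgt[OF R]
  note A = adj_map_id[OF is_pairing_ptensor[OF P Q] is_pairing_ptensor[OF Q P] R fg]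
  show ?thesis
    unfolding adj_def lft_ptensor3 rgt_ptensor3
  proof (intro conjI ballI linear_map_on12[OF f] linear_map_on23[OF vR vQ g])
    fix F T assume F: "F \<in> carr (lft P \<otimes> lft Q \<otimes> lft R)"
      and T: "T \<in> carr (rgt R \<otimes> rgt P \<otimes> rgt Q)"
    note aT = linear_map_in[OF linear_map_assoc[OF vQ] T]
    show "pr (ptensor3 Q P R) (on12 (lft P) (lft Q) (lft R) f F) T =
        pr (ptensor3 P Q R) F (on23 (rgt R) (rgt P) (rgt Q) g T)"
      unfolding pr_ptensor3 on12_def on23_def
        assoc_unassoc[OF vR vP linear_map_in[OF linear_map_id_map[OF g] aT]]
      using adj_pr[OF A, simplified] F aT by blast
  qed
qed

lemma adj_on23:
  assumes P: "is_pairing P" and Q: "is_pairing Q" and R: "is_pairing R"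
    and fg: "adj (Q \<odot> R) (R \<odot> Q) f g"
  shows "adj (ptensor3 P Q R) (ptensor3 P R Q) (on23 (lft P) (lft Q) (lft R) f)
    (on12 (rgt Q) (rgt R) (rgt P) g)"
proof -
  note f = adj_linear_left[OF fg, simplified] and g = adj_linear_right[OF fg, simplified]
  note vP = is_vspace_lft[OF P] and vQ = is_vspace_lft[OF Q] and vR = is_vspace_lft[OF R]
  note A = adj_id_map[OF is_pairing_ptensor[OF Q R] is_pairing_ptensor[OF R Q] P fg]
  note l12 = linear_map_on12[OF g] and l23 = linear_map_on23[OF vP vR f]
  show ?thesis
    unfolding adj_def lft_ptensor3 rgt_ptensor3
  proof (intro conjI ballI l12 l23)
    fix F T assume F: "F \<in> carr (lft P \<otimes> lft Q \<otimes> lft R)"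
      and T: "T \<in> carr (rgt Q \<otimes> rgt R \<otimes> rgt P)"
    note aF = linear_map_in[OF linear_map_assoc[OF vR] F]
    show "pr (ptensor3 P R Q) (on23 (lft P) (lft Q) (lft R) f F) T =
        pr (ptensor3 P Q R) F (on12 (rgt Q) (rgt R) (rgt P) g T)"
      unfolding pr_ptensor3_assoc[OF P R Q linear_map_in[OF l23 F] T]
        pr_ptensor3_assoc[OF P Q R F linear_map_in[OF l12 T]]
      unfolding on12_def on23_def
        assoc_unassoc[OF vP vQ linear_map_in[OF linear_map_id_map[OF f] aF]]
      using adj_pr[OF A, simplified] aF T by blast
  qed
qed

text \<open>The same for maps that contract two factors into one; the transposes expand one factor into two.\<close>

lemma adj_mult12:
  assumes P: "is_pairing P" and Q: "is_pairing Q" and R: "is_pairing R" and M: "is_pairing M"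
    and fg: "adj (P \<odot> Q) M f g"
  shows "adj (ptensor3 P Q R) (M \<odot> R) (map_id (lft P \<otimes> lft Q) (lft M) (lft R) f)
    (\<lambda>t. unassoc (rgt R) (rgt Q) (rgt P) (id_map (rgt R) (rgt M) (rgt Q \<otimes> rgt P) g t))"
proof -
  note f = adj_linear_left[OF fg, simplified] and g = adj_linear_right[OF fg, simplified]
  note vP = is_vspace_rgt[OF P] and vR = is_vspace_rgt[OF R]
  note A = adj_map_id[OF is_pairing_ptensor[OF P Q] M R fg]
  note l = linear_map_id_map[OF g]
  show ?thesis
    unfolding adj_def lft_ptensor3 rgt_ptensor3 lft_ptensor rgt_ptensor
  proof (intro conjI ballI linear_map_map_id[OF f] linear_map_comp[OF l linear_map_unassoc[OF vR]])
    fix F T assume F: "F \<in> carr (lft P \<otimes> lft Q \<otimes> lft R)" and T: "T \<in> carr (rgt R \<otimes> rgt M)"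
    show "pr (M \<odot> R) (map_id (lft P \<otimes> lft Q) (lft M) (lft R) f F) T =
        pr (ptensor3 P Q R) F
          (unassoc (rgt R) (rgt Q) (rgt P) (id_map (rgt R) (rgt M) (rgt Q \<otimes> rgt P) g T))"
      unfolding pr_ptensor3 assoc_unassoc[OF vR vP linear_map_in[OF l T]]
      using adj_pr[OF A, simplified] F T by blast
  qed
qed

lemma adj_mult23:
  assumes P: "is_pairing P" and Q: "is_pairing Q" and R: "is_pairing R" and M: "is_pairing M"
    and fg: "adj (Q \<odot> R) M f g"
  shows "adj (ptensor3 P Q R) (P \<odot> M)
    (\<lambda>t. id_map (lft P) (lft Q \<otimes> lft R) (lft M) f (assoc (lft P) (lft Q) (lft R) t))
    (map_id (rgt M) (rgt R \<otimes> rgt Q) (rgt P) g)"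
proof -
  note f = adj_linear_left[OF fg, simplified] and g = adj_linear_right[OF fg, simplified]
  note vR = is_vspace_lft[OF R]
  note A = adj_id_map[OF is_pairing_ptensor[OF Q R] M P fg]
  note l = linear_map_map_id[OF g]
  show ?thesis
    unfolding adj_def lft_ptensor3 rgt_ptensor3 lft_ptensor rgt_ptensor
  proof (intro conjI ballI l linear_map_comp[OF linear_map_assoc[OF vR] linear_map_id_map[OF f]])
    fix F T assume F: "F \<in> carr (lft P \<otimes> lft Q \<otimes> lft R)" and T: "T \<in> carr (rgt M \<otimes> rgt P)"
    show "pr (P \<odot> M)
          (id_map (lft P) (lft Q \<otimes> lft R) (lft M) f (assoc (lft P) (lft Q) (lft R) F)) T =
        pr (ptensor3 P Q R) F (map_id (rgt M) (rgt R \<otimes> rgt Q) (rgt P) g T)"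
      unfolding pr_ptensor3_assoc[OF P Q R F linear_map_in[OF l T]]
      using adj_pr[OF A, simplified] linear_map_in[OF linear_map_assoc[OF vR] F] T by blast
  qed
qed

lemma linear_map_inv_into:
  assumes A: "is_vspace A" and f: "linear_bij A B f"
  shows "linear_map B A (inv_into (carr A) f)"
proof -
  note lin = linear_bij_def[THEN iffD1, OF f, THEN conjunct1]
    and bij = linear_bij_def[THEN iffD1, OF f, THEN conjunct2]
  let ?g = "inv_into (carr A) f"
  note g = bij_betwE[OF bij_betw_inv_into[OF bij]]
    and gf = bij_betw_inv_into_left[OF bij] and fg = bij_betw_inv_into_right[OF bij]
  show ?thesis
  proof (rule linear_mapI)
    fix x assume x: "x \<in> carr B"
    show "?g x \<in> carr A" using g x by blast
    fix y assume y: "y \<in> carr B"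
    have "?g (f (?g x + ?g y)) = ?g x + ?g y" using g x y is_vspace_add[OF A] gf by blast
    then show "?g (x + y) = ?g x + ?g y"
      using g x y linear_map_add[OF lin] fg by simp
  next
    fix c x assume x: "x \<in> carr B"
    have "?g (f (smul A c (?g x))) = smul A c (?g x)" using g x is_vspace_scale[OF A] gf by blast
    then show "?g (smul B c x) = smul A c (?g x)"
      using g x linear_map_scale[OF lin] fg by simp
  qed
qed

lemma adj_inv_into:
  assumes P: "is_pairing P" and Q: "is_pairing Q" and fg: "adj P Q f g"
    and f: "linear_bij (lft P) (lft Q) f" and g: "linear_bij (rgt Q) (rgt P) g"
  shows "adj Q P (inv_into (carr (lft P)) f) (inv_into (carr (rgt Q)) g)"
  unfolding adj_def
proof (intro conjI ballI linear_map_inv_into is_vspace_lft[OF P] is_vspace_rgt[OF Q] f g)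
  let ?f = "inv_into (carr (lft P)) f" and ?g = "inv_into (carr (rgt Q)) g"
  have bf: "bij_betw f (carr (lft P)) (carr (lft Q))" and bg: "bij_betw g (carr (rgt Q)) (carr (rgt P))"
    using f g by (simp_all add: linear_bij_def)
  fix x b assume x: "x \<in> carr (lft Q)" and b: "b \<in> carr (rgt P)"
  have "?f x \<in> carr (lft P)" "?g b \<in> carr (rgt Q)"
    using bij_betwE[OF bij_betw_inv_into[OF bf]] bij_betwE[OF bij_betw_inv_into[OF bg]] x b by blast+
  then have "pr Q (f (?f x)) (?g b) = pr P (?f x) (g (?g b))" by (rule adj_pr[OF fg])
  then show "pr P (?f x) b = pr Q x (?g b)"
    by (simp add: bij_betw_inv_into_right[OF bf x] bij_betw_inv_into_right[OF bg b])
qed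

lemma inv_on:
  assumes f: "linear_bij (X \<otimes> Y) Z f"
  shows linear_map_inv_on: "linear_map Z (X \<otimes> Y) (inv_on X Y f)"
    and inv_on_right: "\<And>t. t \<in> carr Z \<Longrightarrow> f (inv_on X Y f t) = t"
    and inv_on_left: "\<And>t. t \<in> carr (X \<otimes> Y) \<Longrightarrow> inv_on X Y f (f t) = t"
proof -
  have b: "bij_betw f (carr (X \<otimes> Y)) (carr Z)" using f by (simp add: linear_bij_def)
  show "linear_map Z (X \<otimes> Y) (inv_on X Y f)"
    unfolding inv_on_def by (rule linear_map_inv_into[OF is_vspace_tensor f])
  show "f (inv_on X Y f t) = t" if "t \<in> carr Z" for t
    unfolding inv_on_def by (rule bij_betw_inv_into_right[OF b that])
  show "inv_on X Y f (f t) = t" if "t \<in> carr (X \<otimes> Y)" for t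
    unfolding inv_on_def by (rule bij_betw_inv_into_left[OF b that])
qed


section \<open>Comodules with inverse braidings\<close>

text \<open>Evaluating an axiom at a vector in the image of the inverse braidings moves the braidings to the
  other side as their inverses. In this way the axioms for \<open>\<Delta>\<close> and \<open>\<rho>\<close> give the laws
  \<open>\<Delta>\<^sub>1\<^sub>2 S = S\<^sub>2\<^sub>3 S\<^sub>1\<^sub>2 \<Delta>\<^sub>2\<^sub>3\<close> and \<open>\<rho>\<^sub>2\<^sub>3 S = S\<^sub>1\<^sub>2 R\<^sub>2\<^sub>3 \<rho>\<^sub>1\<^sub>2\<close>. Composing them with \<open>R\<^sub>1\<^sub>2\<close> and \<open>S\<^sub>2\<^sub>3\<close> and using the
  braid relation for \<open>R\<close> and \<open>S\<close> yields the laws for \<open>R \<Delta>\<close> and \<open>S \<rho>\<close>; in coassociativity both sides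
  become \<open>S\<^sub>2\<^sub>3 S\<^sub>1\<^sub>2 R\<^sub>2\<^sub>3\<close> applied to the two sides of \<open>\<rho>\<^sub>1\<^sub>2 \<rho> = \<Delta>\<^sub>2\<^sub>3 \<rho>\<close>.\<close>

lemma braided_right_comodule_inverse:
  fixes H :: "('k::field, 'h::ab_group_add) vspace" and V :: "('k, 'v::ab_group_add) vspace"
  assumes com: "braided_right_comodule H \<Delta> \<epsilon> \<Psi> V \<Theta> \<rho>"
  defines "R \<equiv> inv_on H H \<Psi>" and "S \<equiv> inv_on H V \<Theta>"
  shows right_comodule_braid: "\<And>t. t \<in> carr (V \<otimes> H \<otimes> H) \<Longrightarrow>
      on12 H H V R (on23 H V H S (on12 V H H S t)) =
      on23 H V H S (on12 V H H S (on23 V H H R t))"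
    and right_comodule_comult: "\<And>t. t \<in> carr (V \<otimes> H) \<Longrightarrow>
      map_id H (H \<otimes> H) V (\<lambda>a. R (\<Delta> a)) (S t) =
      on23 H V H S (on12 V H H S (unassoc V H H (id_map V H (H \<otimes> H) (\<lambda>a. R (\<Delta> a)) t)))"
    and right_comodule_coassoc: "\<And>v. v \<in> carr V \<Longrightarrow>
      unassoc H H V (id_map H V (H \<otimes> V) (\<lambda>v. S (\<rho> v)) (S (\<rho> v))) =
      map_id H (H \<otimes> H) V (\<lambda>a. R (\<Delta> a)) (S (\<rho> v))"
    and right_comodule_coact: "\<And>t. t \<in> carr (V \<otimes> H) \<Longrightarrow>
      unassoc H H V (id_map H V (H \<otimes> V) (\<lambda>v. S (\<rho> v)) (S t)) =
      on12 H H V R (on23 H V H S (map_id V (H \<otimes> V) H (\<lambda>v. S (\<rho> v)) t))"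
    and right_comodule_counit: "\<And>t. t \<in> carr (V \<otimes> H) \<Longrightarrow>
      fun_id H V \<epsilon> (S t) = id_fun V H \<epsilon> t"
proof -
  have H: "is_vspace H" and V: "is_vspace V"
    and \<Psi>: "linear_bij (H \<otimes> H) (H \<otimes> H) \<Psi>" and \<Theta>: "linear_bij (H \<otimes> V) (V \<otimes> H) \<Theta>"
    and \<Delta>: "linear_map H (H \<otimes> H) \<Delta>" and \<rho>: "linear_map V (V \<otimes> H) \<rho>"
    and braid: "\<And>t. t \<in> carr (H \<otimes> H \<otimes> V) \<Longrightarrow>
        on12 H V H \<Theta> (on23 H H V \<Theta> (on12 H H V \<Psi> t)) =
        on23 V H H \<Psi> (on12 H V H \<Theta> (on23 H H V \<Theta> t))"
    and comult: "\<And>t. t \<in> carr (H \<otimes> V) \<Longrightarrow>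
        unassoc V H H (id_map V H (H \<otimes> H) \<Delta> (\<Theta> t)) =
          on12 H V H \<Theta> (on23 H H V \<Theta> (map_id H (H \<otimes> H) V \<Delta> t))"
    and counit: "\<And>t. t \<in> carr (H \<otimes> V) \<Longrightarrow> id_fun V H \<epsilon> (\<Theta> t) = fun_id H V \<epsilon> t"
    and coassoc: "\<And>v. v \<in> carr V \<Longrightarrow>
        map_id V (V \<otimes> H) H \<rho> (\<rho> v) = unassoc V H H (id_map V H (H \<otimes> H) \<Delta> (\<rho> v))"
    and coact: "\<And>t. t \<in> carr (H \<otimes> V) \<Longrightarrow> map_id V (V \<otimes> H) H \<rho> (\<Theta> t) =
        on23 V H H \<Psi> (on12 H V H \<Theta> (unassoc H V H (id_map H V (V \<otimes> H) \<rho> t)))"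
    using com unfolding braided_right_comodule_def left_braided_def braiding_def
      compat_comult_left_def braided_coalgebra_def coalgebra_def by blast+
  have \<Psi>l: "linear_map (H \<otimes> H) (H \<otimes> H) \<Psi>" and \<Theta>l: "linear_map (H \<otimes> V) (V \<otimes> H) \<Theta>"
    using \<Psi> \<Theta> by (simp_all add: linear_bij_def)
  note R = linear_map_inv_on[OF \<Psi>, folded R_def] and S = linear_map_inv_on[OF \<Theta>, folded S_def]
  note \<Psi>R = inv_on_right[OF \<Psi>, folded R_def] and R\<Psi> = inv_on_left[OF \<Psi>, folded R_def]
  note \<Theta>S = inv_on_right[OF \<Theta>, folded S_def] and S\<Theta> = inv_on_left[OF \<Theta>, folded S_def]
  note ins = linear_map_in[OF linear_map_on12[OF R]] linear_map_in[OF linear_map_on23[OF V H R]]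
    linear_map_in[OF linear_map_on12[OF S]] linear_map_in[OF linear_map_on23[OF H H S]]
    linear_map_in[OF linear_map_on12[OF \<Theta>l]] linear_map_in[OF linear_map_on23[OF H V \<Theta>l]]
    linear_map_in[OF linear_map_map_id[OF \<Delta>]] linear_map_in[OF linear_map_map_id[OF \<rho>]]
    linear_map_in[OF linear_map_comp[OF linear_map_id_map[OF \<Delta>] linear_map_unassoc[OF V]]]
    linear_map_in[OF linear_map_comp[OF linear_map_id_map[OF \<rho>] linear_map_unassoc[OF H]]]
    linear_map_in[OF S] linear_map_in[OF \<rho>]
  note invs = on12_inverse[OF R \<Psi>l, OF \<Psi>R] on12_inverse[OF S \<Theta>l, OF \<Theta>S] on12_inverse[OF \<Theta>l S, OF S\<Theta>]
    on23_inverse[OF H V H S \<Theta>l, OF \<Theta>S] on23_inverse[OF H H V \<Theta>l S, OF S\<Theta>]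
    on23_inverse[OF V H H \<Psi>l R, OF R\<Psi>]
  note \<Delta>12 = on12_map_id[OF \<Delta> R] and \<Delta>23 = on23_id_map[OF V H \<Delta> R]
    and \<rho>12 = on12_map_id[OF \<rho> S] and \<rho>23 = on23_id_map[OF H H \<rho> S]
  show b: "on12 H H V R (on23 H V H S (on12 V H H S t)) =
      on23 H V H S (on12 V H H S (on23 V H H R t))" if t: "t \<in> carr (V \<otimes> H \<otimes> H)" for t
  proof -
    \<comment> \<open>The braid relation for \<open>\<Psi>\<close> and \<open>\<Theta>\<close> at \<open>?w\<close> undoes all three factors of \<open>?w\<close> on its left-hand side.\<close>
    let ?w = "on12 H H V R (on23 H V H S (on12 V H H S t))"
    have w: "?w \<in> carr (H \<otimes> H \<otimes> V)" using t ins by metis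
    have "on23 V H H \<Psi> (on12 H V H \<Theta> (on23 H H V \<Theta> ?w)) = t"
      using braid[OF w] t by (simp add: invs ins)
    then have "on12 H V H \<Theta> (on23 H H V \<Theta> ?w) = on23 V H H R t"
      using invs(6)[of "on12 H V H \<Theta> (on23 H H V \<Theta> ?w)"] w by (simp add: ins)
    then have "on23 H V H S (on12 V H H S (on12 H V H \<Theta> (on23 H H V \<Theta> ?w))) =
        on23 H V H S (on12 V H H S (on23 V H H R t))" by simp
    then show ?thesis using w by (simp add: invs ins)
  qed
  have D: "map_id H (H \<otimes> H) V \<Delta> (S t) =
      on23 H V H S (on12 V H H S (unassoc V H H (id_map V H (H \<otimes> H) \<Delta> t)))"
    if t: "t \<in> carr (V \<otimes> H)" for t
  proof -
    have St: "S t \<in> carr (H \<otimes> V)" using t ins by metis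
    show ?thesis using comult[OF St] St by (simp add: \<Theta>S[OF t] invs ins)
  qed
  show D': "map_id H (H \<otimes> H) V (\<lambda>a. R (\<Delta> a)) (S t) =
      on23 H V H S (on12 V H H S (unassoc V H H (id_map V H (H \<otimes> H) (\<lambda>a. R (\<Delta> a)) t)))"
    if t: "t \<in> carr (V \<otimes> H)" for t
  proof -
    have St: "S t \<in> carr (H \<otimes> V)" using t ins by metis
    show ?thesis
      unfolding \<Delta>12[OF St, symmetric] \<Delta>23[OF t, symmetric] D[OF t] using b t by (simp add: ins)
  qed
  have N: "unassoc H V H (id_map H V (V \<otimes> H) \<rho> (S t)) =
      on12 V H H S (on23 V H H R (map_id V (V \<otimes> H) H \<rho> t))"
    if t: "t \<in> carr (V \<otimes> H)" for t
  proof -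
    have St: "S t \<in> carr (H \<otimes> V)" using t ins by metis
    show ?thesis using coact[OF St] St by (simp add: \<Theta>S[OF t] invs ins)
  qed
  have N': "unassoc H H V (id_map H V (H \<otimes> V) (\<lambda>v. S (\<rho> v)) (S t)) =
      on23 H V H S (on12 V H H S (on23 V H H R (map_id V (V \<otimes> H) H \<rho> t)))"
    if t: "t \<in> carr (V \<otimes> H)" for t
  proof -
    have St: "S t \<in> carr (H \<otimes> V)" using t ins by metis
    show ?thesis unfolding \<rho>23[OF St, symmetric] N[OF t] ..
  qed
  show "unassoc H H V (id_map H V (H \<otimes> V) (\<lambda>v. S (\<rho> v)) (S (\<rho> v))) =
      map_id H (H \<otimes> H) V (\<lambda>a. R (\<Delta> a)) (S (\<rho> v))" if v: "v \<in> carr V" for v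
  proof -
    have \<rho>v: "\<rho> v \<in> carr (V \<otimes> H)" using v ins by metis
    show ?thesis
      unfolding N'[OF \<rho>v] D'[OF \<rho>v] coassoc[OF v] \<Delta>23[OF \<rho>v] ..
  qed
  show "unassoc H H V (id_map H V (H \<otimes> V) (\<lambda>v. S (\<rho> v)) (S t)) =
      on12 H H V R (on23 H V H S (map_id V (H \<otimes> V) H (\<lambda>v. S (\<rho> v)) t))"
    if t: "t \<in> carr (V \<otimes> H)" for t
    unfolding N'[OF t] \<rho>12[OF t, symmetric] using b t by (simp add: ins)
  show "fun_id H V \<epsilon> (S t) = id_fun V H \<epsilon> t" if t: "t \<in> carr (V \<otimes> H)" for t
    using counit[of "S t"] t by (simp add: ins \<Theta>S)
qed

text \<open>The mirror image: the order of the factors is reversed, and 12 and 23 are exchanged.\<close>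

lemma braided_left_comodule_inverse:
  fixes H :: "('k::field, 'h::ab_group_add) vspace" and V :: "('k, 'v::ab_group_add) vspace"
  assumes com: "braided_left_comodule H \<Delta> \<epsilon> \<Psi> V \<Theta> \<rho>"
  defines "R \<equiv> inv_on H H \<Psi>" and "S \<equiv> inv_on V H \<Theta>"
  shows left_comodule_braid: "\<And>t. t \<in> carr (H \<otimes> H \<otimes> V) \<Longrightarrow>
      on23 V H H R (on12 H V H S (on23 H H V S t)) =
      on12 H V H S (on23 H H V S (on12 H H V R t))"
    and left_comodule_comult: "\<And>t. t \<in> carr (H \<otimes> V) \<Longrightarrow>
      unassoc V H H (id_map V H (H \<otimes> H) (\<lambda>a. R (\<Delta> a)) (S t)) =
      on12 H V H S (on23 H H V S (map_id H (H \<otimes> H) V (\<lambda>a. R (\<Delta> a)) t))"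
    and left_comodule_coassoc: "\<And>v. v \<in> carr V \<Longrightarrow>
      map_id V (V \<otimes> H) H (\<lambda>v. S (\<rho> v)) (S (\<rho> v)) =
      unassoc V H H (id_map V H (H \<otimes> H) (\<lambda>a. R (\<Delta> a)) (S (\<rho> v)))"
    and left_comodule_coact: "\<And>t. t \<in> carr (H \<otimes> V) \<Longrightarrow>
      map_id V (V \<otimes> H) H (\<lambda>v. S (\<rho> v)) (S t) =
      on23 V H H R (on12 H V H S (unassoc H V H (id_map H V (V \<otimes> H) (\<lambda>v. S (\<rho> v)) t)))"
    and left_comodule_counit: "\<And>t. t \<in> carr (H \<otimes> V) \<Longrightarrow>
      id_fun V H \<epsilon> (S t) = fun_id H V \<epsilon> t"
proof -
  have H: "is_vspace H" and V: "is_vspace V"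
    and \<Psi>: "linear_bij (H \<otimes> H) (H \<otimes> H) \<Psi>" and \<Theta>: "linear_bij (V \<otimes> H) (H \<otimes> V) \<Theta>"
    and \<Delta>: "linear_map H (H \<otimes> H) \<Delta>" and \<rho>: "linear_map V (H \<otimes> V) \<rho>"
    and braid: "\<And>t. t \<in> carr (V \<otimes> H \<otimes> H) \<Longrightarrow>
        on23 H V H \<Theta> (on12 V H H \<Theta> (on23 V H H \<Psi> t)) =
        on12 H H V \<Psi> (on23 H V H \<Theta> (on12 V H H \<Theta> t))"
    and comult: "\<And>t. t \<in> carr (V \<otimes> H) \<Longrightarrow>
        map_id H (H \<otimes> H) V \<Delta> (\<Theta> t) =
          on23 H V H \<Theta> (on12 V H H \<Theta> (unassoc V H H (id_map V H (H \<otimes> H) \<Delta> t)))"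
    and counit: "\<And>t. t \<in> carr (V \<otimes> H) \<Longrightarrow> fun_id H V \<epsilon> (\<Theta> t) = id_fun V H \<epsilon> t"
    and coassoc: "\<And>v. v \<in> carr V \<Longrightarrow>
        unassoc H H V (id_map H V (H \<otimes> V) \<rho> (\<rho> v)) = map_id H (H \<otimes> H) V \<Delta> (\<rho> v)"
    and coact: "\<And>t. t \<in> carr (V \<otimes> H) \<Longrightarrow>
        unassoc H H V (id_map H V (H \<otimes> V) \<rho> (\<Theta> t)) =
        on12 H H V \<Psi> (on23 H V H \<Theta> (map_id V (H \<otimes> V) H \<rho> t))"
    using com unfolding braided_left_comodule_def right_braided_def braiding_def
      compat_comult_right_def braided_coalgebra_def coalgebra_def by blast+
  have \<Psi>l: "linear_map (H \<otimes> H) (H \<otimes> H) \<Psi>" and \<Theta>l: "linear_map (V \<otimes> H) (H \<otimes> V) \<Theta>"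
    using \<Psi> \<Theta> by (simp_all add: linear_bij_def)
  note R = linear_map_inv_on[OF \<Psi>, folded R_def] and S = linear_map_inv_on[OF \<Theta>, folded S_def]
  note \<Psi>R = inv_on_right[OF \<Psi>, folded R_def] and R\<Psi> = inv_on_left[OF \<Psi>, folded R_def]
  note \<Theta>S = inv_on_right[OF \<Theta>, folded S_def] and S\<Theta> = inv_on_left[OF \<Theta>, folded S_def]
  note ins = linear_map_in[OF linear_map_on12[OF R]] linear_map_in[OF linear_map_on23[OF V H R]]
    linear_map_in[OF linear_map_on12[OF S]] linear_map_in[OF linear_map_on23[OF H V S]]
    linear_map_in[OF linear_map_on12[OF \<Theta>l]] linear_map_in[OF linear_map_on23[OF H H \<Theta>l]]
    linear_map_in[OF linear_map_map_id[OF \<Delta>]] linear_map_in[OF linear_map_map_id[OF \<rho>]]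
    linear_map_in[OF linear_map_comp[OF linear_map_id_map[OF \<Delta>] linear_map_unassoc[OF V]]]
    linear_map_in[OF linear_map_comp[OF linear_map_id_map[OF \<rho>] linear_map_unassoc[OF H]]]
    linear_map_in[OF S] linear_map_in[OF \<rho>]
  note invs = on23_inverse[OF V H H R \<Psi>l, OF \<Psi>R] on12_inverse[OF S \<Theta>l, OF \<Theta>S] on12_inverse[OF \<Theta>l S, OF S\<Theta>]
    on23_inverse[OF H H V S \<Theta>l, OF \<Theta>S] on23_inverse[OF H V H \<Theta>l S, OF S\<Theta>]
    on12_inverse[OF \<Psi>l R, OF R\<Psi>]
  note \<Delta>12 = on12_map_id[OF \<Delta> R] and \<Delta>23 = on23_id_map[OF V H \<Delta> R]
    and \<rho>12 = on12_map_id[OF \<rho> S] and \<rho>23 = on23_id_map[OF H V \<rho> S]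
  show b: "on23 V H H R (on12 H V H S (on23 H H V S t)) =
      on12 H V H S (on23 H H V S (on12 H H V R t))" if t: "t \<in> carr (H \<otimes> H \<otimes> V)" for t
  proof -
    \<comment> \<open>As before, the left-hand side of the braid relation undoes all three factors of \<open>?w\<close>.\<close>
    let ?w = "on23 V H H R (on12 H V H S (on23 H H V S t))"
    have w: "?w \<in> carr (V \<otimes> H \<otimes> H)" using t ins by metis
    have "on12 H H V \<Psi> (on23 H V H \<Theta> (on12 V H H \<Theta> ?w)) = t"
      using braid[OF w] t by (simp add: invs ins)
    then have "on23 H V H \<Theta> (on12 V H H \<Theta> ?w) = on12 H H V R t"
      using invs(6)[of "on23 H V H \<Theta> (on12 V H H \<Theta> ?w)" V] w by (simp add: ins)
    then have "on12 H V H S (on23 H H V S (on23 H V H \<Theta> (on12 V H H \<Theta> ?w))) =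
        on12 H V H S (on23 H H V S (on12 H H V R t))" by simp
    then show ?thesis using w by (simp add: invs ins)
  qed
  have D: "unassoc V H H (id_map V H (H \<otimes> H) \<Delta> (S t)) =
      on12 H V H S (on23 H H V S (map_id H (H \<otimes> H) V \<Delta> t))"
    if t: "t \<in> carr (H \<otimes> V)" for t
  proof -
    have St: "S t \<in> carr (V \<otimes> H)" using t ins by metis
    show ?thesis using comult[OF St] St by (simp add: \<Theta>S[OF t] invs ins)
  qed
  show D': "unassoc V H H (id_map V H (H \<otimes> H) (\<lambda>a. R (\<Delta> a)) (S t)) =
      on12 H V H S (on23 H H V S (map_id H (H \<otimes> H) V (\<lambda>a. R (\<Delta> a)) t))"
    if t: "t \<in> carr (H \<otimes> V)" for t
  proof -
    have St: "S t \<in> carr (V \<otimes> H)" using t ins by metis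
    show ?thesis
      unfolding \<Delta>23[OF St, symmetric] \<Delta>12[OF t, symmetric] D[OF t] using b t by (simp add: ins)
  qed
  have N: "map_id V (H \<otimes> V) H \<rho> (S t) =
      on23 H H V S (on12 H H V R (unassoc H H V (id_map H V (H \<otimes> V) \<rho> t)))"
    if t: "t \<in> carr (H \<otimes> V)" for t
  proof -
    have St: "S t \<in> carr (V \<otimes> H)" using t ins by metis
    show ?thesis using coact[OF St] St by (simp add: \<Theta>S[OF t] invs ins)
  qed
  have N': "map_id V (V \<otimes> H) H (\<lambda>v. S (\<rho> v)) (S t) =
      on12 H V H S (on23 H H V S (on12 H H V R (unassoc H H V (id_map H V (H \<otimes> V) \<rho> t))))"
    if t: "t \<in> carr (H \<otimes> V)" for t
  proof -
    have St: "S t \<in> carr (V \<otimes> H)" using t ins by metis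
    show ?thesis unfolding \<rho>12[OF St, symmetric] N[OF t] ..
  qed
  show "map_id V (V \<otimes> H) H (\<lambda>v. S (\<rho> v)) (S (\<rho> v)) =
      unassoc V H H (id_map V H (H \<otimes> H) (\<lambda>a. R (\<Delta> a)) (S (\<rho> v)))" if v: "v \<in> carr V" for v
  proof -
    have \<rho>v: "\<rho> v \<in> carr (H \<otimes> V)" using v ins by metis
    show ?thesis
      unfolding N'[OF \<rho>v] D'[OF \<rho>v] coassoc[OF v] \<Delta>12[OF \<rho>v] ..
  qed
  show "map_id V (V \<otimes> H) H (\<lambda>v. S (\<rho> v)) (S t) =
      on23 V H H R (on12 H V H S (unassoc H V H (id_map H V (V \<otimes> H) (\<lambda>v. S (\<rho> v)) t)))"
    if t: "t \<in> carr (H \<otimes> V)" for t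
    unfolding N'[OF t] \<rho>23[OF t, symmetric] using b t by (simp add: ins)
  show "id_fun V H \<epsilon> (S t) = fun_id H V \<epsilon> t" if t: "t \<in> carr (H \<otimes> V)" for t
    using counit[of "S t"] t by (simp add: ins \<Theta>S)
qed

section \<open>Pairing with a counit\<close>

lemma fun_id:
  assumes "is_vspace B" and "linear_map A ground \<epsilon>"
  shows linear_map_fun_id: "linear_map (A \<otimes> B) B (fun_id A B \<epsilon>)"
    and fun_id_tens: "\<And>a b. a \<in> carr A \<Longrightarrow> b \<in> carr B \<Longrightarrow>
      fun_id A B \<epsilon> (tens A B a b) = smul B (\<epsilon> a) b"
proof -
  interpret vector_space "smul B" using assms(1) by (simp add: is_vspace_def)
  have "bilinear_map A B B (\<lambda>a b. smul B (\<epsilon> a) b)"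
  proof (rule bilinear_mapI)
    show "linear_map B B (\<lambda>b. smul B (\<epsilon> a) b)" if "a \<in> carr A" for a
      using linear_map_smul[OF assms(1) linear_map_id] .
    show "linear_map A B (\<lambda>a. smul B (\<epsilon> a) b)" if "b \<in> carr B" for b
      using assms(2) is_vspace_scale[OF assms(1) that] that
      by (simp add: linear_map_def scale_left_distrib)
  qed
  from lift[OF assms(1) this]
  show "linear_map (A \<otimes> B) B (fun_id A B \<epsilon>)"
    and "\<And>a b. a \<in> carr A \<Longrightarrow> b \<in> carr B \<Longrightarrow> fun_id A B \<epsilon> (tens A B a b) = smul B (\<epsilon> a) b"
    unfolding fun_id_def by blast+
qed

lemma id_fun:
  assumes "is_vspace A" and "linear_map B ground \<epsilon>"
  shows linear_map_id_fun: "linear_map (A \<otimes> B) A (id_fun A B \<epsilon>)"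
    and id_fun_tens: "\<And>a b. a \<in> carr A \<Longrightarrow> b \<in> carr B \<Longrightarrow>
      id_fun A B \<epsilon> (tens A B a b) = smul A (\<epsilon> b) a"
proof -
  interpret vector_space "smul A" using assms(1) by (simp add: is_vspace_def)
  have "bilinear_map A B A (\<lambda>a b. smul A (\<epsilon> b) a)"
  proof (rule bilinear_mapI)
    show "linear_map A A (\<lambda>a. smul A (\<epsilon> b) a)" if "b \<in> carr B" for b
      using linear_map_smul[OF assms(1) linear_map_id] .
    show "linear_map B A (\<lambda>b. smul A (\<epsilon> b) a)" if "a \<in> carr A" for a
      using assms(2) is_vspace_scale[OF assms(1) that] that
      by (simp add: linear_map_def scale_left_distrib)
  qed
  from lift[OF assms(1) this]
  show "linear_map (A \<otimes> B) A (id_fun A B \<epsilon>)"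
    and "\<And>a b. a \<in> carr A \<Longrightarrow> b \<in> carr B \<Longrightarrow> id_fun A B \<epsilon> (tens A B a b) = smul A (\<epsilon> b) a"
    unfolding id_fun_def by blast+
qed

text \<open>Pairing with the counit in one slot amounts to applying the counit to that factor; this turns the
  counit laws of a comodule into the unit laws of the dual module.\<close>

lemma rfun_fun_id:
  assumes B: "is_vspace B" and \<epsilon>: "linear_map A ground \<epsilon>" and \<xi>: "linear_map B ground \<xi>"
    and T: "T \<in> carr (A \<otimes> B)"
  shows "rfun A B \<xi> \<epsilon> T = \<xi> (fun_id A B \<epsilon> T)"
  by (rule tensor_ext[OF linear_map_rfun[OF \<xi> \<epsilon>] linear_map_comp[OF linear_map_fun_id[OF B \<epsilon>] \<xi>] _ T])
    (simp add: rfun_tens[OF \<xi> \<epsilon>] fun_id_tens[OF B \<epsilon>] linear_map_scale[OF \<xi>] mult.commute)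

lemma rfun_id_fun:
  assumes A: "is_vspace A" and \<epsilon>: "linear_map B ground \<epsilon>" and \<eta>: "linear_map A ground \<eta>"
    and T: "T \<in> carr (A \<otimes> B)"
  shows "rfun A B \<epsilon> \<eta> T = \<eta> (id_fun A B \<epsilon> T)"
  by (rule tensor_ext[OF linear_map_rfun[OF \<epsilon> \<eta>] linear_map_comp[OF linear_map_id_fun[OF A \<epsilon>] \<eta>] _ T])
    (simp add: rfun_tens[OF \<epsilon> \<eta>] id_fun_tens[OF A \<epsilon>] linear_map_scale[OF \<eta>])


section \<open>Braided comodules dualise to braided modules\<close>

text \<open>Both sides of each law have explicit transposes, and those agree by the laws for the inverse
  braidings. The two unit laws are evaluated directly, the unit being the functional \<open>\<epsilon>\<close>.\<close>

lemma dual_right_module_identities: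
  fixes P :: "('k::field, 'u::ab_group_add, 'h::ab_group_add) pairing"
    and Q :: "('k, 'w::ab_group_add, 'v::ab_group_add) pairing"
  assumes P: "is_pairing P" and Q: "is_pairing Q"
    and com: "braided_right_comodule (rgt P) \<Delta> \<epsilon> \<Psi> (rgt Q) \<Theta> \<rho>"
    and \<Phi>: "adj (P \<odot> P) (P \<odot> P) \<Phi> (inv_on (rgt P) (rgt P) \<Psi>)"
    and \<Xi>: "adj (Q \<odot> P) (P \<odot> Q) \<Xi> (inv_on (rgt P) (rgt Q) \<Theta>)"
    and m: "adj (P \<odot> P) P m (\<lambda>a. inv_on (rgt P) (rgt P) \<Psi> (\<Delta> a))"
    and \<nu>: "adj (Q \<odot> P) Q \<nu> (\<lambda>v. inv_on (rgt P) (rgt Q) \<Theta> (\<rho> v))"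
    and u: "\<And>e. u = Some e \<Longrightarrow> e \<in> carr (lft P) \<and> pr P e = \<epsilon>"
  shows dual_right_braid: "\<And>t. t \<in> carr (lft Q \<otimes> lft P \<otimes> lft P) \<Longrightarrow>
      on23 (lft P) (lft Q) (lft P) \<Xi> (on12 (lft Q) (lft P) (lft P) \<Xi> (on23 (lft Q) (lft P) (lft P) \<Phi> t)) =
      on12 (lft P) (lft P) (lft Q) \<Phi> (on23 (lft P) (lft Q) (lft P) \<Xi> (on12 (lft Q) (lft P) (lft P) \<Xi> t))"
    and dual_right_mult: "compat_mult_right (lft Q) (lft P) m u \<Xi>"
    and dual_right_assoc: "\<And>t. t \<in> carr (lft Q \<otimes> lft P \<otimes> lft P) \<Longrightarrow>
      \<nu> (map_id (lft Q \<otimes> lft P) (lft Q) (lft P) \<nu> t) =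
      \<nu> (id_map (lft Q) (lft P \<otimes> lft P) (lft P) m (assoc (lft Q) (lft P) (lft P) t))"
    and dual_right_unit: "\<And>e w. u = Some e \<Longrightarrow> w \<in> carr (lft Q) \<Longrightarrow>
      \<nu> (tens (lft Q) (lft P) w e) = w"
    and dual_right_act: "\<And>t. t \<in> carr (lft Q \<otimes> lft P \<otimes> lft P) \<Longrightarrow>
      \<Xi> (map_id (lft Q \<otimes> lft P) (lft Q) (lft P) \<nu> t) =
      id_map (lft P) (lft Q \<otimes> lft P) (lft Q) \<nu> (assoc (lft P) (lft Q) (lft P)
        (on12 (lft Q) (lft P) (lft P) \<Xi> (on23 (lft Q) (lft P) (lft P) \<Phi> t)))"
proof -
  note id = braided_right_comodule_inverse[OF com]
  note PQ = is_pairing_ptensor[OF P Q] and QP = is_pairing_ptensor[OF Q P]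
  note \<Phi>23 = adj_on23[OF Q P P \<Phi>] and \<Phi>12 = adj_on12[OF P P Q \<Phi>]
    and \<Xi>12 = adj_on12[OF Q P P \<Xi>] and \<Xi>23 = adj_on23[OF P Q P \<Xi>]
    and m23 = adj_mult23[OF Q P P P m] and m12 = adj_mult12[OF P P Q P m]
    and \<nu>12 = adj_mult12[OF Q P P Q \<nu>] and \<nu>23 = adj_mult23[OF P Q P Q \<nu>]
  note lS = adj_linear_right[OF \<Xi>, simplified] and lN = adj_linear_right[OF \<nu>, simplified]
  note vV = is_vspace_rgt[OF Q]
  show "on23 (lft P) (lft Q) (lft P) \<Xi> (on12 (lft Q) (lft P) (lft P) \<Xi> (on23 (lft Q) (lft P) (lft P) \<Phi> t)) =
      on12 (lft P) (lft P) (lft Q) \<Phi> (on23 (lft P) (lft Q) (lft P) \<Xi> (on12 (lft Q) (lft P) (lft P) \<Xi> t))"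
    if "t \<in> carr (lft Q \<otimes> lft P \<otimes> lft P)" for t
    by (rule adj_unique[OF is_pairing_ptensor3[OF P P Q]
          adj_comp[OF adj_comp[OF \<Phi>23 \<Xi>12] \<Xi>23] adj_comp[OF adj_comp[OF \<Xi>12 \<Xi>23] \<Phi>12]])
      (use id(1) that in simp_all)
  show "\<nu> (map_id (lft Q \<otimes> lft P) (lft Q) (lft P) \<nu> t) =
      \<nu> (id_map (lft Q) (lft P \<otimes> lft P) (lft P) m (assoc (lft Q) (lft P) (lft P) t))"
    if "t \<in> carr (lft Q \<otimes> lft P \<otimes> lft P)" for t
    by (rule adj_unique[OF Q adj_comp[OF \<nu>12 \<nu>] adj_comp[OF m23 \<nu>]])
      (use id(3) that in simp_all)
  show "\<Xi> (map_id (lft Q \<otimes> lft P) (lft Q) (lft P) \<nu> t) =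
      id_map (lft P) (lft Q \<otimes> lft P) (lft Q) \<nu> (assoc (lft P) (lft Q) (lft P)
        (on12 (lft Q) (lft P) (lft P) \<Xi> (on23 (lft Q) (lft P) (lft P) \<Phi> t)))"
    if "t \<in> carr (lft Q \<otimes> lft P \<otimes> lft P)" for t
    by (rule adj_unique[OF PQ adj_comp[OF \<nu>12 \<Xi>] adj_comp[OF adj_comp[OF \<Phi>23 \<Xi>12] \<nu>23]])
      (use id(4) that in simp_all)
  have \<epsilon>: "linear_map (rgt P) ground \<epsilon>" if "u = Some e" for e
    using u[OF that] linear_map_pr[OF P] by metis
  show "\<nu> (tens (lft Q) (lft P) w e) = w" if e: "u = Some e" and w: "w \<in> carr (lft Q)" for e w
  proof (rule pairing_eqI[OF Q _ w])
    have we: "tens (lft Q) (lft P) w e \<in> carr (lft Q \<otimes> lft P)" using u[OF e] w by (simp add: tens_in)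
    then show "\<nu> (tens (lft Q) (lft P) w e) \<in> carr (lft Q)"
      using linear_map_in[OF adj_linear_left[OF \<nu>]] by simp
    fix v assume v: "v \<in> carr (rgt Q)"
    let ?N = "inv_on (rgt P) (rgt Q) \<Theta> (\<rho> v)"
    have \<rho>v: "\<rho> v \<in> carr (rgt Q \<otimes> rgt P)" and co: "id_fun (rgt Q) (rgt P) \<epsilon> (\<rho> v) = v"
      using com v unfolding braided_right_comodule_def linear_map_def by blast+
    have "pr Q (\<nu> (tens (lft Q) (lft P) w e)) v = pr (Q \<odot> P) (tens (lft Q) (lft P) w e) ?N"
      using adj_pr[OF \<nu>] we v by simp
    also have "\<dots> = rfun (rgt P) (rgt Q) (pr Q w) \<epsilon> ?N"
      using pr_tens_left[OF Q P w _ linear_map_in[OF lN v]] u[OF e] by simp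
    also have "\<dots> = pr Q w (fun_id (rgt P) (rgt Q) \<epsilon> ?N)"
      by (rule rfun_fun_id[OF vV \<epsilon>[OF e] linear_map_pr[OF Q w] linear_map_in[OF lN v]])
    also have "\<dots> = pr Q w v" by (simp add: id(5)[OF \<rho>v] co)
    finally show "pr Q (\<nu> (tens (lft Q) (lft P) w e)) v = pr Q w v" .
  qed
  have "\<Xi> (tens (lft Q) (lft P) w e) = tens (lft P) (lft Q) e w"
    if e: "u = Some e" and w: "w \<in> carr (lft Q)" for e w
  proof (rule pairing_eqI[OF PQ])
    have we: "tens (lft Q) (lft P) w e \<in> carr (lft Q \<otimes> lft P)" using u[OF e] w by (simp add: tens_in)
    then show "\<Xi> (tens (lft Q) (lft P) w e) \<in> carr (lft (P \<odot> Q))"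
      using linear_map_in[OF adj_linear_left[OF \<Xi>]] by simp
    show "tens (lft P) (lft Q) e w \<in> carr (lft (P \<odot> Q))" using u[OF e] w by (simp add: tens_in)
    fix T assume "T \<in> carr (rgt (P \<odot> Q))"
    then have T: "T \<in> carr (rgt Q \<otimes> rgt P)" by simp
    let ?S = "inv_on (rgt P) (rgt Q) \<Theta> T"
    have "pr (P \<odot> Q) (\<Xi> (tens (lft Q) (lft P) w e)) T = pr (Q \<odot> P) (tens (lft Q) (lft P) w e) ?S"
      using adj_pr[OF \<Xi>] we T by simp
    also have "\<dots> = rfun (rgt P) (rgt Q) (pr Q w) \<epsilon> ?S"
      using pr_tens_left[OF Q P w _ linear_map_in[OF lS T]] u[OF e] by simp
    also have "\<dots> = pr Q w (fun_id (rgt P) (rgt Q) \<epsilon> ?S)"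
      by (rule rfun_fun_id[OF vV \<epsilon>[OF e] linear_map_pr[OF Q w] linear_map_in[OF lS T]])
    also have "\<dots> = rfun (rgt Q) (rgt P) \<epsilon> (pr Q w) T"
      by (simp add: id(5)[OF T] rfun_id_fun[OF vV \<epsilon>[OF e] linear_map_pr[OF Q w] T])
    also have "\<dots> = pr (P \<odot> Q) (tens (lft P) (lft Q) e w) T"
      using pr_tens_left[OF P Q _ w T] u[OF e] by simp
    finally show "pr (P \<odot> Q) (\<Xi> (tens (lft Q) (lft P) w e)) T =
        pr (P \<odot> Q) (tens (lft P) (lft Q) e w) T" .
  qed
  moreover have "\<Xi> (id_map (lft Q) (lft P \<otimes> lft P) (lft P) m (assoc (lft Q) (lft P) (lft P) t)) =
      map_id (lft P \<otimes> lft P) (lft P) (lft Q) m (on23 (lft P) (lft Q) (lft P) \<Xi>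
        (on12 (lft Q) (lft P) (lft P) \<Xi> t))"
    if "t \<in> carr (lft Q \<otimes> lft P \<otimes> lft P)" for t
    by (rule adj_unique[OF PQ adj_comp[OF m23 \<Xi>] adj_comp[OF adj_comp[OF \<Xi>12 \<Xi>23] m12]])
      (use id(2) that in simp_all)
  ultimately show "compat_mult_right (lft Q) (lft P) m u \<Xi>"
    unfolding compat_mult_right_def by blast
qed

text \<open>The mirror image of \<open>dual_right_module_identities\<close>.\<close>

lemma dual_left_module_identities:
  fixes P :: "('k::field, 'u::ab_group_add, 'h::ab_group_add) pairing"
    and Q :: "('k, 'w::ab_group_add, 'v::ab_group_add) pairing"
  assumes P: "is_pairing P" and Q: "is_pairing Q"
    and com: "braided_left_comodule (rgt P) \<Delta> \<epsilon> \<Psi> (rgt Q) \<Theta> \<rho>"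
    and \<Phi>: "adj (P \<odot> P) (P \<odot> P) \<Phi> (inv_on (rgt P) (rgt P) \<Psi>)"
    and \<Xi>: "adj (P \<odot> Q) (Q \<odot> P) \<Xi> (inv_on (rgt Q) (rgt P) \<Theta>)"
    and m: "adj (P \<odot> P) P m (\<lambda>a. inv_on (rgt P) (rgt P) \<Psi> (\<Delta> a))"
    and \<nu>: "adj (P \<odot> Q) Q \<nu> (\<lambda>v. inv_on (rgt Q) (rgt P) \<Theta> (\<rho> v))"
    and u: "\<And>e. u = Some e \<Longrightarrow> e \<in> carr (lft P) \<and> pr P e = \<epsilon>"
  shows dual_left_braid: "\<And>t. t \<in> carr (lft P \<otimes> lft P \<otimes> lft Q) \<Longrightarrow>
      on12 (lft P) (lft Q) (lft P) \<Xi> (on23 (lft P) (lft P) (lft Q) \<Xi> (on12 (lft P) (lft P) (lft Q) \<Phi> t)) =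
      on23 (lft Q) (lft P) (lft P) \<Phi> (on12 (lft P) (lft Q) (lft P) \<Xi> (on23 (lft P) (lft P) (lft Q) \<Xi> t))"
    and dual_left_mult: "compat_mult_left (lft P) m u (lft Q) \<Xi>"
    and dual_left_assoc: "\<And>t. t \<in> carr (lft P \<otimes> lft P \<otimes> lft Q) \<Longrightarrow>
      \<nu> (id_map (lft P) (lft P \<otimes> lft Q) (lft Q) \<nu> (assoc (lft P) (lft P) (lft Q) t)) =
      \<nu> (map_id (lft P \<otimes> lft P) (lft P) (lft Q) m t)"
    and dual_left_unit: "\<And>e w. u = Some e \<Longrightarrow> w \<in> carr (lft Q) \<Longrightarrow>
      \<nu> (tens (lft P) (lft Q) e w) = w"
    and dual_left_act: "\<And>t. t \<in> carr (lft P \<otimes> lft P \<otimes> lft Q) \<Longrightarrow>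
      \<Xi> (id_map (lft P) (lft P \<otimes> lft Q) (lft Q) \<nu> (assoc (lft P) (lft P) (lft Q) t)) =
      map_id (lft P \<otimes> lft Q) (lft Q) (lft P) \<nu>
        (on23 (lft P) (lft P) (lft Q) \<Xi> (on12 (lft P) (lft P) (lft Q) \<Phi> t))"
proof -
  note id = braided_left_comodule_inverse[OF com]
  note PQ = is_pairing_ptensor[OF P Q] and QP = is_pairing_ptensor[OF Q P]
  note \<Phi>23 = adj_on23[OF Q P P \<Phi>] and \<Phi>12 = adj_on12[OF P P Q \<Phi>]
    and \<Xi>12 = adj_on12[OF P Q P \<Xi>] and \<Xi>23 = adj_on23[OF P P Q \<Xi>]
    and m23 = adj_mult23[OF Q P P P m] and m12 = adj_mult12[OF P P Q P m]
    and \<nu>12 = adj_mult12[OF P Q P Q \<nu>] and \<nu>23 = adj_mult23[OF P P Q Q \<nu>]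
  note lS = adj_linear_right[OF \<Xi>, simplified] and lN = adj_linear_right[OF \<nu>, simplified]
  note vV = is_vspace_rgt[OF Q]
  show "on12 (lft P) (lft Q) (lft P) \<Xi> (on23 (lft P) (lft P) (lft Q) \<Xi> (on12 (lft P) (lft P) (lft Q) \<Phi> t)) =
      on23 (lft Q) (lft P) (lft P) \<Phi> (on12 (lft P) (lft Q) (lft P) \<Xi> (on23 (lft P) (lft P) (lft Q) \<Xi> t))"
    if "t \<in> carr (lft P \<otimes> lft P \<otimes> lft Q)" for t
    by (rule adj_unique[OF is_pairing_ptensor3[OF Q P P]
          adj_comp[OF adj_comp[OF \<Phi>12 \<Xi>23] \<Xi>12] adj_comp[OF adj_comp[OF \<Xi>23 \<Xi>12] \<Phi>23]])
      (use id(1) that in simp_all)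
  show "\<nu> (id_map (lft P) (lft P \<otimes> lft Q) (lft Q) \<nu> (assoc (lft P) (lft P) (lft Q) t)) =
      \<nu> (map_id (lft P \<otimes> lft P) (lft P) (lft Q) m t)"
    if "t \<in> carr (lft P \<otimes> lft P \<otimes> lft Q)" for t
    by (rule adj_unique[OF Q adj_comp[OF \<nu>23 \<nu>] adj_comp[OF m12 \<nu>]])
      (use id(3) that in simp_all)
  show "\<Xi> (id_map (lft P) (lft P \<otimes> lft Q) (lft Q) \<nu> (assoc (lft P) (lft P) (lft Q) t)) =
      map_id (lft P \<otimes> lft Q) (lft Q) (lft P) \<nu>
        (on23 (lft P) (lft P) (lft Q) \<Xi> (on12 (lft P) (lft P) (lft Q) \<Phi> t))"
    if "t \<in> carr (lft P \<otimes> lft P \<otimes> lft Q)" for t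
    by (rule adj_unique[OF QP adj_comp[OF \<nu>23 \<Xi>] adj_comp[OF adj_comp[OF \<Phi>12 \<Xi>23] \<nu>12]])
      (use id(4) that in simp_all)
  have \<epsilon>: "linear_map (rgt P) ground \<epsilon>" if "u = Some e" for e
    using u[OF that] linear_map_pr[OF P] by metis
  show "\<nu> (tens (lft P) (lft Q) e w) = w" if e: "u = Some e" and w: "w \<in> carr (lft Q)" for e w
  proof (rule pairing_eqI[OF Q _ w])
    have we: "tens (lft P) (lft Q) e w \<in> carr (lft P \<otimes> lft Q)" using u[OF e] w by (simp add: tens_in)
    then show "\<nu> (tens (lft P) (lft Q) e w) \<in> carr (lft Q)"
      using linear_map_in[OF adj_linear_left[OF \<nu>]] by simp
    fix v assume v: "v \<in> carr (rgt Q)"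
    let ?N = "inv_on (rgt Q) (rgt P) \<Theta> (\<rho> v)"
    have \<rho>v: "\<rho> v \<in> carr (rgt P \<otimes> rgt Q)" and co: "fun_id (rgt P) (rgt Q) \<epsilon> (\<rho> v) = v"
      using com v unfolding braided_left_comodule_def linear_map_def by blast+
    have "pr Q (\<nu> (tens (lft P) (lft Q) e w)) v = pr (P \<odot> Q) (tens (lft P) (lft Q) e w) ?N"
      using adj_pr[OF \<nu>] we v by simp
    also have "\<dots> = rfun (rgt Q) (rgt P) \<epsilon> (pr Q w) ?N"
      using pr_tens_left[OF P Q _ w linear_map_in[OF lN v]] u[OF e] by simp
    also have "\<dots> = pr Q w (id_fun (rgt Q) (rgt P) \<epsilon> ?N)"
      by (rule rfun_id_fun[OF vV \<epsilon>[OF e] linear_map_pr[OF Q w] linear_map_in[OF lN v]])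
    also have "\<dots> = pr Q w v" by (simp add: id(5)[OF \<rho>v] co)
    finally show "pr Q (\<nu> (tens (lft P) (lft Q) e w)) v = pr Q w v" .
  qed
  have "\<Xi> (tens (lft P) (lft Q) e w) = tens (lft Q) (lft P) w e"
    if e: "u = Some e" and w: "w \<in> carr (lft Q)" for e w
  proof (rule pairing_eqI[OF QP])
    have we: "tens (lft P) (lft Q) e w \<in> carr (lft P \<otimes> lft Q)" using u[OF e] w by (simp add: tens_in)
    then show "\<Xi> (tens (lft P) (lft Q) e w) \<in> carr (lft (Q \<odot> P))"
      using linear_map_in[OF adj_linear_left[OF \<Xi>]] by simp
    show "tens (lft Q) (lft P) w e \<in> carr (lft (Q \<odot> P))" using u[OF e] w by (simp add: tens_in)
    fix T assume "T \<in> carr (rgt (Q \<odot> P))"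
    then have T: "T \<in> carr (rgt P \<otimes> rgt Q)" by simp
    let ?S = "inv_on (rgt Q) (rgt P) \<Theta> T"
    have "pr (Q \<odot> P) (\<Xi> (tens (lft P) (lft Q) e w)) T = pr (P \<odot> Q) (tens (lft P) (lft Q) e w) ?S"
      using adj_pr[OF \<Xi>] we T by simp
    also have "\<dots> = rfun (rgt Q) (rgt P) \<epsilon> (pr Q w) ?S"
      using pr_tens_left[OF P Q _ w linear_map_in[OF lS T]] u[OF e] by simp
    also have "\<dots> = pr Q w (id_fun (rgt Q) (rgt P) \<epsilon> ?S)"
      by (rule rfun_id_fun[OF vV \<epsilon>[OF e] linear_map_pr[OF Q w] linear_map_in[OF lS T]])
    also have "\<dots> = rfun (rgt P) (rgt Q) (pr Q w) \<epsilon> T"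
      by (simp add: id(5)[OF T] rfun_fun_id[OF vV \<epsilon>[OF e] linear_map_pr[OF Q w] T])
    also have "\<dots> = pr (Q \<odot> P) (tens (lft Q) (lft P) w e) T"
      using pr_tens_left[OF Q P w _ T] u[OF e] by simp
    finally show "pr (Q \<odot> P) (\<Xi> (tens (lft P) (lft Q) e w)) T =
        pr (Q \<odot> P) (tens (lft Q) (lft P) w e) T" .
  qed
  moreover have "\<Xi> (map_id (lft P \<otimes> lft P) (lft P) (lft Q) m t) =
      id_map (lft Q) (lft P \<otimes> lft P) (lft P) m (assoc (lft Q) (lft P) (lft P)
        (on12 (lft P) (lft Q) (lft P) \<Xi> (on23 (lft P) (lft P) (lft Q) \<Xi> t)))"
    if "t \<in> carr (lft P \<otimes> lft P \<otimes> lft Q)" for t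
    by (rule adj_unique[OF QP adj_comp[OF m12 \<Xi>] adj_comp[OF adj_comp[OF \<Xi>23 \<Xi>12] m23]])
      (use id(2) that in simp_all)
  ultimately show "compat_mult_left (lft P) m u (lft Q) \<Xi>"
    unfolding compat_mult_left_def by blast
qed

text \<open>For \<open>V = H\<close> and \<open>\<rho> = \<Delta>\<close>, one of the two compatibilities of \<open>\<Psi>\<close> with \<open>\<Delta>\<close> says that \<open>\<Psi>\<close> is compatible
  with \<open>\<Delta>\<close> as a comultiplication, and the other that it is compatible with \<open>\<Delta>\<close> as a coaction.\<close>

lemma braided_coalgebra_right_comodule:
  assumes "braided_coalgebra H \<Delta> \<epsilon> \<Psi>"
  shows "braided_right_comodule H \<Delta> \<epsilon> \<Psi> H \<Psi> \<Delta>"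
  using assms unfolding braided_right_comodule_def left_braided_def braided_coalgebra_def
    coalgebra_def braiding_def compat_comult_left_def compat_comult_right_def by blast

lemma braided_coalgebra_left_comodule:
  assumes "braided_coalgebra H \<Delta> \<epsilon> \<Psi>"
  shows "braided_left_comodule H \<Delta> \<epsilon> \<Psi> H \<Psi> \<Delta>"
  using assms unfolding braided_left_comodule_def right_braided_def braided_coalgebra_def
    coalgebra_def braiding_def compat_comult_left_def compat_comult_right_def by (simp (no_asm_simp))

text \<open>The regular right comodule yields the right unit law and the compatibility of \<open>\<Phi>\<close> with the product
  in its right argument; the regular left comodule yields the left-handed counterparts. Associativity
  and the braid relation come from either.\<close>

lemma dual_braided_algebra:
  assumes P: "is_pairing P"
    and H: "braided_coalgebra (rgt P) \<Delta> \<epsilon> \<Psi>"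
    and \<Phi>: "adj (P \<odot> P) (P \<odot> P) \<Phi> (inv_on (rgt P) (rgt P) \<Psi>)"
    and bij: "bij_betw \<Phi> (carr (lft P \<otimes> lft P)) (carr (lft P \<otimes> lft P))"
    and m: "adj (P \<odot> P) P m (\<lambda>a. inv_on (rgt P) (rgt P) \<Psi> (\<Delta> a))"
    and u: "\<And>e. u = Some e \<Longrightarrow> e \<in> carr (lft P) \<and> pr P e = \<epsilon>"
  shows "braided_algebra (lft P) m u \<Phi>"
proof -
  note r = dual_right_module_identities[OF P P braided_coalgebra_right_comodule[OF H] \<Phi> \<Phi> m m u]
    and l = dual_left_module_identities[OF P P braided_coalgebra_left_comodule[OF H] \<Phi> \<Phi> m m u]
  have "linear_bij (lft P \<otimes> lft P) (lft P \<otimes> lft P) \<Phi>"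
    using adj_linear_left[OF \<Phi>] bij by (simp add: linear_bij_def)
  then have b: "braiding (lft P) \<Phi>"
    unfolding braiding_def using r(1) is_vspace_lft[OF P] by simp
  have "algebra (lft P) m u"
    unfolding algebra_def using is_vspace_lft[OF P] adj_linear_left[OF m] r(3,4) l(4) u by simp
  then show ?thesis using b r(2) l(2) by (simp add: braided_algebra_def)
qed

lemma dual_braided_right_module:
  assumes P: "is_pairing P" and Q: "is_pairing Q"
    and com: "braided_right_comodule (rgt P) \<Delta> \<epsilon> \<Psi> (rgt Q) \<Theta> \<rho>"
    and \<Phi>: "adj (P \<odot> P) (P \<odot> P) \<Phi> (inv_on (rgt P) (rgt P) \<Psi>)"
    and b\<Phi>: "bij_betw \<Phi> (carr (lft P \<otimes> lft P)) (carr (lft P \<otimes> lft P))"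
    and \<Xi>: "adj (Q \<odot> P) (P \<odot> Q) \<Xi> (inv_on (rgt P) (rgt Q) \<Theta>)"
    and b\<Xi>: "bij_betw \<Xi> (carr (lft Q \<otimes> lft P)) (carr (lft P \<otimes> lft Q))"
    and m: "adj (P \<odot> P) P m (\<lambda>a. inv_on (rgt P) (rgt P) \<Psi> (\<Delta> a))"
    and \<nu>: "adj (Q \<odot> P) Q \<nu> (\<lambda>v. inv_on (rgt P) (rgt Q) \<Theta> (\<rho> v))"
    and u: "\<And>e. u = Some e \<Longrightarrow> e \<in> carr (lft P) \<and> pr P e = \<epsilon>"
  shows "braided_right_module (lft P) m u \<Phi> (lft Q) \<Xi> \<nu>"
proof -
  note r = dual_right_module_identities[OF P Q com \<Phi> \<Xi> m \<nu> u]
  have H: "braided_coalgebra (rgt P) \<Delta> \<epsilon> \<Psi>"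
    using com by (simp add: braided_right_comodule_def)
  have alg: "braided_algebra (lft P) m u \<Phi>" by (rule dual_braided_algebra[OF P H \<Phi> b\<Phi> m u])
  have "linear_bij (lft Q \<otimes> lft P) (lft P \<otimes> lft Q) \<Xi>"
    using adj_linear_left[OF \<Xi>] b\<Xi> by (simp add: linear_bij_def)
  then have "right_braided (lft P) \<Phi> (lft Q) \<Xi>"
    unfolding right_braided_def using r(1) is_vspace_lft[OF Q] alg by (simp add: braided_algebra_def)
  then show ?thesis
    unfolding braided_right_module_def using alg r(2-5) adj_linear_left[OF \<nu>] by simp
qed

lemma dual_braided_left_module:
  assumes P: "is_pairing P" and Q: "is_pairing Q"
    and com: "braided_left_comodule (rgt P) \<Delta> \<epsilon> \<Psi> (rgt Q) \<Theta> \<rho>"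
    and \<Phi>: "adj (P \<odot> P) (P \<odot> P) \<Phi> (inv_on (rgt P) (rgt P) \<Psi>)"
    and b\<Phi>: "bij_betw \<Phi> (carr (lft P \<otimes> lft P)) (carr (lft P \<otimes> lft P))"
    and \<Xi>: "adj (P \<odot> Q) (Q \<odot> P) \<Xi> (inv_on (rgt Q) (rgt P) \<Theta>)"
    and b\<Xi>: "bij_betw \<Xi> (carr (lft P \<otimes> lft Q)) (carr (lft Q \<otimes> lft P))"
    and m: "adj (P \<odot> P) P m (\<lambda>a. inv_on (rgt P) (rgt P) \<Psi> (\<Delta> a))"
    and \<nu>: "adj (P \<odot> Q) Q \<nu> (\<lambda>v. inv_on (rgt Q) (rgt P) \<Theta> (\<rho> v))"
    and u: "\<And>e. u = Some e \<Longrightarrow> e \<in> carr (lft P) \<and> pr P e = \<epsilon>"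
  shows "braided_left_module (lft P) m u \<Phi> (lft Q) \<Xi> \<nu>"
proof -
  note l = dual_left_module_identities[OF P Q com \<Phi> \<Xi> m \<nu> u]
  have H: "braided_coalgebra (rgt P) \<Delta> \<epsilon> \<Psi>"
    using com by (simp add: braided_left_comodule_def)
  have alg: "braided_algebra (lft P) m u \<Phi>" by (rule dual_braided_algebra[OF P H \<Phi> b\<Phi> m u])
  have "linear_bij (lft P \<otimes> lft Q) (lft Q \<otimes> lft P) \<Xi>"
    using adj_linear_left[OF \<Xi>] b\<Xi> by (simp add: linear_bij_def)
  then have "left_braided (lft P) \<Phi> (lft Q) \<Xi>"
    unfolding left_braided_def using l(1) is_vspace_lft[OF Q] alg by (simp add: braided_algebra_def)
  then show ?thesis
    unfolding braided_left_module_def using alg l(2-5) adj_linear_left[OF \<nu>] by simp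
qed

section \<open>Pairings of function spaces and dual-valued maps\<close>

definition funpair :: "('k::field, 'a \<Rightarrow> 'k) vspace \<Rightarrow> ('k, 'a::ab_group_add) vspace \<Rightarrow>
    ('k, 'a \<Rightarrow> 'k, 'a) pairing" where
  "funpair U A = \<lparr>lft = U, rgt = A, pr = (\<lambda>f. f)\<rparr>"

lemma funpair_simps [simp]:
  "lft (funpair U A) = U" "rgt (funpair U A) = A" "pr (funpair U A) = (\<lambda>f. f)"
  by (simp_all add: funpair_def)

lemma is_pairing_funpair:
  assumes U: "subspace_of U (dual A)" and A: "is_vspace A"
  shows "is_pairing (funpair U A)"
  unfolding is_pairing_def funpair_simps
proof (intro conjI ballI impI A bilinear_mapI)
  show "is_vspace U" using U by (simp add: subspace_of_def)
  have smul: "smul U = fscale" and in': "f \<in> carr (dual A)" if "f \<in> carr U" for f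
    using U that by (auto simp: subspace_of_def)
  show "linear_map A ground f" if "f \<in> carr U" for f
    using in'[OF that] by (simp add: in_dual_iff)
  show "linear_map U ground (\<lambda>f. f a)" for a
    by (rule linear_mapI) (simp_all add: smul fscale_def)
  fix f assume "f \<in> carr U" and "\<forall>a\<in>carr A. f a = 0"
  then show "f = 0" using in' by (auto simp: in_dual_iff fun_eq_iff)
qed

lemma subspace_of_dual_self: "subspace_of (dual A) (dual A)"
  by (simp add: subspace_of_def is_vspace_dual)

lemma bilinear_map_ev: "bilinear_map A (dual A) ground ev"
  unfolding ev_def
  by (intro bilinear_mapI linear_mapI) (auto simp: dual_def linear_map_def fscale_def)

lemma linear_map_eval:
  assumes "linear_map X (dual A) F"
  shows "linear_map X ground (\<lambda>x. F x a)"
  using assms by (auto simp: linear_map_def fscale_def)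

text \<open>Functionals are zero off the carrier, hence equal as soon as they agree on it; so bilinearity may
  be tested by evaluation.\<close>

lemma bilinear_map_dualI:
  fixes A :: "('k::field, 'a::ab_group_add) vspace"
  assumes "\<And>x y. x \<in> carr X \<Longrightarrow> y \<in> carr Y \<Longrightarrow> \<gamma> x y \<in> carr (dual A)"
    and bil: "\<And>a. a \<in> carr A \<Longrightarrow> bilinear_map X Y ground (\<lambda>x y. \<gamma> x y a)"
    and X: "is_vspace X" and Y: "is_vspace Y"
  shows "bilinear_map X Y (dual A) \<gamma>"
proof -
  have off: "\<gamma> x y a = 0" if "x \<in> carr X" "y \<in> carr Y" "a \<notin> carr A" for x y a
    using assms(1)[OF that(1,2)] that(3) by (simp add: in_dual_iff)
  have bil': "bilinear_map X Y ground (\<lambda>x y. \<gamma> x y a)" for a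
  proof (cases "a \<in> carr A")
    case False
    have "bilinear_map X Y (ground :: ('k, 'k) vspace) (\<lambda>x y. 0)"
      by (simp add: bilinear_map_def linear_map_def)
    then show ?thesis by (rule bilinear_map_cong[OF X Y]) (simp add: off False)
  qed (rule bil)
  show ?thesis
    using bilinear_map_right[OF bil'] bilinear_map_left[OF bil'] assms(1)
    by (intro bilinear_mapI linear_mapI) (simp_all add: linear_map_def fun_eq_iff fscale_def)
qed

text \<open>The embeddings \<^const>\<open>emb\<close> and the dual braidings are all of this form. Here \<open>\<beta>\<close> is the defining
  formula and \<open>\<gamma>\<close> an expression with the same values that is visibly multilinear; they differ for the
  maps whose definition passes through \<^const>\<open>pull\<close>.\<close>

lemma lift_lift:
  fixes A :: "('k::field, 'a::ab_group_add) vspace" and B :: "('k, 'b::ab_group_add) vspace"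
  assumes X: "is_vspace X" and Y: "is_vspace Y" and A: "is_vspace A" and B: "is_vspace B"
    and eq: "\<And>x y a b. x \<in> carr X \<Longrightarrow> y \<in> carr Y \<Longrightarrow> a \<in> carr A \<Longrightarrow> b \<in> carr B \<Longrightarrow>
      \<beta> x y a b = \<gamma> x y a b"
    and ab: "\<And>x y. x \<in> carr X \<Longrightarrow> y \<in> carr Y \<Longrightarrow> bilinear_map A B ground (\<gamma> x y)"
    and xy: "\<And>a b. a \<in> carr A \<Longrightarrow> b \<in> carr B \<Longrightarrow> bilinear_map X Y ground (\<lambda>x y. \<gamma> x y a b)"
  defines "F \<equiv> lift X Y (dual (A \<otimes> B)) (\<lambda>x y. lift A B ground (\<beta> x y))"
  shows linear_map_lift_lift: "linear_map (X \<otimes> Y) (dual (A \<otimes> B)) F"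
    and lift_lift_tens: "\<And>x y a b. x \<in> carr X \<Longrightarrow> y \<in> carr Y \<Longrightarrow> a \<in> carr A \<Longrightarrow> b \<in> carr B \<Longrightarrow>
      F (tens X Y x y) (tens A B a b) = \<gamma> x y a b"
proof -
  have ab': "bilinear_map A B ground (\<beta> x y)" if "x \<in> carr X" "y \<in> carr Y" for x y
    by (rule bilinear_map_cong[OF A B ab[OF that]]) (simp add: eq that)
  have xy': "bilinear_map X Y ground (\<lambda>x y. \<beta> x y a b)" if "a \<in> carr A" "b \<in> carr B" for a b
    by (rule bilinear_map_cong[OF X Y xy[OF that]]) (simp add: eq that)
  have bil: "bilinear_map X Y (dual (A \<otimes> B)) (\<lambda>x y. lift A B ground (\<beta> x y))"
  proof (rule bilinear_map_dualI[OF _ _ X Y])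
    show "lift A B ground (\<beta> x y) \<in> carr (dual (A \<otimes> B))" if "x \<in> carr X" "y \<in> carr Y" for x y
      using lift[OF is_vspace_ground ab'[OF that]] by (simp add: in_dual_iff)
    show "bilinear_map X Y ground (\<lambda>x y. lift A B ground (\<beta> x y) T)" if "T \<in> carr (A \<otimes> B)" for T
    proof (rule bilinear_mapI)
      show "linear_map Y ground (\<lambda>y. lift A B ground (\<beta> x y) T)" if x: "x \<in> carr X" for x
        by (rule linear_map_lift_param[OF is_vspace_ground Y ab'[OF x]
              bilinear_map_right[OF xy' x] \<open>T \<in> carr (A \<otimes> B)\<close>])
      show "linear_map X ground (\<lambda>x. lift A B ground (\<beta> x y) T)" if y: "y \<in> carr Y" for y
        by (rule linear_map_lift_param[OF is_vspace_ground X ab'[OF _ y]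
              bilinear_map_left[OF xy' y] \<open>T \<in> carr (A \<otimes> B)\<close>])
    qed
  qed
  show "linear_map (X \<otimes> Y) (dual (A \<otimes> B)) F"
    unfolding F_def by (rule linear_map_lift[OF is_vspace_dual bil])
  show "F (tens X Y x y) (tens A B a b) = \<gamma> x y a b"
    if "x \<in> carr X" "y \<in> carr Y" "a \<in> carr A" "b \<in> carr B" for x y a b
    unfolding F_def lift_tens[OF is_vspace_dual bil that(1,2)]
    using lift_tens[OF is_vspace_ground ab'[OF that(1,2)] that(3,4)] eq[OF that] by simp
qed

lemma emb:
  fixes A :: "('k::field, 'a::ab_group_add) vspace" and B :: "('k, 'b::ab_group_add) vspace"
  assumes X: "is_vspace X" and Y: "is_vspace Y" and A: "is_vspace A" and B: "is_vspace B"
    and p: "bilinear_map X A ground p" and q: "bilinear_map Y B ground q"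
  shows linear_map_emb: "linear_map (X \<otimes> Y) (dual (A \<otimes> B)) (emb X Y A B p q)"
    and emb_tens: "\<And>x y a b. x \<in> carr X \<Longrightarrow> y \<in> carr Y \<Longrightarrow> a \<in> carr A \<Longrightarrow> b \<in> carr B \<Longrightarrow>
      emb X Y A B p q (tens X Y x y) (tens A B a b) = p x a * q y b"
proof -
  have ab: "bilinear_map A B ground (\<lambda>a b. p x a * q y b)" if "x \<in> carr X" "y \<in> carr Y" for x y
    using bilinear_map_mult[OF bilinear_map_right[OF p that(1)] bilinear_map_right[OF q that(2)]] .
  have xy: "bilinear_map X Y ground (\<lambda>x y. p x a * q y b)" if "a \<in> carr A" "b \<in> carr B" for a b
    using bilinear_map_mult[OF bilinear_map_left[OF p that(1)] bilinear_map_left[OF q that(2)]] .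
  show "linear_map (X \<otimes> Y) (dual (A \<otimes> B)) (emb X Y A B p q)"
    and "\<And>x y a b. x \<in> carr X \<Longrightarrow> y \<in> carr Y \<Longrightarrow> a \<in> carr A \<Longrightarrow> b \<in> carr B \<Longrightarrow>
      emb X Y A B p q (tens X Y x y) (tens A B a b) = p x a * q y b"
    unfolding emb_def tfun_def using lift_lift[OF X Y A B refl ab xy] by blast+
qed

lemma emb_eq_pr:
  assumes P: "is_pairing P" and Q: "is_pairing Q" and F: "F \<in> carr (lft P \<otimes> lft Q)"
    and a: "a \<in> carr (rgt P)" and b: "b \<in> carr (rgt Q)"
  shows "emb (lft P) (lft Q) (rgt P) (rgt Q) (pr P) (pr Q) F (tens (rgt P) (rgt Q) a b) =
    pr (P \<odot> Q) F (tens (rgt Q) (rgt P) b a)"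
proof -
  note e = emb[OF is_vspace_lft[OF P] is_vspace_lft[OF Q] is_vspace_rgt[OF P] is_vspace_rgt[OF Q]
      bilinear_map_pr[OF P] bilinear_map_pr[OF Q]]
  show ?thesis
    by (rule tensor_ext[OF linear_map_eval[OF e(1)]
          bilinear_map_left[OF bilinear_map_ptensor[OF P Q] tens_in[OF b a]] _ F])
      (simp add: e(2) a b pr_tens[OF P Q])
qed

text \<open>Up to the order of the factors, the embedding is the map \<open>F \<mapsto> \<langle>\<langle>F, _\<rangle>\<rangle>\<close>, so its injectivity is the
  separation property of the tensor product pairing.\<close>

lemma inj_on_emb:
  assumes P: "is_pairing P" and Q: "is_pairing Q"
  shows "inj_on (emb (lft P) (lft Q) (rgt P) (rgt Q) (pr P) (pr Q)) (carr (lft P \<otimes> lft Q))"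
proof (rule inj_onI)
  note PQ = is_pairing_ptensor[OF P Q]
  let ?E = "emb (lft P) (lft Q) (rgt P) (rgt Q) (pr P) (pr Q)"
  fix F G assume F: "F \<in> carr (lft P \<otimes> lft Q)" and G: "G \<in> carr (lft P \<otimes> lft Q)" and eq: "?E F = ?E G"
  show "F = G"
  proof (rule pairing_eqI[OF PQ], unfold lft_ptensor rgt_ptensor)
    fix T assume T: "T \<in> carr (rgt Q \<otimes> rgt P)"
    show "pr (P \<odot> Q) F T = pr (P \<odot> Q) G T"
      using eq emb_eq_pr[OF P Q F] emb_eq_pr[OF P Q G]
      by (intro tensor_ext[OF bilinear_map_right[OF bilinear_map_ptensor[OF P Q] F]
            bilinear_map_right[OF bilinear_map_ptensor[OF P Q] G] _ T]) metis
  qed (rule F G)+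
qed

lemma pull_bij_onto:
  assumes "bij_onto X Y E \<Psi>" and "F \<in> carr (X \<otimes> Y)"
  shows pull_in: "pull X Y E \<Psi> F \<in> carr (Y \<otimes> X)" and emb_pull: "E (pull X Y E \<Psi> F) = \<Psi> F"
proof -
  have "\<Psi> F \<in> E ` carr (Y \<otimes> X)" using assms by (auto simp: bij_onto_def bij_betw_def)
  then show "pull X Y E \<Psi> F \<in> carr (Y \<otimes> X)" and "E (pull X Y E \<Psi> F) = \<Psi> F"
    unfolding pull_def by (simp_all only: inv_into_into f_inv_into_f)
qed

lemma bij_betw_pull:
  assumes "bij_onto X Y E \<Psi>" and "inj_on E (carr (Y \<otimes> X))"
  shows "bij_betw (pull X Y E \<Psi>) (carr (X \<otimes> Y)) (carr (Y \<otimes> X))"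
proof -
  have "bij_betw (inv_into (carr (Y \<otimes> X)) E) (E ` carr (Y \<otimes> X)) (carr (Y \<otimes> X))"
    using assms(2) by (simp add: bij_betw_inv_into inj_on_imp_bij_betw)
  then have "bij_betw (inv_into (carr (Y \<otimes> X)) E \<circ> \<Psi>) (carr (X \<otimes> Y)) (carr (Y \<otimes> X))"
    using assms(1) bij_betw_trans unfolding bij_onto_def by blast
  moreover have "inv_into (carr (Y \<otimes> X)) E \<circ> \<Psi> = pull X Y E \<Psi>"
    by (simp add: fun_eq_iff pull_def)
  ultimately show ?thesis by simp
qed

text \<open>Recognising a dual braiding as a transpose takes only its values on pure tensors. The embedding
  keeps the order of the factors while the pairing reverses it, whence \<open>tens a v\<close> on one side and
  \<open>tens v a\<close> on the other.\<close>

lemma adj_pull: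
  assumes P: "is_pairing P" and Q: "is_pairing Q"
  defines "E \<equiv> emb (lft P) (lft Q) (rgt P) (rgt Q) (pr P) (pr Q)"
  assumes bij: "bij_onto (lft Q) (lft P) E \<Psi>"
    and \<Psi>: "linear_map (lft Q \<otimes> lft P) (dual (rgt P \<otimes> rgt Q)) \<Psi>"
    and g: "linear_map (rgt Q \<otimes> rgt P) (rgt P \<otimes> rgt Q) g"
    and tens: "\<And>w u a v. w \<in> carr (lft Q) \<Longrightarrow> u \<in> carr (lft P) \<Longrightarrow> a \<in> carr (rgt P) \<Longrightarrow>
      v \<in> carr (rgt Q) \<Longrightarrow> \<Psi> (tens (lft Q) (lft P) w u) (tens (rgt P) (rgt Q) a v) =
        rfun (rgt P) (rgt Q) (pr Q w) (pr P u) (g (tens (rgt Q) (rgt P) v a))"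
  shows "adj (Q \<odot> P) (P \<odot> Q) (pull (lft Q) (lft P) E \<Psi>) g"
    and "bij_betw (pull (lft Q) (lft P) E \<Psi>) (carr (lft Q \<otimes> lft P)) (carr (lft P \<otimes> lft Q))"
proof -
  note PQ = is_pairing_ptensor[OF P Q] and QP = is_pairing_ptensor[OF Q P]
  show "bij_betw (pull (lft Q) (lft P) E \<Psi>) (carr (lft Q \<otimes> lft P)) (carr (lft P \<otimes> lft Q))"
    by (rule bij_betw_pull[OF bij]) (unfold E_def, rule inj_on_emb[OF P Q])
  show "adj (Q \<odot> P) (P \<odot> Q) (pull (lft Q) (lft P) E \<Psi>) g"
  proof (rule adjI[OF QP PQ], unfold lft_ptensor rgt_ptensor)
    show "linear_map (rgt Q \<otimes> rgt P) (rgt P \<otimes> rgt Q) g" by (rule g)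
    fix F assume F: "F \<in> carr (lft Q \<otimes> lft P)"
    note pF = pull_in[OF bij F]
    show "pull (lft Q) (lft P) E \<Psi> F \<in> carr (lft P \<otimes> lft Q)" by (rule pF)
    fix T assume T: "T \<in> carr (rgt Q \<otimes> rgt P)"
    show "pr (P \<odot> Q) (pull (lft Q) (lft P) E \<Psi> F) T = pr (Q \<odot> P) F (g T)"
    proof (rule tensor_ext[OF bilinear_map_right[OF bilinear_map_ptensor[OF P Q] pF]
          linear_map_comp[OF g bilinear_map_right[OF bilinear_map_ptensor[OF Q P] F]] _ T])
      fix v a assume v: "v \<in> carr (rgt Q)" and a: "a \<in> carr (rgt P)"
      note gva = linear_map_in[OF g tens_in[OF v a]]
      have "pr (P \<odot> Q) (pull (lft Q) (lft P) E \<Psi> F) (tens (rgt Q) (rgt P) v a) =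
          \<Psi> F (tens (rgt P) (rgt Q) a v)"
        using emb_eq_pr[OF P Q pF a v] emb_pull[OF bij F] by (simp add: E_def)
      also have "\<dots> = pr (Q \<odot> P) F (g (tens (rgt Q) (rgt P) v a))"
        by (rule tensor_ext[OF linear_map_eval[OF \<Psi>]
              bilinear_map_left[OF bilinear_map_ptensor[OF Q P] gva] _ F])
          (simp add: tens a v pr_tens_left[OF Q P _ _ gva])
      finally show "pr (P \<odot> Q) (pull (lft Q) (lft P) E \<Psi> F) (tens (rgt Q) (rgt P) v a) =
          pr (Q \<odot> P) F (g (tens (rgt Q) (rgt P) v a))" .
    qed
  qed
qed

text \<open>The common pattern of \<^const>\<open>dual_mult\<close>, \<^const>\<open>nu_R\<close> and \<^const>\<open>nu_L\<close>.\<close>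

lemma adj_lift_dual:
  assumes P: "is_pairing P" and Q: "is_pairing Q"
    and W: "subspace_of W (dual A)" and A: "is_vspace A"
    and g: "linear_map A (rgt P \<otimes> rgt Q) g"
  defines "f \<equiv> lift (lft Q) (lft P) (dual A) (\<lambda>w u.
      (\<lambda>a. if a \<in> carr A then rfun (rgt P) (rgt Q) (pr Q w) (pr P u) (g a) else 0))"
  assumes im: "f ` carr (lft Q \<otimes> lft P) \<subseteq> carr W"
  shows "adj (Q \<odot> P) (funpair W A) f g"
proof -
  let ?\<beta> = "\<lambda>w u a. if a \<in> carr A then rfun (rgt P) (rgt Q) (pr Q w) (pr P u) (g a) else 0"
  have bil: "bilinear_map (lft Q) (lft P) (dual A) ?\<beta>"
  proof (rule bilinear_map_dualI[OF _ _ is_vspace_lft[OF Q] is_vspace_lft[OF P]])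
    fix w u assume w: "w \<in> carr (lft Q)" and u: "u \<in> carr (lft P)"
    have "linear_map A ground (?\<beta> w u)"
      by (rule linear_map_cong[OF A linear_map_comp[OF g
              linear_map_rfun[OF linear_map_pr[OF Q w] linear_map_pr[OF P u]]]]) simp
    then show "?\<beta> w u \<in> carr (dual A)" by (simp add: in_dual_iff)
  next
    fix a assume a: "a \<in> carr A"
    then show "bilinear_map (lft Q) (lft P) ground (\<lambda>w u. ?\<beta> w u a)"
      using bilinear_map_rfun[OF is_vspace_lft[OF Q] is_vspace_lft[OF P] bilinear_map_pr[OF Q]
          bilinear_map_pr[OF P] linear_map_in[OF g a]] by simp
  qed
  have lin: "linear_map (lft Q \<otimes> lft P) (dual A) f"
    unfolding f_def by (rule linear_map_lift[OF is_vspace_dual bil])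
  have "linear_map (lft Q \<otimes> lft P) W f"
    using lin im W by (auto simp: linear_map_def subspace_of_def)
  then show ?thesis
    using g lift_tens[OF is_vspace_dual bil]
    by (intro adj_tensI[OF Q P is_pairing_funpair[OF W A]]) (simp_all add: f_def)
qed

text \<open>The dual braidings split these four arguments between their two lifts either as \<open>x, y | c, d\<close> or as
  \<open>x, d | y, c\<close>.\<close>

lemma quadrilinear_rfun:
  fixes A :: "('k::field, 'a::ab_group_add) vspace" and B :: "('k, 'b::ab_group_add) vspace"
  assumes X: "is_vspace X" and Y: "is_vspace Y"
    and p: "bilinear_map X B ground p" and q: "bilinear_map Y A ground q"
    and S: "linear_map (C \<otimes> D) (A \<otimes> B) S"
  shows quadrilinear_rfun_xy: "\<And>c d. c \<in> carr C \<Longrightarrow> d \<in> carr D \<Longrightarrow>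
      bilinear_map X Y ground (\<lambda>x y. rfun A B (p x) (q y) (S (tens C D c d)))"
    and quadrilinear_rfun_cd: "\<And>x y. x \<in> carr X \<Longrightarrow> y \<in> carr Y \<Longrightarrow>
      bilinear_map C D ground (\<lambda>c d. rfun A B (p x) (q y) (S (tens C D c d)))"
    and quadrilinear_rfun_xd: "\<And>y c. y \<in> carr Y \<Longrightarrow> c \<in> carr C \<Longrightarrow>
      bilinear_map X D ground (\<lambda>x d. rfun A B (p x) (q y) (S (tens C D c d)))"
    and quadrilinear_rfun_yc: "\<And>x d. x \<in> carr X \<Longrightarrow> d \<in> carr D \<Longrightarrow>
      bilinear_map Y C ground (\<lambda>y c. rfun A B (p x) (q y) (S (tens C D c d)))"
proof -
  let ?g = "\<lambda>x y c d. rfun A B (p x) (q y) (S (tens C D c d))"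
  note b = bilinear_map_rfun[OF X Y p q linear_map_in[OF S tens_in]]
  note l = linear_map_rfun[OF bilinear_map_right[OF p] bilinear_map_right[OF q]]
  have 1: "linear_map X ground (\<lambda>x. ?g x y c d)" if "y \<in> carr Y" "c \<in> carr C" "d \<in> carr D" for y c d
    by (rule bilinear_map_left[OF b[OF that(2,3)] that(1)])
  have 2: "linear_map Y ground (\<lambda>y. ?g x y c d)" if "x \<in> carr X" "c \<in> carr C" "d \<in> carr D" for x c d
    by (rule bilinear_map_right[OF b[OF that(2,3)] that(1)])
  have 3: "linear_map C ground (\<lambda>c. ?g x y c d)" if "x \<in> carr X" "y \<in> carr Y" "d \<in> carr D" for x y d
    by (rule linear_map_comp[OF linear_map_comp[OF linear_map_tens_left[OF that(3)] S]
          l[OF that(1,2)]])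
  have 4: "linear_map D ground (\<lambda>d. ?g x y c d)" if "x \<in> carr X" "y \<in> carr Y" "c \<in> carr C" for x y c
    by (rule linear_map_comp[OF linear_map_comp[OF linear_map_tens_right[OF that(3)] S]
          l[OF that(1,2)]])
  show "bilinear_map X Y ground (\<lambda>x y. ?g x y c d)" if "c \<in> carr C" "d \<in> carr D" for c d
    using 1 2 that by (intro bilinear_mapI)
  show "bilinear_map C D ground (\<lambda>c d. ?g x y c d)" if "x \<in> carr X" "y \<in> carr Y" for x y
    using 3 4 that by (intro bilinear_mapI)
  show "bilinear_map X D ground (\<lambda>x d. ?g x y c d)" if "y \<in> carr Y" "c \<in> carr C" for y c
    using 1 4 that by (intro bilinear_mapI)
  show "bilinear_map Y C ground (\<lambda>y c. ?g x y c d)" if "x \<in> carr X" "d \<in> carr D" for x d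
    using 2 3 that by (intro bilinear_mapI)
qed

lemma bilinear_map_fun:
  "subspace_of U (dual A) \<Longrightarrow> is_vspace A \<Longrightarrow> bilinear_map U A ground (\<lambda>f. f)"
  using bilinear_map_pr[OF is_pairing_funpair] by simp


section \<open>The dual braidings are transposes\<close>

lemma Psi_UU:
  assumes H: "is_vspace H" and U: "subspace_of U (dual H)"
    and \<Psi>: "linear_map (H \<otimes> H) (H \<otimes> H) \<Psi>"
  shows linear_map_Psi_UU: "linear_map (U \<otimes> U) (dual (H \<otimes> H)) (Psi_UU H \<Psi> U)"
    and Psi_UU_tens: "\<And>f g b a. f \<in> carr U \<Longrightarrow> g \<in> carr U \<Longrightarrow> b \<in> carr H \<Longrightarrow> a \<in> carr H \<Longrightarrow>
      Psi_UU H \<Psi> U (tens U U f g) (tens H H b a) = rfun H H f g (\<Psi> (tens H H a b))"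
proof -
  note vU = U[unfolded subspace_of_def, THEN conjunct1]
  note p = bilinear_map_fun[OF U H]
  note l = lift_lift[OF vU vU H H refl bilinear_map_flip[OF quadrilinear_rfun_cd[OF vU vU p p \<Psi>]]
      quadrilinear_rfun_xy[OF vU vU p p \<Psi>]]
  show "linear_map (U \<otimes> U) (dual (H \<otimes> H)) (Psi_UU H \<Psi> U)"
    unfolding Psi_UU_def by (rule l(1); assumption)
  show "Psi_UU H \<Psi> U (tens U U f g) (tens H H b a) = rfun H H f g (\<Psi> (tens H H a b))"
    if "f \<in> carr U" "g \<in> carr U" "b \<in> carr H" "a \<in> carr H" for f g b a
    unfolding Psi_UU_def by (rule l(2)) (use that in simp_all)
qed

lemma Psi_UV_tens:
  assumes H: "is_vspace H" and V: "is_vspace V" and U: "subspace_of U (dual H)"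
    and S: "linear_map (V \<otimes> H) (H \<otimes> V) (inv_on H V \<Theta>)"
    and "f \<in> carr U" and "v \<in> carr V" and "e \<in> carr (dual V)" and "a \<in> carr H"
  shows "Psi_UV H V \<Theta> U (tens U V f v) (tens (dual V) H e a) =
    rfun H V e f (inv_on H V \<Theta> (tens V H v a))"
proof -
  note vU = U[unfolded subspace_of_def, THEN conjunct1] and vV = is_vspace_dual[of V]
  note p = bilinear_map_fun[OF U H] and q = bilinear_map_fun[OF subspace_of_dual_self V]
  note b = quadrilinear_rfun_xd[OF vV vU q p S] quadrilinear_rfun_yc[OF vV vU q p S]
  show ?thesis
    unfolding Psi_UV_def by (rule lift_lift_tens[OF vU V vV H refl b]) (use assms in simp_all)
qed

lemma Psi_VU_tens:
  assumes H: "is_vspace H" and V: "is_vspace V" and U: "subspace_of U (dual H)"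
    and S: "linear_map (H \<otimes> V) (V \<otimes> H) (inv_on V H \<Theta>)"
    and "v \<in> carr V" and "f \<in> carr U" and "a \<in> carr H" and "e \<in> carr (dual V)"
  shows "Psi_VU H V \<Theta> U (tens V U v f) (tens H (dual V) a e) =
    rfun V H f e (inv_on V H \<Theta> (tens H V a v))"
proof -
  note vU = U[unfolded subspace_of_def, THEN conjunct1] and vV = is_vspace_dual[of V]
  note p = bilinear_map_fun[OF U H] and q = bilinear_map_fun[OF subspace_of_dual_self V]
  note b = bilinear_map_flip[OF quadrilinear_rfun_yc[OF vU vV p q S]]
    bilinear_map_flip[OF quadrilinear_rfun_xd[OF vU vV p q S]]
  show ?thesis
    unfolding Psi_VU_def by (rule lift_lift_tens[OF V vU H vV refl b]) (use assms in simp_all)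
qed

text \<open>The definition of \<^const>\<open>Psi_WU\<close> makes a detour through the element \<open>G\<close> of \<open>V \<otimes> U\<close> that represents
  \<open>Psi_UV (f \<otimes> v)\<close>. Pairing \<open>G\<close> with \<open>e\<close> and \<open>a\<close> gives back the defining formula of \<^const>\<open>Psi_UV\<close>, now read
  as a formula in \<open>e\<close> and \<open>f\<close>. Thus \<^const>\<open>Psi_WU\<close> is the transpose of the inverse braiding.\<close>

lemma Psi_WU:
  assumes H: "is_vspace H" and V: "is_vspace V"
    and U: "subspace_of U (dual H)" and W: "subspace_of W (dual V)"
    and S: "linear_map (V \<otimes> H) (H \<otimes> V) (inv_on H V \<Theta>)"
    and bij: "bij_onto U V (emb_VU_L H V U) (Psi_UV H V \<Theta> U)"
  shows linear_map_Psi_WU: "linear_map (W \<otimes> U) (dual (H \<otimes> V)) (Psi_WU H V \<Theta> U W)"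
    and Psi_WU_tens: "\<And>e f a v. e \<in> carr W \<Longrightarrow> f \<in> carr U \<Longrightarrow> a \<in> carr H \<Longrightarrow> v \<in> carr V \<Longrightarrow>
      Psi_WU H V \<Theta> U W (tens W U e f) (tens H V a v) = rfun H V e f (inv_on H V \<Theta> (tens V H v a))"
proof -
  note vU = U[unfolded subspace_of_def, THEN conjunct1]
    and vW = W[unfolded subspace_of_def, THEN conjunct1] and vV = is_vspace_dual[of V]
  note p = bilinear_map_fun[OF U H] and q = bilinear_map_fun[OF W V]
  note em = emb[OF V vU vV H bilinear_map_ev p, folded emb_VU_L_def[of H V U]]
  have eval: "rfun V U (ev a) e (pull U V (emb_VU_L H V U) (Psi_UV H V \<Theta> U) (tens U V f v)) =
      rfun H V e f (inv_on H V \<Theta> (tens V H v a))"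
    if e: "e \<in> carr W" and f: "f \<in> carr U" and a: "a \<in> carr H" and v: "v \<in> carr V" for e f a v
  proof -
    have e': "e \<in> carr (dual V)" using e W by (auto simp: subspace_of_def)
    let ?G = "pull U V (emb_VU_L H V U) (Psi_UV H V \<Theta> U) (tens U V f v)"
    note G = pull_in[OF bij tens_in[OF f v]] and G_eq = emb_pull[OF bij tens_in[OF f v]]
    have la: "linear_map U ground (ev a)" using bilinear_map_left[OF p a] by (simp add: ev_def[abs_def])
    have le: "linear_map V ground e" using e' by (simp add: in_dual_iff)
    have "rfun V U (ev a) e ?G = emb_VU_L H V U ?G (tens (dual V) H e a)"
      by (rule tensor_ext[OF linear_map_rfun[OF la le] linear_map_eval[OF em(1)] _ G])
        (simp add: rfun_tens[OF la le] em(2) e' a, simp add: ev_def mult.commute)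
    also have "\<dots> = Psi_UV H V \<Theta> U (tens U V f v) (tens (dual V) H e a)" by (simp add: G_eq)
    also have "\<dots> = rfun H V e f (inv_on H V \<Theta> (tens V H v a))"
      by (rule Psi_UV_tens[OF H V U S f v e' a])
    finally show ?thesis .
  qed
  note l = lift_lift[OF vW vU H V eval bilinear_map_flip[OF quadrilinear_rfun_cd[OF vW vU q p S]]
      quadrilinear_rfun_xy[OF vW vU q p S]]
  show "linear_map (W \<otimes> U) (dual (H \<otimes> V)) (Psi_WU H V \<Theta> U W)"
    unfolding Psi_WU_def by (rule l(1); assumption)
  show "Psi_WU H V \<Theta> U W (tens W U e f) (tens H V a v) = rfun H V e f (inv_on H V \<Theta> (tens V H v a))"
    if "e \<in> carr W" "f \<in> carr U" "a \<in> carr H" "v \<in> carr V" for e f a v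
    unfolding Psi_WU_def by (rule l(2)) (use that in simp_all)
qed

text \<open>The mirror image of \<open>Psi_WU\<close>.\<close>

lemma Psi_UW:
  assumes H: "is_vspace H" and V: "is_vspace V"
    and U: "subspace_of U (dual H)" and W: "subspace_of W (dual V)"
    and S: "linear_map (H \<otimes> V) (V \<otimes> H) (inv_on V H \<Theta>)"
    and bij: "bij_onto V U (emb_UV_R H V U) (Psi_VU H V \<Theta> U)"
  shows linear_map_Psi_UW: "linear_map (U \<otimes> W) (dual (V \<otimes> H)) (Psi_UW H V \<Theta> U W)"
    and Psi_UW_tens: "\<And>f e v a. f \<in> carr U \<Longrightarrow> e \<in> carr W \<Longrightarrow> v \<in> carr V \<Longrightarrow> a \<in> carr H \<Longrightarrow>
      Psi_UW H V \<Theta> U W (tens U W f e) (tens V H v a) = rfun V H f e (inv_on V H \<Theta> (tens H V a v))"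
proof -
  note vU = U[unfolded subspace_of_def, THEN conjunct1]
    and vW = W[unfolded subspace_of_def, THEN conjunct1] and vV = is_vspace_dual[of V]
  note p = bilinear_map_fun[OF U H] and q = bilinear_map_fun[OF W V]
  note em = emb[OF vU V H vV p bilinear_map_ev, folded emb_UV_R_def[of H V U]]
  have eval: "rfun U V e (ev a) (pull V U (emb_UV_R H V U) (Psi_VU H V \<Theta> U) (tens V U v f)) =
      rfun V H f e (inv_on V H \<Theta> (tens H V a v))"
    if f: "f \<in> carr U" and e: "e \<in> carr W" and v: "v \<in> carr V" and a: "a \<in> carr H" for f e v a
  proof -
    have e': "e \<in> carr (dual V)" using e W by (auto simp: subspace_of_def)
    let ?G = "pull V U (emb_UV_R H V U) (Psi_VU H V \<Theta> U) (tens V U v f)"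
    note G = pull_in[OF bij tens_in[OF v f]] and G_eq = emb_pull[OF bij tens_in[OF v f]]
    have la: "linear_map U ground (ev a)" using bilinear_map_left[OF p a] by (simp add: ev_def[abs_def])
    have le: "linear_map V ground e" using e' by (simp add: in_dual_iff)
    have "rfun U V e (ev a) ?G = emb_UV_R H V U ?G (tens H (dual V) a e)"
      by (rule tensor_ext[OF linear_map_rfun[OF le la] linear_map_eval[OF em(1)] _ G])
        (simp add: rfun_tens[OF le la] em(2) e' a, simp add: ev_def mult.commute)
    also have "\<dots> = Psi_VU H V \<Theta> U (tens V U v f) (tens H (dual V) a e)" by (simp add: G_eq)
    also have "\<dots> = rfun V H f e (inv_on V H \<Theta> (tens H V a v))"
      by (rule Psi_VU_tens[OF H V U S v f a e'])
    finally show ?thesis .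
  qed
  note l = lift_lift[OF vU vW V H eval bilinear_map_flip[OF quadrilinear_rfun_cd[OF vU vW p q S]]
      quadrilinear_rfun_xy[OF vU vW p q S]]
  show "linear_map (U \<otimes> W) (dual (V \<otimes> H)) (Psi_UW H V \<Theta> U W)"
    unfolding Psi_UW_def by (rule l(1); assumption)
  show "Psi_UW H V \<Theta> U W (tens U W f e) (tens V H v a) = rfun V H f e (inv_on V H \<Theta> (tens H V a v))"
    if "f \<in> carr U" "e \<in> carr W" "v \<in> carr V" "a \<in> carr H" for f e v a
    unfolding Psi_UW_def by (rule l(2)) (use that in simp_all)
qed

section \<open>Modules of functionals\<close>

text \<open>\<^const>\<open>Psi_UU\<close> is the transpose of \<open>\<Psi>\<close>, so its inverse is the transpose of the inverse.\<close>

lemma dual_braiding: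
  assumes U: "subspace_of U (dual H)" and H: "braided_coalgebra H \<Delta> \<epsilon> \<Psi>"
    and bij: "bij_onto U U (emb_UU H U) (Psi_UU H \<Psi> U)"
  defines "P \<equiv> funpair U H" and "\<Phi> \<equiv> inv_on U U (pull U U (emb_UU H U) (Psi_UU H \<Psi> U))"
  shows adj_dual_braiding: "adj (P \<odot> P) (P \<odot> P) \<Phi> (inv_on H H \<Psi>)"
    and bij_dual_braiding: "bij_betw \<Phi> (carr (U \<otimes> U)) (carr (U \<otimes> U))"
proof -
  have vH: "is_vspace H" and \<Psi>: "linear_bij (H \<otimes> H) (H \<otimes> H) \<Psi>"
    using H unfolding braided_coalgebra_def braiding_def by blast+
  have \<Psi>l: "linear_map (H \<otimes> H) (H \<otimes> H) \<Psi>" using \<Psi> by (simp add: linear_bij_def)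
  have P: "is_pairing P" unfolding P_def by (rule is_pairing_funpair[OF U vH])
  have [simp]: "lft P = U" "rgt P = H" "pr P = (\<lambda>f. f)" by (simp_all add: P_def)
  let ?\<Phi> = "pull U U (emb_UU H U) (Psi_UU H \<Psi> U)"
  have a: "adj (P \<odot> P) (P \<odot> P) ?\<Phi> \<Psi>" and b: "bij_betw ?\<Phi> (carr (U \<otimes> U)) (carr (U \<otimes> U))"
    using adj_pull[OF P P, of "Psi_UU H \<Psi> U" \<Psi>] bij linear_map_Psi_UU[OF vH U \<Psi>l] \<Psi>l
      Psi_UU_tens[OF vH U \<Psi>l] by (simp_all add: emb_UU_def)
  have lb: "linear_bij (U \<otimes> U) (U \<otimes> U) ?\<Phi>" using adj_linear_left[OF a] b by (simp add: linear_bij_def)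
  show "adj (P \<odot> P) (P \<odot> P) \<Phi> (inv_on H H \<Psi>)"
    using adj_inv_into[OF is_pairing_ptensor[OF P P] is_pairing_ptensor[OF P P] a] lb \<Psi>
    by (simp add: \<Phi>_def inv_on_def)
  show "bij_betw \<Phi> (carr (U \<otimes> U)) (carr (U \<otimes> U))"
    unfolding \<Phi>_def inv_on_def by (rule bij_betw_inv_into[OF b])
qed

lemma adj_dual_mult:
  assumes U: "subspace_of U (dual H)" and H: "braided_coalgebra H \<Delta> \<epsilon> \<Psi>"
    and im: "dual_mult H \<Delta> \<Psi> U ` carr (U \<otimes> U) \<subseteq> carr U"
  shows "adj (funpair U H \<odot> funpair U H) (funpair U H) (dual_mult H \<Delta> \<Psi> U)
    (\<lambda>a. inv_on H H \<Psi> (\<Delta> a))"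
proof -
  have vH: "is_vspace H" and \<Psi>: "linear_bij (H \<otimes> H) (H \<otimes> H) \<Psi>" and \<Delta>: "linear_map H (H \<otimes> H) \<Delta>"
    using H unfolding braided_coalgebra_def braiding_def coalgebra_def by blast+
  note P = is_pairing_funpair[OF U vH]
  show ?thesis
    using adj_lift_dual[OF P P U vH, of "\<lambda>a. inv_on H H \<Psi> (\<Delta> a)"]
      linear_map_comp[OF \<Delta> linear_map_inv_on[OF \<Psi>]] im by (simp add: dual_mult_def cong: if_cong)
qed

lemma dual_right_module:
  assumes U: "subspace_of U (dual H)" and W: "subspace_of W (dual V)"
    and com: "braided_right_comodule H \<Delta> \<epsilon> \<Psi> V \<Theta> \<rho>"
    and UU: "bij_onto U U (emb_UU H U) (Psi_UU H \<Psi> U)"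
    and UV: "bij_onto U V (emb_VU_L H V U) (Psi_UV H V \<Theta> U)"
    and WU: "bij_onto W U (emb_UW_L H V U W) (Psi_WU H V \<Theta> U W)"
    and m: "dual_mult H \<Delta> \<Psi> U ` carr (U \<otimes> U) \<subseteq> carr U"
    and \<nu>: "nu_R H V \<Theta> \<rho> U W ` carr (W \<otimes> U) \<subseteq> carr W"
  shows "braided_right_module U (dual_mult H \<Delta> \<Psi> U) (if \<epsilon> \<in> carr U then Some \<epsilon> else None)
    (inv_on U U (pull U U (emb_UU H U) (Psi_UU H \<Psi> U)))
    W (pull W U (emb_UW_L H V U W) (Psi_WU H V \<Theta> U W)) (nu_R H V \<Theta> \<rho> U W)"
proof -
  have H: "braided_coalgebra H \<Delta> \<epsilon> \<Psi>" and vH: "is_vspace H" and vV: "is_vspace V"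
    and \<Theta>: "linear_bij (H \<otimes> V) (V \<otimes> H) \<Theta>" and \<rho>: "linear_map V (V \<otimes> H) \<rho>"
    using com unfolding braided_right_comodule_def left_braided_def braiding_def by blast+
  let ?P = "funpair U H" and ?Q = "funpair W V"
  note P = is_pairing_funpair[OF U vH] and Q = is_pairing_funpair[OF W vV]
  note S = linear_map_inv_on[OF \<Theta>]
  have \<Xi>: "adj (?Q \<odot> ?P) (?P \<odot> ?Q) (pull W U (emb_UW_L H V U W) (Psi_WU H V \<Theta> U W)) (inv_on H V \<Theta>)"
    and b\<Xi>: "bij_betw (pull W U (emb_UW_L H V U W) (Psi_WU H V \<Theta> U W)) (carr (W \<otimes> U)) (carr (U \<otimes> W))"
    using adj_pull[OF P Q, of "Psi_WU H V \<Theta> U W" "inv_on H V \<Theta>"] WU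
      linear_map_Psi_WU[OF vH vV U W S UV] S Psi_WU_tens[OF vH vV U W S UV]
    by (simp_all add: emb_UW_L_def)
  have \<nu>': "adj (?Q \<odot> ?P) ?Q (nu_R H V \<Theta> \<rho> U W) (\<lambda>v. inv_on H V \<Theta> (\<rho> v))"
    using adj_lift_dual[OF P Q W vV, of "\<lambda>v. inv_on H V \<Theta> (\<rho> v)"]
      linear_map_comp[OF \<rho> S] \<nu> by (simp add: nu_R_def tfun_eq_rfun cong: if_cong)
  show ?thesis
    by (rule dual_braided_right_module[OF P Q, unfolded funpair_simps, OF com
          adj_dual_braiding[OF U H UU] bij_dual_braiding[OF U H UU] \<Xi> b\<Xi> adj_dual_mult[OF U H m] \<nu>'])
      (simp split: if_splits)
qed

lemma dual_left_module:
  assumes U: "subspace_of U (dual H)" and W: "subspace_of W (dual V)"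
    and com: "braided_left_comodule H \<Delta> \<epsilon> \<Psi> V \<Theta> \<rho>"
    and UU: "bij_onto U U (emb_UU H U) (Psi_UU H \<Psi> U)"
    and VU: "bij_onto V U (emb_UV_R H V U) (Psi_VU H V \<Theta> U)"
    and UW: "bij_onto U W (emb_WU_R H V U W) (Psi_UW H V \<Theta> U W)"
    and m: "dual_mult H \<Delta> \<Psi> U ` carr (U \<otimes> U) \<subseteq> carr U"
    and \<nu>: "nu_L H V \<Theta> \<rho> U W ` carr (U \<otimes> W) \<subseteq> carr W"
  shows "braided_left_module U (dual_mult H \<Delta> \<Psi> U) (if \<epsilon> \<in> carr U then Some \<epsilon> else None)
    (inv_on U U (pull U U (emb_UU H U) (Psi_UU H \<Psi> U)))
    W (pull U W (emb_WU_R H V U W) (Psi_UW H V \<Theta> U W)) (nu_L H V \<Theta> \<rho> U W)"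
proof -
  have H: "braided_coalgebra H \<Delta> \<epsilon> \<Psi>" and vH: "is_vspace H" and vV: "is_vspace V"
    and \<Theta>: "linear_bij (V \<otimes> H) (H \<otimes> V) \<Theta>" and \<rho>: "linear_map V (H \<otimes> V) \<rho>"
    using com unfolding braided_left_comodule_def right_braided_def braiding_def by blast+
  let ?P = "funpair U H" and ?Q = "funpair W V"
  note P = is_pairing_funpair[OF U vH] and Q = is_pairing_funpair[OF W vV]
  note S = linear_map_inv_on[OF \<Theta>]
  have \<Xi>: "adj (?P \<odot> ?Q) (?Q \<odot> ?P) (pull U W (emb_WU_R H V U W) (Psi_UW H V \<Theta> U W)) (inv_on V H \<Theta>)"
    and b\<Xi>: "bij_betw (pull U W (emb_WU_R H V U W) (Psi_UW H V \<Theta> U W)) (carr (U \<otimes> W)) (carr (W \<otimes> U))"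
    using adj_pull[OF Q P, of "Psi_UW H V \<Theta> U W" "inv_on V H \<Theta>"] UW
      linear_map_Psi_UW[OF vH vV U W S VU] S Psi_UW_tens[OF vH vV U W S VU]
    by (simp_all add: emb_WU_R_def)
  have \<nu>': "adj (?P \<odot> ?Q) ?Q (nu_L H V \<Theta> \<rho> U W) (\<lambda>v. inv_on V H \<Theta> (\<rho> v))"
    using adj_lift_dual[OF Q P W vV, of "\<lambda>v. inv_on V H \<Theta> (\<rho> v)"]
      linear_map_comp[OF \<rho> S] \<nu> by (simp add: nu_L_def tfun_eq_rfun cong: if_cong)
  show ?thesis
    by (rule dual_braided_left_module[OF P Q, unfolded funpair_simps, OF com
          adj_dual_braiding[OF U H UU] bij_dual_braiding[OF U H UU] \<Xi> b\<Xi> adj_dual_mult[OF U H m] \<nu>'])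
      (simp split: if_splits)
qed

theorem proposition5p8:
  fixes H :: "('k::field, 'h::ab_group_add) vspace"
    and V :: "('k, 'v::ab_group_add) vspace"
    and U :: "('k, 'h \<Rightarrow> 'k) vspace"
    and W :: "('k, 'v \<Rightarrow> 'k) vspace"
    and \<Delta> :: "'h \<Rightarrow> ('k, 'h, 'h) tensor"
    and \<epsilon> :: "'h \<Rightarrow> 'k"
    and \<Psi>HH :: "('k, 'h, 'h) tensor \<Rightarrow> ('k, 'h, 'h) tensor"
    and \<Psi>HV :: "('k, 'h, 'v) tensor \<Rightarrow> ('k, 'v, 'h) tensor"
    and \<rho>R :: "'v \<Rightarrow> ('k, 'v, 'h) tensor"
    and \<Psi>VH :: "('k, 'v, 'h) tensor \<Rightarrow> ('k, 'h, 'v) tensor"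
    and \<rho>L :: "'v \<Rightarrow> ('k, 'h, 'v) tensor"
  shows
    "(braided_coalgebra H \<Delta> \<epsilon> \<Psi>HH \<and>
      braided_right_comodule H \<Delta> \<epsilon> \<Psi>HH V \<Psi>HV \<rho>R \<and>
      nondegenerate_subspace U H \<and>
      nondegenerate_subspace W V \<and>
      bij_onto U U (emb_UU H U) (Psi_UU H \<Psi>HH U) \<and>
      bij_onto H W (emb_WH_L H V W) (Psi_HW H V \<Psi>HV W) \<and>
      bij_onto U V (emb_VU_L H V U) (Psi_UV H V \<Psi>HV U) \<and>
      bij_onto W U (emb_UW_L H V U W) (Psi_WU H V \<Psi>HV U W) \<and>
      dual_mult H \<Delta> \<Psi>HH U ` carr (U \<otimes> U) \<subseteq> carr U \<and>
      nu_R H V \<Psi>HV \<rho>R U W ` carr (W \<otimes> U) \<subseteq> carr W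
      \<longrightarrow>
      braided_right_module U (dual_mult H \<Delta> \<Psi>HH U) (if \<epsilon> \<in> carr U then Some \<epsilon> else None)
        (inv_on U U (pull U U (emb_UU H U) (Psi_UU H \<Psi>HH U)))
        W (pull W U (emb_UW_L H V U W) (Psi_WU H V \<Psi>HV U W))
        (nu_R H V \<Psi>HV \<rho>R U W))
     \<and>
     (braided_coalgebra H \<Delta> \<epsilon> \<Psi>HH \<and>
      braided_left_comodule H \<Delta> \<epsilon> \<Psi>HH V \<Psi>VH \<rho>L \<and>
      nondegenerate_subspace U H \<and>
      nondegenerate_subspace W V \<and>
      bij_onto U U (emb_UU H U) (Psi_UU H \<Psi>HH U) \<and>
      bij_onto W H (emb_HW_R H V W) (Psi_WH H V \<Psi>VH W) \<and>
      bij_onto V U (emb_UV_R H V U) (Psi_VU H V \<Psi>VH U) \<and>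
      bij_onto U W (emb_WU_R H V U W) (Psi_UW H V \<Psi>VH U W) \<and>
      dual_mult H \<Delta> \<Psi>HH U ` carr (U \<otimes> U) \<subseteq> carr U \<and>
      nu_L H V \<Psi>VH \<rho>L U W ` carr (U \<otimes> W) \<subseteq> carr W
      \<longrightarrow>
      braided_left_module U (dual_mult H \<Delta> \<Psi>HH U) (if \<epsilon> \<in> carr U then Some \<epsilon> else None)
        (inv_on U U (pull U U (emb_UU H U) (Psi_UU H \<Psi>HH U)))
        W (pull U W (emb_WU_R H V U W) (Psi_UW H V \<Psi>VH U W))
        (nu_L H V \<Psi>VH \<rho>L U W))"
  unfolding nondegenerate_subspace_def
  by (intro conjI impI; elim conjE; (rule dual_right_module dual_left_module; assumption))

end
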